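(* Let $H = H(q)$ be a function of the prime $q$, with $1 \le H(q) \le q$, satisfying $\frac{\log(q/H)}{\log q} \rightarrow 0$ and $H = o(q)$ as the prime $q \rightarrow \infty$. Then there exists a subset $\mathcal{P}_{H}$ of the primes which satisfies $$ \frac{\#(\mathcal{P}_{H} \cap [Q,2Q])}{\#\{ Q \leq q \leq 2Q : \; q \text{ prime}\}} \geq 1 - O\left(e^{-\min_{Q \leq q \leq 2Q}\log^{3/4}(q/H(q))}\right) $$ for all $Q = 2^j$, $j \in \mathbb{N}$, and such that, if $\chi = \left(\frac{\cdot}{q}\right)$ is the Legendre symbol modulo $q$ and $X$ is uniformly distributed on $\{0,1,\dots,q-1\}$, we have the convergence in distribution $$ \frac{S_{\chi,H}(X)}{\sqrt{H}} \stackrel{d}{\rightarrow} N(0,1) \quad \text{as } q \rightarrow \infty, \; q \in \mathcal{P}_{H}. $$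
   Context: For a Dirichlet character $\chi$ modulo a prime $q$, a real number $H$ with $1 \le H \le q$, and $x \in \{0,1,\dots,q-1\}$, define $S_{\chi,H}(x) := \sum_{x < n \leq x+H} \chi(n)$ (sum over integers $n$). The minimum $\min_{Q \le q \le 2Q}$ is over primes $q \in [Q,2Q]$; $\log^{3/4}(y) = (\log y)^{3/4}$. The implied constant in $O(\cdot)$ does not depend on $Q$. $N(0,1)$ is the standard real Gaussian distribution. *)

theory Defs
  imports
    "HOL-Probability.Probability"
    "HOL-Number_Theory.Number_Theory"
    "HOL-Library.Landau_Symbols"
begin

definition at_top_within :: "nat set \<Rightarrow> nat filter" where
  "at_top_within A = inf at_top (principal A)"

lemma tendsto_at_top_within_iff:
  fixes f :: "nat \<Rightarrow> real"
  shows "(f \<longlongrightarrow> l) (at_top_within A) \<longleftrightarrow>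
    (\<forall>e>0. \<exists>N. \<forall>q\<ge>N. q \<in> A \<longrightarrow> \<bar>f q - l\<bar> < e)"
  by (simp add: tendsto_iff at_top_within_def eventually_inf_principal
      eventually_sequentially dist_real_def)

text \<open>Convergence in distribution of real laws along an arbitrary filter; the library's
  \<^const>\<open>weak_conv_m\<close> is the case of \<^const>\<open>sequentially\<close>.\<close>

definition weak_conv_filter :: "('i \<Rightarrow> real measure) \<Rightarrow> real measure \<Rightarrow> 'i filter \<Rightarrow> bool" where
  "weak_conv_filter \<mu> M F \<longleftrightarrow>
    (\<forall>t. isCont (cdf M) t \<longrightarrow> ((\<lambda>i. cdf (\<mu> i) t) \<longlongrightarrow> cdf M t) F)"

lemma weak_conv_filter_sequentially:
  "weak_conv_filter \<mu> M sequentially \<longleftrightarrow> weak_conv_m \<mu> M"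
  by (simp add: weak_conv_filter_def weak_conv_m_def weak_conv_def)

definition short_sum :: "(int \<Rightarrow> 'a::comm_monoid_add) \<Rightarrow> real \<Rightarrow> int \<Rightarrow> 'a" where
  "short_sum f H x = (\<Sum>n | x < n \<and> real_of_int n \<le> real_of_int x + H. f n)"

text \<open>The index set above is finite, so the sum is never the default value \<open>0\<close> of
  an infinite sum.\<close>

lemma short_sum_altdef: "short_sum f H x = (\<Sum>n\<in>{x<..x + \<lfloor>H\<rfloor>}. f n)"
proof -
  have "{n. x < n \<and> real_of_int n \<le> real_of_int x + H} = {x<..x + \<lfloor>H\<rfloor>}"
    by (auto; linarith)
  then show ?thesis by (simp add: short_sum_def)
qed

definition uniform_residue :: "nat \<Rightarrow> int pmf" where
  "uniform_residue q = pmf_of_set {0..<int q}"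

text \<open>The law of \<open>S(X) / sqrt H\<close> for the Legendre symbol modulo \<open>q\<close> and uniform \<open>X\<close>.\<close>

definition legendre_sum_law :: "nat \<Rightarrow> real \<Rightarrow> real measure" where
  "legendre_sum_law q H =
    distr (measure_pmf (uniform_residue q)) borel
      (\<lambda>x. real_of_int (short_sum (\<lambda>n. Legendre n (int q)) H x) / sqrt H)"

definition primes_dyadic :: "nat \<Rightarrow> nat set" where
  "primes_dyadic Q = {q. prime q \<and> Q \<le> q \<and> q \<le> 2 * Q}"

end

theory Submission
  imports Defs "HOL-Computational_Algebra.Squarefree" "HOL-Real_Asymp.Real_Asymp"
begin

text \<open>
  Expand the Legendre symbol by its Gauss sum: up to a small error in \<open>L\<^sup>2\<close>, the normalised sum
  is the trigonometric polynomial \<open>M(x) = \<Sum> w b(k) (k/q) e(kx/q)\<close> over \<open>0 < |k| \<le> T q/H\<close>, with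
  \<open>|b(k)| \<le> sqrt (H/q)\<close> and \<open>|w| = 1\<close>. Its \<open>m\<close>-th moment in \<open>x\<close> is a sum over tuples with
  \<open>k\<^sub>1 + ... + k\<^sub>m = 0\<close>. Pairing \<open>k\<^sub>1\<close> with some \<open>k\<^sub>j = -k\<^sub>1\<close> yields the Gaussian recursion
  \<open>\<mu>\<^sub>m = (m - 1) \<mu>\<^sub>2 \<mu>\<^sub>m\<^sub>-\<^sub>2\<close>, up to the sum over tuples in which the number of such \<open>j\<close> is not \<open>1\<close>.

  The mean square of this defect over primes \<open>q\<close> in \<open>[Q, 2Q]\<close> is estimated with a
  Selberg-type majorant of the primes and quadratic reciprocity, so that only pairs of tuples whose
  total product is a square contribute. Writing \<open>|k\<^sub>i| = g\<^sub>i\<^sub>i\<^sup>2 \<Prod> g\<^sub>i\<^sub>j\<close> with symmetric \<open>g\<close>, there are about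
  \<open>N\<^sup>m\<close> such pairs of tuples up to \<open>N\<close>; in the defect the linear relation determines one of the large
  parameters \<open>g\<^sub>1\<^sub>j\<close>, which saves a power of \<open>N\<close>. Hence for fixed \<open>m\<close> the exceptional primes have
  relative density at most \<open>(q/H) powr -c\<close>, and letting \<open>m\<close> and \<open>T\<close> grow slowly gives the theorem.
\<close>

section \<open>Pairing multiplicatively dependent tuples\<close>

text \<open>A large sieve over primes needs coefficients that are the same for every
  \<open>q\<close> of a dyadic block, but \<open>H\<close> is an arbitrary function of
  \<open>q\<close> and the Gauss-sum phase \<open>w\<close> varies with \<open>q\<close> as well.
  Taking absolute values removes \<open>w\<close>. The density \<open>H / q\<close> is replaced by a
  nearby grid value \<open>exp (- sqrt n)\<close>, and the exceptional sets of all \<open>n\<close>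
  that occur in a block are united.

  At the grid point \<open>n\<close> the exceptional density for the \<open>m\<close>-th moment is
  about \<open>exp (- c * sqrt n)\<close>, where \<open>c = c(m) > 0\<close> shrinks as
  \<open>m\<close> grows. Since \<open>q / H\<close> is about \<open>exp (sqrt n)\<close>, the
  target is \<open>exp (- n powr (3/8))\<close>. As 3/8 < 1/2, every \<open>c\<close> wins once
  \<open>n\<close> is large in terms of \<open>m\<close>, with a factor \<open>n ^ 3\<close> to
  spare for the union. This is the room in which \<open>m\<close> and \<open>T\<close> can grow.

  The error term of the large sieve loses a power of \<open>q / H\<close> that depends on
  \<open>m\<close> against a fixed power of \<open>Q\<close>; here
  \<open>ln (q / H) = o(ln q)\<close> enters. \<open>H = o(q)\<close> makes \<open>n\<close> tend to
  infinity; it also makes the variance, which is about \<open>1 - H / q\<close>, tend to 1.\<close>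

definition incid :: "nat \<times> nat \<Rightarrow> nat \<Rightarrow> nat" where
  "incid u i = of_bool (fst u = i) + of_bool (snd u = i)"

text \<open>Each unordered pair is stored once, diagonal included, so that a symmetric matrix
  \<open>g\<close> is a function on \<open>upairs I\<close> without a symmetry condition.\<close>

definition upairs :: "nat set \<Rightarrow> (nat \<times> nat) set" where
  "upairs I = {u \<in> I \<times> I. fst u \<le> snd u}"

lemma finite_upairs [simp]: "finite I \<Longrightarrow> finite (upairs I)"
  by (simp add: upairs_def)

lemma sum_incid: "finite I \<Longrightarrow> u \<in> upairs I \<Longrightarrow> (\<Sum>i\<in>I. incid u i) = 2"
  by (auto simp: incid_def upairs_def sum.distrib of_bool_def)

lemma prod_fun_upd_mult:
  fixes g :: "'a \<Rightarrow> 'b::comm_monoid_mult"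
  assumes "finite U" "u0 \<in> U"
  shows "(\<Prod>u\<in>U. (g(u0 := g u0 * p)) u ^ e u) = (\<Prod>u\<in>U. g u ^ e u) * p ^ e u0"
proof -
  have "(\<Prod>u\<in>U. (g(u0 := g u0 * p)) u ^ e u)
      = (g u0 * p) ^ e u0 * (\<Prod>u\<in>U-{u0}. (g(u0 := g u0 * p)) u ^ e u)"
    using assms by (subst prod.remove[of _ u0]) auto
  also have "(\<Prod>u\<in>U-{u0}. (g(u0 := g u0 * p)) u ^ e u) = (\<Prod>u\<in>U-{u0}. g u ^ e u)"
    by (intro prod.cong) auto
  also have "(g u0 * p) ^ e u0 * (\<Prod>u\<in>U-{u0}. g u ^ e u) =
     (g u0 ^ e u0 * (\<Prod>u\<in>U-{u0}. g u ^ e u)) * p ^ e u0"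
    by (simp add: power_mult_distrib mult_ac)
  also have "g u0 ^ e u0 * (\<Prod>u\<in>U-{u0}. g u ^ e u) = (\<Prod>u\<in>U. g u ^ e u)"
    using assms by (subst (2) prod.remove[of _ u0]) auto
  finally show ?thesis .
qed

text \<open>Induction on the product. If a prime \<open>p\<close> divides \<open>k i\<close>, then
  either \<open>p\<^sup>2\<close> divides \<open>k i\<close> and \<open>p\<close> goes into the
  diagonal parameter \<open>g (i,i)\<close>, or, the product being a square, \<open>p\<close>
  divides another \<open>k j\<close> and goes into \<open>g (i,j)\<close>. In both cases the product
  loses the factor \<open>p\<^sup>2\<close> and remains a square.\<close>

lemma square_parametrization:
  fixes k :: "nat \<Rightarrow> nat"
  assumes "finite I" "\<And>i. i \<in> I \<Longrightarrow> k i > 0" "(\<Prod>i\<in>I. k i) = s\<^sup>2"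
  shows "\<exists>g. (\<forall>u. g u > 0) \<and> (\<forall>i\<in>I. k i = (\<Prod>u\<in>upairs I. g u ^ incid u i))"
  using assms(2,3)
proof (induction "\<Prod>i\<in>I. k i" arbitrary: k s rule: less_induct)
  case (less k s)
  show ?case
  proof (cases "\<forall>i\<in>I. k i = 1")
    case True
    then show ?thesis by (intro exI[of _ "\<lambda>_. 1"]) auto
  next
    case False
    then obtain i where i: "i \<in> I" "k i \<noteq> 1" by auto
    then obtain p where p: "prime p" "p dvd k i" using prime_factor_nat by blast
    have "p dvd (\<Prod>i\<in>I. k i)" using i p assms(1) by (meson dvd_prodI dvd_trans)
    hence "p dvd s" using less.prems(2) p(1) prime_dvd_power_nat by metis
    then obtain s' where s': "s = p * s'" by (elim dvdE)
    have p0: "p > 1" "p > 0" using p(1) prime_gt_1_nat prime_gt_0_nat by auto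
    have "\<exists>u0\<in>upairs I. \<exists>k'. \<forall>l\<in>I. k l = k' l * p ^ incid u0 l"
    proof (cases "p\<^sup>2 dvd k i")
      case True
      then obtain m where m: "k i = p\<^sup>2 * m" by (elim dvdE)
      show ?thesis
        by (rule bexI[of _ "(i,i)"], rule exI[of _ "k(i := m)"])
           (use i m in \<open>auto simp: upairs_def incid_def numeral_2_eq_2\<close>)
    next
      case False
      obtain m where m: "k i = p * m" using p by (elim dvdE)
      have nm: "\<not> p dvd m" using False m by (auto simp: power2_eq_square)
      have "p * m * (\<Prod>l\<in>I-{i}. k l) = p * p * s'\<^sup>2"
        using less.prems(2) i assms(1) m s' prod.remove[of I i k] by (simp add: power2_eq_square mult_ac)
      hence "m * (\<Prod>l\<in>I-{i}. k l) = p * s'\<^sup>2" using p0 by simp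
      hence "p dvd m * (\<Prod>l\<in>I-{i}. k l)" by simp
      hence "p dvd (\<Prod>l\<in>I-{i}. k l)" using nm p(1) prime_dvd_mult_nat by blast
      then obtain j where j: "j \<in> I" "j \<noteq> i" "p dvd k j"
        using prime_dvd_prod_iff[of "I-{i}" p k] p(1) assms(1) by auto
      then obtain m2 where m2: "k j = p * m2" by (elim dvdE)
      show ?thesis
        by (rule bexI[of _ "(min i j, max i j)"], rule exI[of _ "k(i := m, j := m2)"])
           (use i j m m2 in \<open>auto simp: upairs_def incid_def min_def max_def\<close>)
    qed
    then obtain u0 k' where u0: "u0 \<in> upairs I" and k': "\<And>l. l \<in> I \<Longrightarrow> k l = k' l * p ^ incid u0 l"
      by blast
    have "(\<Prod>l\<in>I. k l) = (\<Prod>l\<in>I. k' l) * p ^ (\<Sum>l\<in>I. incid u0 l)"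
      by (simp add: k' prod.distrib power_sum)
    hence eq: "(\<Prod>l\<in>I. k l) = (\<Prod>l\<in>I. k' l) * p\<^sup>2"
      using sum_incid[OF assms(1) u0] by simp
    hence eq2: "(\<Prod>l\<in>I. k' l) = s'\<^sup>2"
      using less.prems(2) s' p0 by (simp add: power_mult_distrib)
    have pos': "k' l > 0" if "l \<in> I" for l
      using less.prems(1)[OF that] k'[OF that] by (cases "k' l") auto
    hence "(\<Prod>l\<in>I. k' l) > 0" by (simp add: prod_pos)
    hence "(\<Prod>l\<in>I. k' l) < (\<Prod>l\<in>I. k l)"
      unfolding eq using p0 one_less_power[of p 2] by simp
    from less.hyps[OF this pos' eq2] obtain g where
      g: "\<forall>u. g u > 0" "\<forall>i\<in>I. k' i = (\<Prod>u\<in>upairs I. g u ^ incid u i)" by blast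
    show ?thesis
    proof (intro exI[of _ "g(u0 := g u0 * p)"] conjI allI ballI)
      fix u show "0 < (g(u0 := g u0 * p)) u" using g(1)[rule_format, of u] g(1)[rule_format, of u0] p0 by simp
    next
      fix l assume "l \<in> I"
      thus "k l = (\<Prod>u\<in>upairs I. (g(u0 := g u0 * p)) u ^ incid u l)"
        using prod_fun_upd_mult[OF finite_upairs[OF assms(1)] u0, of g p "\<lambda>u. incid u l"] g k' by auto
    qed
  qed
qed

section \<open>Tuples of bounded product and tuples whose product is a square\<close>

lemma harmonic_sum_le: "n \<ge> 1 \<Longrightarrow> (\<Sum>k=1..n. 1 / real k) \<le> 1 + ln (real n)"
proof (induction n rule: nat_induct_at_least)
  case base
  then show ?case by simp
next
  case (Suc n)
  have "ln (1 + (- 1 / real (Suc n))) \<le> - 1 / real (Suc n)"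
    by (rule ln_add_one_self_le_self2) (use Suc in \<open>auto simp: field_simps\<close>)
  moreover have "1 + (- 1 / real (Suc n)) = real n / real (Suc n)" by (simp add: field_simps)
  ultimately have "1 / real (Suc n) \<le> ln (real (Suc n)) - ln (real n)"
    using Suc by (simp add: ln_div)
  then show ?case using Suc by simp
qed

definition prod_le_tuples :: "'a set \<Rightarrow> real \<Rightarrow> ('a \<Rightarrow> nat) set" where
  "prod_le_tuples U X = {g \<in> PiE U (\<lambda>_. {1..}). real (\<Prod>u\<in>U. g u) \<le> X}"

lemma prod_ge_component:
  fixes g :: "'a \<Rightarrow> nat"
  assumes "finite U" "u \<in> U" "\<And>v. v \<in> U \<Longrightarrow> g v \<ge> 1"
  shows "g u \<le> (\<Prod>v\<in>U. g v)"
proof -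
  have "(\<Prod>v\<in>U. g v) = g u * (\<Prod>v\<in>U-{u}. g v)" using assms by (simp add: prod.remove)
  moreover have "(\<Prod>v\<in>U-{u}. g v) \<ge> 1" using assms by (intro prod_ge_1) auto
  ultimately show ?thesis by simp
qed

lemma prod_le_tuples_subset:
  assumes "finite U"
  shows "prod_le_tuples U X \<subseteq> PiE U (\<lambda>_. {1..nat \<lfloor>X\<rfloor>})"
proof
  fix g assume g: "g \<in> prod_le_tuples U X"
  show "g \<in> PiE U (\<lambda>_. {1..nat \<lfloor>X\<rfloor>})"
  proof (rule PiE_I)
    fix u assume u: "u \<in> U"
    have ge: "g v \<ge> 1" if "v \<in> U" for v using g that by (auto simp: prod_le_tuples_def PiE_def Pi_def)
    have "real (g u) \<le> real (\<Prod>v\<in>U. g v)"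
      using prod_ge_component[OF assms u ge] by (simp only: of_nat_le_iff)
    also have "\<dots> \<le> X" using g by (simp add: prod_le_tuples_def)
    finally have "real (g u) \<le> X" .
    hence "g u \<le> nat \<lfloor>X\<rfloor>" by linarith
    thus "g u \<in> {1..nat \<lfloor>X\<rfloor>}" using ge[OF u] by simp
  next
    fix u assume "u \<notin> U" thus "g u = undefined" using g by (auto simp: prod_le_tuples_def PiE_def extensional_def)
  qed
qed

lemma finite_prod_le_tuples [simp]: "finite U \<Longrightarrow> finite (prod_le_tuples U X)"
  by (rule finite_subset[OF prod_le_tuples_subset]) (auto intro: finite_PiE)

text \<open>Rankin's trick: on the set counted, 1 is at most \<open>X\<close> divided by the product
  of the entries, and the sum of that weight over the whole box factors into harmonic sums.
  \<open>L\<close> is only an upper bound for \<open>1 + ln X\<close>, so that one value serves for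
  several \<open>X\<close>.\<close>

lemma card_prod_le_tuples:
  assumes U: "finite U" and X: "X > 0" and L: "L \<ge> 1" "L \<ge> 1 + ln X"
  shows "real (card (prod_le_tuples U X)) \<le> X * L ^ card U"
proof (cases "X < 1")
  case True
  have "prod_le_tuples U X = {}"
  proof (rule ccontr)
    assume "prod_le_tuples U X \<noteq> {}"
    then obtain g where g: "g \<in> prod_le_tuples U X" by blast
    have "(\<Prod>u\<in>U. g u) \<ge> 1" using g by (intro prod_ge_1) (auto simp: prod_le_tuples_def PiE_def Pi_def)
    hence "real (\<Prod>u\<in>U. g u) \<ge> 1" by linarith
    thus False using g True by (auto simp: prod_le_tuples_def)
  qed
  thus ?thesis using X L by simp
next
  case False
  define n where "n = nat \<lfloor>X\<rfloor>"
  have n: "n \<ge> 1" "real n \<le> X" using False by (auto simp: n_def le_nat_floor)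
  have "real (card (prod_le_tuples U X)) = (\<Sum>g\<in>prod_le_tuples U X. 1)" by simp
  also have "\<dots> \<le> (\<Sum>g\<in>prod_le_tuples U X. X * (\<Prod>u\<in>U. 1 / real (g u)))"
  proof (rule sum_mono)
    fix g assume g: "g \<in> prod_le_tuples U X"
    have "(\<Prod>u\<in>U. g u) > 0" using g by (intro prod_pos) (force simp: prod_le_tuples_def PiE_def Pi_def)
    hence "(\<Prod>u\<in>U. real (g u)) > 0" by (metis of_nat_0_less_iff of_nat_prod)
    moreover have "(\<Prod>u\<in>U. real (g u)) \<le> X" using g by (auto simp: prod_le_tuples_def)
    ultimately show "1 \<le> X * (\<Prod>u\<in>U. 1 / real (g u))" by (simp add: prod_dividef field_simps)
  qed
  also have "\<dots> \<le> (\<Sum>g\<in>PiE U (\<lambda>_. {1..n}). X * (\<Prod>u\<in>U. 1 / real (g u)))"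
    by (rule sum_mono2) (use prod_le_tuples_subset[OF U] X U in
        \<open>auto intro!: finite_PiE mult_nonneg_nonneg prod_nonneg simp: n_def\<close>)
  also have "\<dots> = X * (\<Prod>u\<in>U. \<Sum>k=1..n. 1 / real k)"
    by (subst prod_sum_PiE) (use U in \<open>auto simp: sum_distrib_left\<close>)
  also have "\<dots> \<le> X * L ^ card U"
  proof -
    have "(\<Sum>k=1..n. 1 / real k) \<le> L"
    proof -
      have "(\<Sum>k=1..n. 1 / real k) \<le> 1 + ln (real n)" by (rule harmonic_sum_le[OF n(1)])
      also have "\<dots> \<le> 1 + ln X" using n by simp
      finally show ?thesis using L by linarith
    qed
    hence "(\<Prod>u\<in>U. \<Sum>k=1..n. 1 / real k) \<le> L ^ card U"
      by (simp add: power_mono sum_nonneg)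
    thus ?thesis using X by simp
  qed
  finally show ?thesis .
qed

definition square_tuples :: "nat set \<Rightarrow> nat \<Rightarrow> (nat \<Rightarrow> int) set" where
  "square_tuples I N = {k \<in> PiE I (\<lambda>_. {-int N..int N} - {0}). \<exists>s. (\<Prod>i\<in>I. nat \<bar>k i\<bar>) = s\<^sup>2}"

definition sign_vectors :: "nat set \<Rightarrow> (nat \<Rightarrow> int) set" where
  "sign_vectors I = PiE I (\<lambda>_. {-1, 1})"

lemma finite_sign_vectors [simp]: "finite I \<Longrightarrow> finite (sign_vectors I)"
  by (simp add: sign_vectors_def finite_PiE)

lemma card_sign_vectors: "finite I \<Longrightarrow> card (sign_vectors I) = 2 ^ card I"
  by (simp add: sign_vectors_def card_PiE numeral_2_eq_2)

lemma card_prod_le_tuples_times_signs: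
  assumes "finite U" "finite I" "X > 0" "L \<ge> 1" "L \<ge> 1 + ln X"
  shows "real (card (prod_le_tuples U X \<times> sign_vectors I)) \<le> X * L ^ card U * 2 ^ card I"
  using card_prod_le_tuples[OF assms(1,3-5)] assms
  by (simp add: card_cartesian_product card_sign_vectors mult_right_mono)

definition param_tuple :: "nat set \<Rightarrow> (nat \<times> nat \<Rightarrow> nat) \<Rightarrow> (nat \<Rightarrow> int) \<Rightarrow> nat \<Rightarrow> int" where
  "param_tuple I g \<sigma> = (\<lambda>i\<in>I. \<sigma> i * int (\<Prod>u\<in>upairs I. g u ^ incid u i))"

lemma finite_square_tuples [simp]: "finite I \<Longrightarrow> finite (square_tuples I N)"
  by (rule finite_subset[of _ "PiE I (\<lambda>_. {-int N..int N} - {0})"])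
     (auto simp: square_tuples_def intro!: finite_PiE)

text \<open>Every \<open>g u\<close> enters the product of all entries with total exponent 2
  (\<open>sum_incid\<close>), so the product of the parameters is the square root of that product.
  This is what reduces the count from \<open>N ^ r\<close> to about
  \<open>N powr (r / 2)\<close>.\<close>

lemma square_tuples_param:
  assumes I: "finite I" and k: "k \<in> square_tuples I N"
  obtains g \<sigma> where "g \<in> PiE (upairs I) (\<lambda>_. {1..})" "\<sigma> \<in> sign_vectors I"
    "k = param_tuple I g \<sigma>" "(\<Prod>u\<in>upairs I. g u)\<^sup>2 = (\<Prod>i\<in>I. nat \<bar>k i\<bar>)"
proof -
  obtain s where s: "(\<Prod>i\<in>I. nat \<bar>k i\<bar>) = s\<^sup>2" using k by (auto simp: square_tuples_def)
  have nz: "k i \<noteq> 0" if "i \<in> I" for i using k that by (auto simp: square_tuples_def PiE_def Pi_def)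
  have pos: "nat \<bar>k i\<bar> > 0" if "i \<in> I" for i using nz[OF that] by simp
  obtain g where g: "\<forall>u. g u > 0" "\<forall>i\<in>I. nat \<bar>k i\<bar> = (\<Prod>u\<in>upairs I. g u ^ incid u i)"
    using square_parametrization[OF I pos s] by blast
  define g' where "g' = restrict g (upairs I)"
  define \<sigma> where "\<sigma> = (\<lambda>i\<in>I. sgn (k i))"
  have g': "nat \<bar>k i\<bar> = (\<Prod>u\<in>upairs I. g' u ^ incid u i)" if "i \<in> I" for i
    using g(2) that by (simp add: g'_def)
  have "g' \<in> PiE (upairs I) (\<lambda>_. {1..})" using g(1) by (auto simp: g'_def Suc_le_eq)
  moreover have "\<sigma> \<in> sign_vectors I" using nz by (auto simp: \<sigma>_def sign_vectors_def sgn_if)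
  moreover have "k = param_tuple I g' \<sigma>"
  proof
    fix i show "k i = param_tuple I g' \<sigma> i"
    proof (cases "i \<in> I")
      case True
      have "k i = sgn (k i) * \<bar>k i\<bar>" by (simp add: sgn_mult_abs)
      also have "\<bar>k i\<bar> = int (nat \<bar>k i\<bar>)" by simp
      finally show ?thesis using True unfolding g'[OF True] by (simp add: param_tuple_def \<sigma>_def)
    next
      case False
      thus ?thesis using k by (auto simp: param_tuple_def square_tuples_def PiE_def extensional_def)
    qed
  qed
  moreover have "(\<Prod>u\<in>upairs I. g' u)\<^sup>2 = (\<Prod>i\<in>I. nat \<bar>k i\<bar>)"
  proof -
    have "(\<Prod>i\<in>I. nat \<bar>k i\<bar>) = (\<Prod>i\<in>I. \<Prod>u\<in>upairs I. g' u ^ incid u i)" using g' by simp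
    also have "\<dots> = (\<Prod>u\<in>upairs I. \<Prod>i\<in>I. g' u ^ incid u i)" by (rule prod.swap)
    also have "\<dots> = (\<Prod>u\<in>upairs I. g' u ^ 2)"
      by (intro prod.cong refl) (simp add: power_sum[symmetric] sum_incid[OF I])
    finally show ?thesis by (simp add: prod_power_distrib)
  qed
  ultimately show ?thesis using that by blast
qed

lemma square_tuples_prod_le:
  assumes "k \<in> square_tuples I N" "finite I"
  shows "(\<Prod>i\<in>I. nat \<bar>k i\<bar>) \<le> N ^ card I"
proof -
  have "(\<Prod>i\<in>I. nat \<bar>k i\<bar>) \<le> (\<Prod>i\<in>I. N)"
    by (rule prod_mono) (use assms in \<open>force simp: square_tuples_def PiE_def Pi_def\<close>)
  thus ?thesis by simp
qed

lemma card_square_tuples: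
  assumes I: "finite I" and N: "N \<ge> 1" and L: "L = 1 + real (card I) / 2 * ln (real N)"
  shows "real (card (square_tuples I N)) \<le>
     2 ^ card I * real N powr (card I / 2) * L ^ card (upairs I)"
proof -
  define X where "X = real N powr (card I / 2)"
  have X: "X > 0" "1 + ln X = L" using N by (auto simp: X_def L ln_powr)
  have L1: "L \<ge> 1" using N by (simp add: L)
  have "square_tuples I N \<subseteq> (\<lambda>(g,\<sigma>). param_tuple I g \<sigma>) ` (prod_le_tuples (upairs I) X \<times> sign_vectors I)"
  proof
    fix k assume k: "k \<in> square_tuples I N"
    obtain g \<sigma> where g: "g \<in> PiE (upairs I) (\<lambda>_. {1..})" "\<sigma> \<in> sign_vectors I"
      "k = param_tuple I g \<sigma>" "(\<Prod>u\<in>upairs I. g u)\<^sup>2 = (\<Prod>i\<in>I. nat \<bar>k i\<bar>)"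
      by (rule square_tuples_param[OF I k])
    have "real (\<Prod>u\<in>upairs I. g u) ^ 2 \<le> real N ^ card I"
      using square_tuples_prod_le[OF k I] g(4) by (metis of_nat_le_iff of_nat_power)
    also have "\<dots> = X ^ 2" using N using N unfolding X_def power2_eq_square powr_add[symmetric] by (simp add: powr_realpow)
    finally have "real (\<Prod>u\<in>upairs I. g u) \<le> X" by (rule power2_le_imp_le) (use X(1) in simp)
    thus "k \<in> (\<lambda>(g,\<sigma>). param_tuple I g \<sigma>) ` (prod_le_tuples (upairs I) X \<times> sign_vectors I)"
      using g by (auto simp: prod_le_tuples_def)
  qed
  hence "card (square_tuples I N) \<le> card (prod_le_tuples (upairs I) X \<times> sign_vectors I)"
    by (rule surj_card_le[rotated]) (use I in auto)
  hence "real (card (square_tuples I N)) \<le> real (card (prod_le_tuples (upairs I) X \<times> sign_vectors I))"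
    by (simp only: of_nat_le_iff)
  also have "\<dots> \<le> X * L ^ card (upairs I) * 2 ^ card I"
    by (rule card_prod_le_tuples_times_signs) (use I X L1 in auto)
  finally show ?thesis by (simp add: X_def mult_ac)
qed

lemma param_tuple_split:
  assumes "finite I" "i \<in> I" "u \<in> upairs I"
  shows "param_tuple I g \<sigma> i =
     int (g u) ^ incid u i * (\<sigma> i * int (\<Prod>v\<in>upairs I - {u}. g v ^ incid v i))"
  using assms by (simp add: param_tuple_def prod.remove[of _ u] mult_ac)

section \<open>Square tuples subject to a linear relation\<close>

text \<open>The source of the power saving: a linear relation determines each
  parameter of its leading variable from all the others, unless that parameter is shared with a
  second variable that cancels the leading one.\<close>

lemma linear_relation_determines:
  assumes I: "finite I" "I0 \<subseteq> I" "0 \<in> I0" and u: "u \<in> upairs I" "incid u 0 > 0"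
    and agree: "\<And>v. v \<noteq> u \<Longrightarrow> g v = h v"
    and pos: "g u \<ge> 1"
    and k: "k = param_tuple I g \<sigma>" and l: "l = param_tuple I h \<sigma>"
    and zk: "(\<Sum>i\<in>I0. k i) = 0" and zl: "(\<Sum>i\<in>I0. l i) = 0"
    and nz: "k 0 \<noteq> 0" and nc: "\<And>j. j \<in> I0 - {0} \<Longrightarrow> k j \<noteq> - k 0"
  shows "g u = h u"
proof -
  define x where "x i = \<sigma> i * int (\<Prod>v\<in>upairs I - {u}. g v ^ incid v i)" for i
  define A where "A = {i\<in>I0. incid u i > 0}"
  define e where "e = (if fst u = snd u then 2 else 1 :: nat)"
  have e: "incid u i = e" if "i \<in> A" for i
    using that u(2) by (auto simp: A_def incid_def e_def of_bool_def split: if_splits)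
  have fin: "finite I0" using I finite_subset by blast
  have kx: "k i = int (g u) ^ incid u i * x i" if "i \<in> I0" for i
    using param_tuple_split[OF I(1) _ u(1)] that I(2) by (auto simp: k x_def)
  have gh: "(\<Prod>v\<in>upairs I - {u}. h v ^ incid v i) = (\<Prod>v\<in>upairs I - {u}. g v ^ incid v i)" for i
    by (intro prod.cong) (auto simp: agree)
  have lx: "l i = int (h u) ^ incid u i * x i" if "i \<in> I0" for i
    by (simp only: l x_def param_tuple_split[OF I(1) subsetD[OF I(2) that] u(1)] gh)
  have split: "(\<Sum>i\<in>I0. f i) = (\<Sum>i\<in>A. f i) + (\<Sum>i\<in>I0-A. f i)" for f :: "nat \<Rightarrow> int"
    using fin sum.subset_diff[of A I0 f] by (auto simp: A_def add.commute)
  have AI: "A \<subseteq> I0" by (auto simp: A_def)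
  have kA: "(\<Sum>i\<in>A. k i) = int (g u) ^ e * (\<Sum>i\<in>A. x i)"
    unfolding sum_distrib_left by (intro sum.cong refl) (simp add: kx e subsetD[OF AI])
  have lA: "(\<Sum>i\<in>A. l i) = int (h u) ^ e * (\<Sum>i\<in>A. x i)"
    unfolding sum_distrib_left by (intro sum.cong refl) (simp add: lx e subsetD[OF AI])
  have "(\<Sum>i\<in>I0-A. k i) = (\<Sum>i\<in>I0-A. l i)"
    by (intro sum.cong) (use kx lx in \<open>auto simp: A_def\<close>)
  hence eq: "int (g u) ^ e * (\<Sum>i\<in>A. x i) = int (h u) ^ e * (\<Sum>i\<in>A. x i)"
    using zk zl split[of k] split[of l] kA lA by linarith
  \<comment> \<open>Among the entries with index in \<open>I0\<close>, only \<open>k 0\<close> and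
    at most one further \<open>k j\<close> contain \<open>g u\<close>. Their sum could vanish only
    if \<open>k j\<close> cancelled \<open>k 0\<close>, which \<open>nc\<close> excludes.\<close>
  have "(\<Sum>i\<in>A. k i) \<noteq> 0"
  proof -
    obtain j where j: "u = (0, j) \<or> u = (j, 0)" using u(2)
      by (cases u) (auto simp: incid_def of_bool_def split: if_splits)
    show ?thesis
    proof (cases "j \<in> I0 - {0}")
      case True
      hence "A = {0, j}" using j I(3) by (auto simp: A_def incid_def)
      moreover have "k j \<noteq> - k 0" using nc True by blast
      ultimately show ?thesis using True by (auto simp: add_eq_0_iff)
    next
      case False
      hence "A = {0}" using j I(3) by (auto simp: A_def incid_def of_bool_def split: if_splits)
      thus ?thesis using nz by simp
    qed
  qed
  hence "(\<Sum>i\<in>A. x i) \<noteq> 0" using kA by auto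
  hence "int (g u) ^ e = int (h u) ^ e" using eq by simp
  hence "g u ^ e = h u ^ e" by (metis of_nat_eq_iff of_nat_power)
  thus ?thesis by (simp add: e_def split: if_splits)
qed

text \<open>The number of parameters in \<open>k 0\<close>, with multiplicity: the diagonal one
  counts twice. If all of them are at most \<open>Y\<close>, then \<open>\<bar>k 0\<bar>\<close> is
  at most \<open>Y ^ (r + 1)\<close>, which dictates the size of \<open>Y\<close> below.\<close>

lemma sum_incid_0:
  assumes "finite I" "0 \<in> I"
  shows "(\<Sum>u\<in>upairs I. incid u 0) = Suc (card I)"
proof -
  have "{u \<in> upairs I. fst u = 0} = Pair 0 ` I" "{u \<in> upairs I. snd u = 0} = {(0,0)}"
    using assms by (auto simp: upairs_def)
  hence "card {u \<in> upairs I. fst u = 0} = card I" "card {u \<in> upairs I. snd u = 0} = 1"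
    by (simp_all add: card_image inj_on_def)
  thus ?thesis using assms(1)
    by (simp add: incid_def sum.distrib sum_of_bool_eq Int_def conj_commute)
qed

text \<open>A dichotomy on the parameters of \<open>k 0\<close>, with \<open>Y\<close> chosen so
  that \<open>Y ^ (r + 1) = sqrt N\<close>. If all are at most \<open>Y\<close> (\<open>W0\<close>),
  then \<open>\<bar>k 0\<bar> \<le> sqrt N\<close>, and the product of all entries is too small for
  a typical tuple. If some \<open>g u\<close> exceeds \<open>Y\<close> (\<open>W u\<close>), the
  linear relation determines it from the other parameters, whose product is at most
  \<open>X / Y\<close>. Both cases leave at most \<open>X0 = X / Y\<close> for a product of free
  parameters.\<close>

lemma card_constrained_square_tuples:
  fixes N :: nat and I I0 :: "nat set"
  assumes I: "finite I" "I0 \<subseteq> I" "0 \<in> I0" and N: "N \<ge> 1"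
    and L: "L = 1 + real (card I) / 2 * ln (real N)"
  defines "r \<equiv> card I" and "d \<equiv> card (upairs I)"
  defines "C1 \<equiv> {k \<in> square_tuples I N. (\<Sum>i\<in>I0. k i) = 0 \<and> (\<forall>j\<in>I0-{0}. k j \<noteq> - k 0)}"
  shows "real (card C1) \<le> (1 + d) * (2 ^ r * real N powr (r / 2 - 1 / (2 * (r + 1))) * L ^ d)"
proof -
  define U where "U = upairs I"
  define X where "X = real N powr (r / 2)"
  define Y where "Y = real N powr (1 / (2 * (r + 1)))"
  define X0 where "X0 = real N powr (r / 2 - 1 / (2 * (r + 1)))"
  have r1: "r \<ge> 1" using I by (metis One_nat_def Suc_leI card_gt_0_iff empty_iff r_def subsetD)
  have X: "X > 0" "Y > 0" "X0 > 0" "X0 = X / Y" "Y \<ge> 1"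
    using N by (auto simp: X_def Y_def X0_def powr_diff ge_one_powr_ge_zero)
  have L1: "L \<ge> 1" using N by (simp add: L)
  have "ln X0 = (r / 2 - 1 / (2 * (r + 1))) * ln (real N)" using N by (simp add: X0_def ln_powr)
  also have "\<dots> \<le> r / 2 * ln (real N)" using N by (intro mult_right_mono) auto
  finally have LX0: "1 + ln X0 \<le> L" by (simp add: L r_def)
  have finU: "finite U" using I by (simp add: U_def)
  have finC: "finite C1" using I by (auto simp: C1_def)
  define par where "par k g \<sigma> \<longleftrightarrow> g \<in> PiE U (\<lambda>_. {1..}) \<and> \<sigma> \<in> sign_vectors I \<and>
      k = param_tuple I g \<sigma> \<and> (\<Prod>u\<in>U. g u)\<^sup>2 = (\<Prod>i\<in>I. nat \<bar>k i\<bar>)" for k g \<sigma>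
  have ex_par: "\<exists>g \<sigma>. par k g \<sigma>" if "k \<in> C1" for k
  proof -
    have "k \<in> square_tuples I N" using that by (simp add: C1_def)
    from square_tuples_param[OF I(1) this] show ?thesis unfolding par_def U_def by metis
  qed
  define W0 where "W0 = {k\<in>C1. \<exists>g \<sigma>. par k g \<sigma> \<and> (\<forall>u\<in>U. incid u 0 > 0 \<longrightarrow> real (g u) \<le> Y)}"
  define W where "W u = {k\<in>C1. \<exists>g \<sigma>. par k g \<sigma> \<and> real (g u) > Y}" for u
  define U0 where "U0 = {u\<in>U. incid u 0 > 0}"
  have sub: "C1 \<subseteq> W0 \<union> (\<Union>u\<in>U0. W u)"
  proof
    fix k assume k: "k \<in> C1"
    obtain g \<sigma> where "par k g \<sigma>" using ex_par[OF k] by blast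
    thus "k \<in> W0 \<union> (\<Union>u\<in>U0. W u)"
      using k by (cases "\<forall>u\<in>U. incid u 0 > 0 \<longrightarrow> real (g u) \<le> Y")
        (auto simp: W0_def W_def U0_def not_le intro!: exI[of _ g] exI[of _ \<sigma>])
  qed
  define B where "B = 2 ^ r * X0 * L ^ d"
  have k_bds: "k i \<noteq> 0" "nat \<bar>k i\<bar> \<le> N" if "k \<in> C1" "i \<in> I" for k i
    using that by (force simp: C1_def square_tuples_def PiE_def Pi_def)+
  have W0: "real (card W0) \<le> B"
  proof -
    have "W0 \<subseteq> (\<lambda>(g,\<sigma>). param_tuple I g \<sigma>) ` (prod_le_tuples U X0 \<times> sign_vectors I)"
    proof
      fix k assume "k \<in> W0"
      then obtain g \<sigma> where k: "k \<in> C1" and p: "par k g \<sigma>"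
        and le: "\<And>u. u \<in> U \<Longrightarrow> incid u 0 > 0 \<Longrightarrow> real (g u) \<le> Y" by (auto simp: W0_def)
      have 0: "0 \<in> I" using I by auto
      have "\<bar>\<sigma> 0\<bar> = 1" using p 0 by (auto simp: par_def sign_vectors_def PiE_def Pi_def)
      hence "\<bar>k 0\<bar> = int (\<Prod>u\<in>U. g u ^ incid u 0)"
        using p 0 unfolding par_def by (simp add: param_tuple_def U_def abs_mult del: of_nat_prod)
      hence "real (nat \<bar>k 0\<bar>) = (\<Prod>u\<in>U. real (g u) ^ incid u 0)" by simp
      also have "\<dots> \<le> (\<Prod>u\<in>U. Y ^ incid u 0)"
      proof (rule prod_mono)
        fix u assume u: "u \<in> U"
        show "0 \<le> real (g u) ^ incid u 0 \<and> real (g u) ^ incid u 0 \<le> Y ^ incid u 0"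
          using le[OF u] by (cases "incid u 0 > 0") (auto intro: power_mono)
      qed
      also have "\<dots> = Y ^ (r + 1)"
        using sum_incid_0[OF I(1) 0] by (simp add: power_sum[symmetric] U_def r_def)
      also have "\<dots> = real N powr (real (r + 1) / (2 * (r + 1)))"
        using N by (simp add: Y_def powr_realpow[symmetric] powr_powr del: power_Suc)
      also have "real (r + 1) / (2 * (r + 1)) = 1 / 2" by (simp add: field_simps)
      finally have k0: "real (nat \<bar>k 0\<bar>) \<le> real N powr (1/2)" .
      have "real (\<Prod>i\<in>I. nat \<bar>k i\<bar>) = real (nat \<bar>k 0\<bar>) * (\<Prod>i\<in>I-{0}. real (nat \<bar>k i\<bar>))"
        using 0 I(1) by (simp add: prod.remove del: of_nat_nat)
      also have "\<dots> \<le> real N powr (1/2) * (\<Prod>i\<in>I-{0}. real N)"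
        using k_bds(2)[OF k] k0 by (intro mult_mono prod_mono prod_nonneg) (auto simp del: of_nat_nat)
      also have "(\<Prod>i\<in>I-{0}. real N) = real N powr (real r - 1)"
        using I 0 N r1 by (simp add: r_def card_Diff_singleton powr_realpow[symmetric] of_nat_diff)
      also have "real N powr (1/2) * real N powr (real r - 1) = real N powr (r - 1/2)"
        by (simp flip: powr_add)
      \<comment> \<open>The exponents compare because \<open>r \<ge> 1\<close> gives
        \<open>1 / (r + 1) \<le> 1 / 2\<close>.\<close>
      also have "\<dots> \<le> real N powr (2 * (r / 2 - 1 / (2 * (r + 1))))"
        using N r1 by (intro powr_mono) (auto simp: field_simps)
      also have "\<dots> = X0\<^sup>2"
        unfolding X0_def power2_eq_square powr_add[symmetric] by simp
      finally have "real ((\<Prod>u\<in>U. g u)\<^sup>2) \<le> X0\<^sup>2" using p by (simp only: par_def)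
      hence "real (\<Prod>u\<in>U. g u) ^ 2 \<le> X0\<^sup>2" by (simp only: of_nat_power)
      hence "real (\<Prod>u\<in>U. g u) \<le> X0" by (rule power2_le_imp_le) (use X in simp)
      thus "k \<in> (\<lambda>(g,\<sigma>). param_tuple I g \<sigma>) ` (prod_le_tuples U X0 \<times> sign_vectors I)"
        using p by (auto simp: prod_le_tuples_def par_def)
    qed
    hence "card W0 \<le> card (prod_le_tuples U X0 \<times> sign_vectors I)"
      by (rule surj_card_le[rotated]) (use I finU in auto)
    hence "real (card W0) \<le> real (card (prod_le_tuples U X0 \<times> sign_vectors I))"
      by (simp only: of_nat_le_iff)
    also have "\<dots> \<le> X0 * L ^ d * 2 ^ r"
      unfolding d_def r_def U_def[symmetric]
      by (rule card_prod_le_tuples_times_signs) (use finU I X L1 LX0 in auto)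
    finally show ?thesis by (simp add: B_def mult_ac)
  qed
  have Wu: "real (card (W u)) \<le> B" if u: "u \<in> U0" for u
  proof -
    \<comment> \<open>A tuple can have several parametrisations, so one is fixed for each
      \<open>k\<close>; \<open>F\<close> forgets its value at \<open>u\<close>.\<close>
    have "\<exists>f. \<forall>k\<in>W u. par k (fst (f k)) (snd (f k)) \<and> real (fst (f k) u) > Y"
      by (rule bchoice) (auto simp: W_def)
    then obtain f where f: "\<And>k. k \<in> W u \<Longrightarrow> par k (fst (f k)) (snd (f k))"
      "\<And>k. k \<in> W u \<Longrightarrow> real (fst (f k) u) > Y" by blast
    define F where "F k = (restrict (fst (f k)) (U - {u}), snd (f k))" for k
    have uU: "u \<in> U" "incid u 0 > 0" using u by (auto simp: U0_def)
    have inj: "inj_on F (W u)"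
    proof (rule inj_onI)
      fix k l assume k: "k \<in> W u" and l: "l \<in> W u" and eq: "F k = F l"
      define g h \<sigma> where "g = fst (f k)" and "h = fst (f l)" and "\<sigma> = snd (f k)"
      have \<sigma>': "\<sigma> = snd (f l)" and re: "restrict g (U-{u}) = restrict h (U-{u})"
        using eq by (auto simp: F_def g_def h_def \<sigma>_def)
      have pk: "par k g \<sigma>" and pl: "par l h \<sigma>"
        using f(1)[OF k] f(1)[OF l] \<sigma>' by (auto simp: g_def h_def \<sigma>_def)
      have agree: "g v = h v" if "v \<noteq> u" for v
      proof (cases "v \<in> U")
        case True
        thus ?thesis using fun_cong[OF re, of v] that by simp
      next
        case False
        thus ?thesis using pk pl PiE_arb[of g U "\<lambda>_. {1..}" v] PiE_arb[of h U "\<lambda>_. {1..}" v] by (simp add: par_def)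
      qed
      have kC: "k \<in> C1" and lC: "l \<in> C1" using k l by (auto simp: W_def)
      have "g u = h u"
      proof (rule linear_relation_determines[OF I _ _ agree])
        show "u \<in> upairs I" "incid u 0 > 0" using uU by (auto simp: U_def)
        show "1 \<le> g u" using pk PiE_mem[of g U "\<lambda>_. {1..}" u] uU by (simp add: par_def)
        show "k = param_tuple I g \<sigma>" "l = param_tuple I h \<sigma>" using pk pl by (auto simp: par_def)
        show "(\<Sum>i\<in>I0. k i) = 0" "(\<Sum>i\<in>I0. l i) = 0" using kC lC by (auto simp: C1_def)
        show "k 0 \<noteq> 0" using k_bds(1)[OF kC] I by auto
        show "k j \<noteq> - k 0" if "j \<in> I0 - {0}" for j using kC that by (auto simp: C1_def)
      qed
      hence "g = h" using agree by (metis ext)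
      thus "k = l" using pk pl by (simp add: par_def)
    qed
    have img: "F ` W u \<subseteq> prod_le_tuples (U-{u}) X0 \<times> sign_vectors I"
    proof
      fix z assume "z \<in> F ` W u"
      then obtain k where k: "k \<in> W u" "z = F k" by blast
      define g \<sigma> where "g = fst (f k)" and "\<sigma> = snd (f k)"
      have p: "par k g \<sigma>" and Yg: "real (g u) > Y" using f k by (auto simp: g_def \<sigma>_def)
      have kC: "k \<in> square_tuples I N" using k by (auto simp: W_def C1_def)
      have "real (\<Prod>u\<in>U. g u) ^ 2 \<le> real N ^ card I"
        using square_tuples_prod_le[OF kC I(1)] p unfolding par_def by (metis of_nat_le_iff of_nat_power)
      also have "\<dots> = X ^ 2"
        using N unfolding X_def power2_eq_square powr_add[symmetric] by (simp add: powr_realpow r_def)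
      finally have "real (\<Prod>u\<in>U. g u) \<le> X" by (rule power2_le_imp_le) (use X(1) in simp)
      moreover have "real (\<Prod>u\<in>U. g u) = real (g u) * real (\<Prod>v\<in>U-{u}. g v)"
        using finU uU by (simp add: prod.remove)
      moreover have "Y * real (\<Prod>v\<in>U-{u}. g v) \<le> real (g u) * real (\<Prod>v\<in>U-{u}. g v)"
        using Yg by (intro mult_right_mono) (auto intro: prod_nonneg)
      moreover have "X = Y * X0" using X by simp
      ultimately have "Y * real (\<Prod>v\<in>U-{u}. g v) \<le> Y * X0" by linarith
      hence "real (\<Prod>v\<in>U-{u}. g v) \<le> X0" using X(2) by (rule mult_left_le_imp_le)
      moreover have "(\<Prod>v\<in>U-{u}. restrict g (U-{u}) v) = (\<Prod>v\<in>U-{u}. g v)"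
        by (intro prod.cong) auto
      ultimately have "restrict g (U-{u}) \<in> prod_le_tuples (U-{u}) X0"
        using p by (auto simp: prod_le_tuples_def par_def PiE_def Pi_def)
      thus "z \<in> prod_le_tuples (U-{u}) X0 \<times> sign_vectors I"
        using p k(2) by (auto simp: F_def g_def \<sigma>_def par_def)
    qed
    have "card (W u) \<le> card (prod_le_tuples (U-{u}) X0 \<times> sign_vectors I)"
      using card_inj_on_le[OF inj img] I finU by auto
    hence "real (card (W u)) \<le> real (card (prod_le_tuples (U-{u}) X0 \<times> sign_vectors I))"
      by (simp only: of_nat_le_iff)
    also have "\<dots> \<le> X0 * L ^ card (U-{u}) * 2 ^ r"
      unfolding r_def by (rule card_prod_le_tuples_times_signs) (use finU I X L1 LX0 in auto)
    also have "\<dots> \<le> (X0 * L ^ d) * 2 ^ r"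
      using L1 X finU by (intro mult_right_mono mult_left_mono power_increasing)
        (auto simp: d_def U_def intro: card_mono)
    finally show ?thesis by (simp add: B_def mult_ac)
  qed
  have finW: "finite W0" "finite (W u)" for u using finC by (auto simp: W0_def W_def)
  have finU0: "finite U0" "card U0 \<le> d" using finU by (auto simp: U0_def d_def U_def intro: card_mono)
  have B0: "B \<ge> 0" using X L1 by (auto simp: B_def)
  have "card C1 \<le> card (W0 \<union> (\<Union>u\<in>U0. W u))"
    by (intro card_mono sub) (use finW finU0 in auto)
  also have "\<dots> \<le> card W0 + (\<Sum>u\<in>U0. card (W u))"
    using card_Un_le[of W0 "\<Union>u\<in>U0. W u"] card_UN_le[OF finU0(1), of W] by linarith
  finally have "real (card C1) \<le> real (card W0 + (\<Sum>u\<in>U0. card (W u)))"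
    by (simp only: of_nat_le_iff)
  also have "\<dots> = real (card W0) + (\<Sum>u\<in>U0. real (card (W u)))" by simp
  also have "\<dots> \<le> B + (\<Sum>u\<in>U0. B)" by (intro add_mono sum_mono W0 Wu)
  also have "\<dots> \<le> B + d * B" using finU0 B0 by (simp add: mult_right_mono)
  finally show ?thesis by (simp add: B_def X0_def algebra_simps)
qed

text \<open>Two entries equal to \<open>- k 0\<close> are determined by \<open>k 0\<close>, and
  deleting them divides the product by the square of \<open>k 0\<close>, so a square remains. Losing
  two coordinates saves a full factor \<open>N\<close>.\<close>

lemma card_repeated_square_tuples:
  fixes N :: nat
  assumes I: "finite I" "0 \<in> I" and ab: "a \<in> I" "b \<in> I" "a \<noteq> b" "a \<noteq> 0" "b \<noteq> 0"
  shows "card {k \<in> square_tuples I N. k a = - k 0 \<and> k b = - k 0} \<le> card (square_tuples (I - {a, b}) N)"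
    (is "card ?A \<le> _")
proof (rule card_inj_on_le)
  show "finite (square_tuples (I - {a, b}) N)" using I by simp
  show "inj_on (\<lambda>k. restrict k (I - {a, b})) ?A"
  proof (rule inj_onI, rule ext)
    fix k l i assume k: "k \<in> ?A" and l: "l \<in> ?A" and eq: "restrict k (I-{a,b}) = restrict l (I-{a,b})"
    have off: "k i = l i" if "i \<in> I - {a,b}" for i using fun_cong[OF eq, of i] that by simp
    have "k 0 = l 0" using off[of 0] I ab by auto
    moreover have "k a = - k 0" "k b = - k 0" "l a = - l 0" "l b = - l 0" using k l by auto
    ultimately have "k i = l i" if "i \<in> I" using off[of i] that by (cases "i \<in> {a, b}") auto
    moreover have "k i = l i" if "i \<notin> I"
      using that k l by (auto simp: square_tuples_def PiE_def extensional_def)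
    ultimately show "k i = l i" by blast
  qed
  show "(\<lambda>k. restrict k (I - {a, b})) ` ?A \<subseteq> square_tuples (I - {a, b}) N"
  proof clarify
    fix k assume k: "k \<in> square_tuples I N" "k a = - k 0" "k b = - k 0"
    obtain s where s: "(\<Prod>i\<in>I. nat \<bar>k i\<bar>) = s\<^sup>2" using k by (auto simp: square_tuples_def)
    define t where "t = nat \<bar>k 0\<bar>"
    have t: "t > 0" using k(1) I by (auto simp: t_def square_tuples_def PiE_def Pi_def)
    have "(\<Prod>i\<in>I. nat \<bar>k i\<bar>) = nat \<bar>k a\<bar> * (\<Prod>i\<in>I-{a}. nat \<bar>k i\<bar>)"
      by (rule prod.remove) (use I ab in auto)
    also have "(\<Prod>i\<in>I-{a}. nat \<bar>k i\<bar>) = nat \<bar>k b\<bar> * (\<Prod>i\<in>I-{a}-{b}. nat \<bar>k i\<bar>)"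
      by (rule prod.remove) (use I ab in auto)
    also have "I-{a}-{b} = I-{a,b}" by auto
    finally have eq: "s\<^sup>2 = t\<^sup>2 * (\<Prod>i\<in>I-{a,b}. nat \<bar>k i\<bar>)"
      using s k by (simp add: t_def power2_eq_square)
    hence "t\<^sup>2 dvd s\<^sup>2" by simp
    hence "t dvd s" by (simp add: pow_divides_pow_iff)
    then obtain s' where "s = t * s'" by (elim dvdE)
    hence "(\<Prod>i\<in>I-{a,b}. nat \<bar>k i\<bar>) = s'\<^sup>2" using eq t by (simp add: power_mult_distrib)
    moreover have "(\<Prod>i\<in>I-{a,b}. nat \<bar>restrict k (I-{a,b}) i\<bar>) = (\<Prod>i\<in>I-{a,b}. nat \<bar>k i\<bar>)"
      by (intro prod.cong) auto
    ultimately show "restrict k (I-{a,b}) \<in> square_tuples (I-{a,b}) N"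
      using k(1) by (auto simp: square_tuples_def PiE_def Pi_def)
  qed
qed

text \<open>In a second moment the first \<open>m\<close> coordinates belong to one tuple and the last \<open>m\<close> to the
  other; the linear relation of the second tuple is not needed.\<close>

definition unpaired_tuples :: "nat \<Rightarrow> nat \<Rightarrow> (nat \<Rightarrow> int) set" where
  "unpaired_tuples m N = {k \<in> square_tuples {..<2*m} N.
      (\<Sum>i<m. k i) = 0 \<and> card {j\<in>{1..<m}. k j = - k 0} \<noteq> 1}"

lemma log_power_le_powr:
  fixes a b c :: real
  assumes "b \<ge> 0" "c > 0"
  shows "\<exists>C>0. \<forall>N::nat. N \<ge> 1 \<longrightarrow> (1 + b * ln (real N)) ^ d \<le> C * real N powr c"
proof (cases "d = 0")
  case True
  thus ?thesis using assms by (intro exI[of _ 1]) (auto intro: ge_one_powr_ge_zero)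
next
  case False
  define e where "e = c / d"
  have e: "e > 0" using False assms by (simp add: e_def)
  show ?thesis
  proof (intro exI[of _ "(1 + b / e) ^ d"] conjI allI impI)
    show "0 < (1 + b / e) ^ d" using e assms by (intro zero_less_power) (auto intro: add_pos_nonneg)
    fix N :: nat assume N: "N \<ge> 1"
    have "1 + b * ln (real N) \<le> real N powr e + b * (real N powr e / e)"
      using N e assms by (intro add_mono mult_left_mono ln_powr_bound ge_one_powr_ge_zero) auto
    also have "\<dots> = (1 + b / e) * real N powr e" by (simp add: algebra_simps)
    finally have "(1 + b * ln (real N)) ^ d \<le> ((1 + b / e) * real N powr e) ^ d"
      using N assms by (intro power_mono) auto
    also have "\<dots> = (1 + b / e) ^ d * real N powr c"
      using N False by (simp add: power_mult_distrib e_def powr_realpow[symmetric] powr_powr)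
    finally show "(1 + b * ln (real N)) ^ d \<le> (1 + b / e) ^ d * real N powr c" .
  qed
qed

text \<open>If no \<open>j\<close> has \<open>k j = - k 0\<close>, the linear relation on the first
  \<open>m\<close> coordinates saves a power of \<open>N\<close>; if at least two do,
  \<open>card_repeated_square_tuples\<close> saves more. Only the case of exactly one
  \<open>j\<close>, excluded here, has the full order \<open>N ^ m\<close>.\<close>

theorem card_unpaired_tuples:
  assumes m: "m \<ge> 1"
  shows "\<exists>C c. C > 0 \<and> c > 0 \<and> c \<le> 1 \<and>
    (\<forall>N\<ge>1. real (card (unpaired_tuples m N)) \<le> C * real N powr (real m - c))"
proof -
  define I where "I = {..<2*m}"
  define d where "d = card (upairs I)"
  \<comment> \<open>The saving of \<open>card_constrained_square_tuples\<close> for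
    \<open>r = 2 * m\<close>. Half of it is given away to absorb the powers of
    \<open>ln N\<close>.\<close>
  define c0 where "c0 = 1 / (2 * real (2 * m + 1))"
  have c0: "c0 > 0" "c0 \<le> 1" using m by (auto simp: c0_def field_simps)
  obtain C0 where C0: "C0 > 0" "\<And>N::nat. N \<ge> 1 \<Longrightarrow> (1 + real m * ln (real N)) ^ d \<le> C0 * real N powr (c0/2)"
    using log_power_le_powr[of "real m" "c0/2" d] c0(1) by auto
  define D where "D = 2 ^ (2*m) * C0 * (1 + d) + (2*m)^2 * 2 ^ (2*m) * C0"
  have "real (card (unpaired_tuples m N)) \<le> D * real N powr (m - c0/2)" if N: "N \<ge> 1" for N
  proof -
    define C1 where "C1 = {k \<in> square_tuples I N. (\<Sum>i<m. k i) = 0 \<and> (\<forall>j\<in>{..<m}-{0}. k j \<noteq> - k 0)}"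
    define C2 where "C2 ab = {k \<in> square_tuples I N. k (fst ab) = - k 0 \<and> k (snd ab) = - k 0}" for ab
    define P where "P = {ab \<in> I \<times> I. fst ab \<noteq> snd ab \<and> fst ab \<noteq> 0 \<and> snd ab \<noteq> 0}"
    have fin: "finite I" "finite P" by (auto simp: I_def P_def)
    have cP: "card P \<le> (2*m)^2"
      using card_mono[of "I \<times> I" P] by (auto simp: P_def I_def power2_eq_square)
    have sub: "unpaired_tuples m N \<subseteq> C1 \<union> (\<Union>ab\<in>P. C2 ab)"
    proof
      fix k assume k: "k \<in> unpaired_tuples m N"
      define J where "J = {j\<in>{1..<m}. k j = - k 0}"
      have J: "card J \<noteq> 1" using k by (simp add: unpaired_tuples_def J_def)
      show "k \<in> C1 \<union> (\<Union>ab\<in>P. C2 ab)"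
      proof (cases "J = {}")
        case True
        thus ?thesis using k by (auto simp: C1_def unpaired_tuples_def I_def J_def)
      next
        case False
        then obtain a where a: "a \<in> J" by blast
        have "J \<noteq> {a}" using J by auto
        then obtain b where "b \<in> J" "b \<noteq> a" using a by blast
        hence "(a,b) \<in> P \<and> k \<in> C2 (a,b)" using k a
          by (auto simp: P_def C2_def unpaired_tuples_def I_def J_def)
        thus ?thesis by blast
      qed
    qed
    have Lb: "(1 + real m * ln (real N)) ^ d \<le> C0 * real N powr (c0/2)" by (rule C0(2)[OF N])
    have C1: "real (card C1) \<le> 2 ^ (2*m) * C0 * (1+d) * real N powr (m - c0/2)"
    proof -
      have "real (card C1) \<le> (1 + d) * (2 ^ (2*m) * real N powr (m - c0) * (1 + real m * ln (real N)) ^ d)"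
        using card_constrained_square_tuples[of I "{..<m}" N "1 + real m * ln (real N)"] m N
        by (simp add: C1_def I_def d_def c0_def add.commute)
      also have "\<dots> \<le> (1 + d) * (2 ^ (2*m) * (real N powr (m - c0) * (C0 * real N powr (c0/2))))"
        unfolding mult.assoc by (intro mult_left_mono Lb) auto
      also have "\<dots> = (1 + d) * (2 ^ (2*m) * (C0 * (real N powr (m - c0) * real N powr (c0/2))))"
        by (simp only: mult_ac)
      also have "\<dots> = (1 + d) * (2 ^ (2*m) * (C0 * real N powr (m - c0/2)))"
        by (simp flip: powr_add)
      finally show ?thesis by (simp add: mult_ac)
    qed
    have C2: "real (card (C2 ab)) \<le> 2 ^ (2*m) * C0 * real N powr (m - c0/2)" if ab: "ab \<in> P" for ab
    proof -
      define I' where "I' = I - {fst ab, snd ab}"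
      have I': "finite I'" "card I' = 2*m - 2" "I' \<subseteq> I"
        using ab by (auto simp: I'_def I_def P_def card_Diff_subset)
      have "upairs I' \<subseteq> upairs I" using I' by (auto simp: upairs_def)
      hence d': "card (upairs I') \<le> d" unfolding d_def by (intro card_mono) (auto simp: I_def)
      define L' where "L' = 1 + (real m - 1) * ln (real N)"
      have L1: "L' \<ge> 1" using m N by (simp add: L'_def)
      have L2: "L' \<le> 1 + real m * ln (real N)" using N by (simp add: L'_def algebra_simps)
      have h: "real (2 * m - 2) / 2 = real m - 1" using m by (simp add: of_nat_diff)
      have pw: "(2::real) ^ (2*m-2) \<le> 2 ^ (2*m)" "L' ^ card (upairs I') \<le> L' ^ d"
        using d' L1 by (simp_all add: power_increasing)
      have "card (C2 ab) \<le> card (square_tuples I' N)"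
        unfolding C2_def I'_def by (rule card_repeated_square_tuples) (use ab m in \<open>auto simp: P_def I_def\<close>)
      hence "real (card (C2 ab)) \<le> real (card (square_tuples I' N))" by simp
      also have "\<dots> \<le> 2 ^ (2*m-2) * real N powr (real m - 1) * L' ^ card (upairs I')"
        using card_square_tuples[OF I'(1) N refl] unfolding I'(2) h L'_def .
      also have "\<dots> \<le> 2 ^ (2*m) * real N powr (real m - 1) * L' ^ d"
        by (rule mult_mono[OF mult_right_mono[OF pw(1)] pw(2)]) (use L1 in auto)
      also have "\<dots> \<le> 2 ^ (2*m) * real N powr (real m - 1) * (1 + real m * ln (real N)) ^ d"
        by (intro mult_left_mono power_mono L2) (use L1 in auto)
      also have "\<dots> \<le> 2 ^ (2*m) * (real N powr (real m - 1) * (C0 * real N powr (c0/2)))"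
        unfolding mult.assoc by (intro mult_left_mono Lb) auto
      also have "\<dots> \<le> 2 ^ (2*m) * (C0 * real N powr (m - c0/2))"
      proof (intro mult_left_mono)
        have "real N powr (real m - 1) * (C0 * real N powr (c0/2)) = C0 * real N powr (real m - 1 + c0/2)"
          by (simp add: powr_add)
        also have "\<dots> \<le> C0 * real N powr (m - c0/2)"
          using C0(1) N c0 by (intro mult_left_mono powr_mono) auto
        finally show "real N powr (real m - 1) * (C0 * real N powr (c0/2)) \<le> C0 * real N powr (m - c0/2)" .
      qed auto
      finally show ?thesis by (simp add: mult_ac)
    qed
    have finC: "finite C1" "finite (C2 ab)" for ab using fin by (auto simp: C1_def C2_def)
    have "card (unpaired_tuples m N) \<le> card (C1 \<union> (\<Union>ab\<in>P. C2 ab))"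
      by (intro card_mono sub) (use finC fin in auto)
    also have "\<dots> \<le> card C1 + (\<Sum>ab\<in>P. card (C2 ab))"
      using card_Un_le[of C1 "\<Union>ab\<in>P. C2 ab"] card_UN_le[OF fin(2), of C2] by linarith
    finally have "real (card (unpaired_tuples m N)) \<le> real (card C1 + (\<Sum>ab\<in>P. card (C2 ab)))"
      by (simp only: of_nat_le_iff)
    also have "\<dots> = real (card C1) + (\<Sum>ab\<in>P. real (card (C2 ab)))" by simp
    also have "\<dots> \<le> 2 ^ (2*m) * C0 * (1+d) * real N powr (m - c0/2) +
        (\<Sum>ab\<in>P. 2 ^ (2*m) * C0 * real N powr (m - c0/2))"
      by (intro add_mono sum_mono C1 C2)
    also have "\<dots> \<le> 2 ^ (2*m) * C0 * (1+d) * real N powr (m - c0/2) +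
        (2*m)^2 * (2 ^ (2*m) * C0 * real N powr (m - c0/2))"
    proof (intro add_left_mono)
      have "(\<Sum>ab\<in>P. 2 ^ (2*m) * C0 * real N powr (m - c0/2)) =
          real (card P) * (2 ^ (2*m) * C0 * real N powr (m - c0/2))" by simp
      also have "\<dots> \<le> real ((2*m)^2) * (2 ^ (2*m) * C0 * real N powr (m - c0/2))"
        by (intro mult_right_mono) (use cP C0(1) in \<open>simp_all only: of_nat_le_iff\<close>, simp)
      finally show "(\<Sum>ab\<in>P. 2 ^ (2*m) * C0 * real N powr (m - c0/2)) \<le>
         real ((2*m)^2) * (2 ^ (2*m) * C0 * real N powr (m - c0/2))" .
    qed
    finally show ?thesis by (simp add: D_def algebra_simps)
  qed
  moreover have "D > 0" unfolding D_def using C0(1) by (intro add_pos_nonneg mult_pos_pos) auto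
  ultimately show ?thesis using c0 by (intro exI[of _ D] exI[of _ "c0/2"]) auto
qed

section \<open>Quadratic characters and a large sieve over primes\<close>

lemma Legendre_cong: "[a = b] (mod p) \<Longrightarrow> Legendre a p = Legendre b p"
proof -
  assume ab: "[a = b] (mod p)"
  have "[y\<^sup>2 = a] (mod p) \<longleftrightarrow> [y\<^sup>2 = b] (mod p)" for y
    using ab cong_sym cong_trans by blast
  moreover have "[a = 0] (mod p) \<longleftrightarrow> [b = 0] (mod p)"
    using ab cong_sym cong_trans by blast
  ultimately show ?thesis by (simp add: Legendre_def QuadRes_def)
qed

lemma Legendre_values: "Legendre a p \<in> {-1, 0, 1}"
  by (simp add: Legendre_def)

lemma abs_Legendre_le_1: "\<bar>Legendre a p\<bar> \<le> 1"
  using Legendre_values[of a p] by auto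

text \<open>Two elements of \<open>{-1, 0, 1}\<close> differ by at most \<open>2 < p\<close>, so
  congruence modulo \<open>p\<close> is equality.\<close>

lemma Legendre_eqI:
  assumes "p > 2" "[Legendre a p = x] (mod p)" "x \<in> {-1, 0, 1}"
  shows "Legendre a p = x"
proof (rule ccontr)
  assume ne: "Legendre a p \<noteq> x"
  have "p dvd Legendre a p - x" using assms(2) by (simp add: cong_iff_dvd_diff)
  moreover have "\<bar>Legendre a p - x\<bar> \<le> 2" using assms(3) Legendre_values[of a p] by auto
  ultimately show False using assms(1) ne zdvd_imp_le[of p "\<bar>Legendre a p - x\<bar>"] by auto
qed

lemma Legendre_mult:
  assumes "prime (p::nat)" "p > 2"
  shows "Legendre (a * b) p = Legendre a p * Legendre b p"
proof (rule Legendre_eqI)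
  have "[Legendre (a * b) p = (a * b) ^ ((p - 1) div 2)] (mod p)"
    by (rule euler_criterion[OF assms])
  also have "(a * b) ^ ((p - 1) div 2) = a ^ ((p - 1) div 2) * b ^ ((p - 1) div 2)"
    by (rule power_mult_distrib)
  also have "[\<dots> = Legendre a p * Legendre b p] (mod p)"
    using euler_criterion[OF assms] by (intro cong_mult) (auto simp: cong_sym_eq)
  finally show "[Legendre (a * b) p = Legendre a p * Legendre b p] (mod p)" .
  show "Legendre a p * Legendre b p \<in> {-1, 0, 1}"
    using Legendre_values[of a p] Legendre_values[of b p] by auto
qed (use assms in auto)

lemma Legendre_1: "p > 1 \<Longrightarrow> Legendre 1 p = 1"
  by (auto simp: Legendre_def QuadRes_def cong_def intro: exI[of _ 1])

text \<open>Otherwise squaring would map the nonzero residues onto themselves, hence injectively,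
  although 1 and \<open>p - 1\<close> have the same square.\<close>

lemma exists_nonresidue:
  assumes p: "prime (p::nat)" "p > 2"
  shows "\<exists>r. Legendre r p = -1"
proof (rule ccontr)
  assume no: "\<nexists>r. Legendre r p = -1"
  define A where "A = {1..<int p}"
  define f where "f x = x\<^sup>2 mod int p" for x
  have pi: "prime (int p)" using p by simp
  have "f ` A \<subseteq> A"
  proof clarify
    fix x assume x: "x \<in> A"
    hence "\<not> int p dvd x" using zdvd_not_zless by (auto simp: A_def)
    hence "\<not> int p dvd x\<^sup>2" using pi prime_dvd_power by blast
    hence "f x \<noteq> 0" by (simp add: f_def dvd_eq_mod_eq_0)
    moreover have "f x \<ge> 0" "f x < int p" using p by (auto simp: f_def)
    ultimately show "f x \<in> A" by (auto simp: A_def)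
  qed
  moreover have "A \<subseteq> f ` A"
  proof
    fix a assume a: "a \<in> A"
    hence na: "\<not> [a = 0] (mod int p)" using zdvd_not_zless by (auto simp: A_def cong_0_iff)
    have "Legendre a p \<noteq> -1" using no by blast
    hence "QuadRes p a" using na by (auto simp: Legendre_def split: if_splits)
    then obtain y where y: "[y\<^sup>2 = a] (mod int p)" by (auto simp: QuadRes_def)
    have "\<not> int p dvd y"
    proof
      assume "int p dvd y"
      hence "[y\<^sup>2 = 0] (mod int p)" by (simp add: cong_0_iff power2_eq_square)
      thus False using y na cong_sym cong_trans by blast
    qed
    hence "y mod int p \<noteq> 0" by (simp add: dvd_eq_mod_eq_0)
    moreover have "y mod int p \<ge> 0" "y mod int p < int p" using p by auto
    ultimately have "y mod int p \<in> A" by (auto simp: A_def)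
    moreover have "f (y mod int p) = a"
      using y a by (auto simp: f_def cong_def power_mod A_def)
    ultimately show "a \<in> f ` A" by blast
  qed
  ultimately have "f ` A = A" by blast
  hence "inj_on f A" by (intro eq_card_imp_inj_on) (auto simp: A_def)
  moreover have "f 1 = f (int p - 1)"
  proof -
    have "(int p - 1)\<^sup>2 = 1 + int p * (int p - 2)" by (simp add: power2_eq_square algebra_simps)
    thus ?thesis by (simp add: f_def)
  qed
  ultimately have "1 = int p - 1" by (rule inj_onD[of f A]) (use p in \<open>auto simp: A_def\<close>)
  thus False using p by simp
qed

section \<open>Real characters attached to integers by quadratic reciprocity\<close>

definition chi4 :: "int \<Rightarrow> int" where
  "chi4 m = (if m mod 4 = 1 then 1 else if m mod 4 = 3 then -1 else 0)"

definition chi8 :: "int \<Rightarrow> int" where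
  "chi8 m = (if m mod 8 \<in> {1, 7} then 1 else if m mod 8 \<in> {3, 5} then -1 else 0)"

lemma chi4_mult: "chi4 (a * b) = chi4 a * chi4 b"
proof -
  have "\<forall>x\<in>{0,1,2,3}. \<forall>y\<in>{0,1,2,3}. chi4 (x * y) = chi4 x * chi4 y"
    by (simp add: chi4_def)
  moreover have "a mod 4 \<in> {0,1,2,3}" "b mod 4 \<in> {0,1,2,3}" by auto
  moreover have "chi4 (a mod 4 * (b mod 4)) = chi4 (a * b)" "chi4 (a mod 4) = chi4 a" "chi4 (b mod 4) = chi4 b"
    by (simp_all add: chi4_def mod_mult_eq)
  ultimately show ?thesis by metis
qed

lemma chi8_mult: "chi8 (a * b) = chi8 a * chi8 b"
proof -
  have "\<forall>x\<in>{0,1,2,3,4,5,6,7}. \<forall>y\<in>{0,1,2,3,4,5,6,7}. chi8 (x * y) = chi8 x * chi8 y"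
    by (simp add: chi8_def)
  moreover have "a mod 8 \<in> {0,1,2,3,4,5,6,7}" "b mod 8 \<in> {0,1,2,3,4,5,6,7}" by auto
  moreover have "chi8 (a mod 8 * (b mod 8)) = chi8 (a * b)" "chi8 (a mod 8) = chi8 a" "chi8 (b mod 8) = chi8 b"
    by (simp_all add: chi8_def mod_mult_eq)
  ultimately show ?thesis by metis
qed

lemma minus_one_power_chi4:
  assumes "odd (q::nat)"
  shows "(-1::int) ^ ((q - 1) div 2) = chi4 (int q)"
proof -
  have "int q mod 4 = int (q mod 4)" by (simp add: of_nat_mod)
  moreover have "q mod 4 = 1 \<or> q mod 4 = 3" using assms by presburger
  moreover have "even ((q - 1) div 2)" if "q mod 4 = 1" using that by presburger
  moreover have "odd ((q - 1) div 2)" if "q mod 4 = 3" using that by presburger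
  ultimately show ?thesis by (auto simp: chi4_def)
qed

lemma Legendre_minus_1:
  assumes q: "prime (q::nat)" "q > 2"
  shows "Legendre (-1) q = chi4 q"
proof (rule Legendre_eqI)
  have "odd q" using q prime_odd_nat by auto
  show "[Legendre (-1) q = chi4 q] (mod q)"
    using euler_criterion[OF q, of "-1"] minus_one_power_chi4[OF \<open>odd q\<close>] by simp
qed (use q in \<open>auto simp: chi4_def\<close>)

text \<open>Gauss's lemma: with \<open>h = (q - 1) / 2\<close>, the multiples \<open>2 * x\<close>
  for \<open>1 \<le> x \<le> h\<close> need no reduction modulo \<open>q\<close>
  (\<open>C = B\<close>), and those with \<open>x > h div 2\<close> are the ones exceeding
  \<open>h\<close>. Their number has a parity that depends only on \<open>q mod 8\<close>.\<close>

lemma Legendre_2: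
  assumes q: "prime (q::nat)" "q > 2"
  shows "Legendre 2 q = chi8 q"
proof -
  have odd: "odd q" using q prime_odd_nat by auto
  interpret GAUSS q 2
    using q zdvd_imp_le[of "int q" 2] by unfold_locales (auto simp: cong_0_iff)
  define h where "h = (int q - 1) div 2"
  have h: "int q = 2 * h + 1" using p_eq2 by (simp add: h_def)
  have "C = B"
  proof -
    have "(\<lambda>x. x mod int q) ` B = (\<lambda>x. x) ` B"
      by (rule image_cong) (use h in \<open>auto simp: B_def A_def h_def[symmetric]\<close>)
    thus ?thesis by (simp add: C_def)
  qed
  hence "E = (\<lambda>x. x * 2) ` {h div 2<..h}"
    by (auto simp: E_def B_def A_def h_def[symmetric] image_iff)
  hence "card E = nat (h - h div 2)" by (simp add: card_image inj_on_def)
  hence L: "Legendre 2 q = (-1) ^ nat (h - h div 2)" using gauss_lemma by simp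
  have "int q mod 8 \<in> {1,3,5,7}" using odd by (simp, presburger)
  moreover have "even (h - h div 2)" if "int q mod 8 = 1 \<or> int q mod 8 = 7"
    using that h by presburger
  moreover have "odd (h - h div 2)" if "int q mod 8 = 3 \<or> int q mod 8 = 5"
    using that h by presburger
  moreover have "h - h div 2 \<ge> 0" using h q by presburger
  ultimately show ?thesis unfolding L by (auto simp: chi8_def even_nat_iff)
qed

text \<open>For a prime \<open>p\<close>, the Dirichlet character modulo \<open>4p\<close> or \<open>8\<close> that by quadratic
  reciprocity takes the value \<open>(p/q)\<close> at every odd prime \<open>q\<close>.\<close>

definition qchar :: "nat \<Rightarrow> int \<Rightarrow> int" where
  "qchar p m = (if p = 2 then chi8 m else Legendre m p * (if p mod 4 = 1 then 1 else chi4 m))"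

lemma qchar_eq_Legendre:
  assumes p: "prime p" and q: "prime q" "q > 2"
  shows "qchar p (int q) = Legendre (int p) q"
proof (cases "p = 2")
  case True
  thus ?thesis using Legendre_2[OF q] by (simp add: qchar_def)
next
  case False
  hence p2: "p > 2" using p prime_ge_2_nat[of p] by linarith
  show ?thesis
  proof (cases "p = q")
    case True
    thus ?thesis using False by (simp add: qchar_def Legendre_def cong_0_iff)
  next
    case ne: False
    have odd: "odd p" "odd q" using p q p2 prime_odd_nat by auto
    have R: "Legendre p q * Legendre q p = (-1::int) ^ ((p - 1) div 2 * ((q - 1) div 2))"
      by (rule Quadratic_Reciprocity[OF p p2 q ne])
    have nz: "Legendre q p \<noteq> 0"
      using p q ne by (auto simp: Legendre_def cong_0_iff primes_dvd_imp_eq)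
    have sgn: "(-1::int) ^ ((p - 1) div 2 * ((q - 1) div 2)) = (if p mod 4 = 1 then 1 else chi4 q)"
    proof (cases "p mod 4 = 1")
      case True
      hence "even ((p - 1) div 2)" by presburger
      thus ?thesis using True by simp
    next
      case False
      hence "odd ((p - 1) div 2)" using odd by presburger
      hence "(-1::int) ^ ((p - 1) div 2 * ((q - 1) div 2)) = (-1) ^ ((q - 1) div 2)"
        by (simp add: power_mult)
      thus ?thesis using False minus_one_power_chi4[OF odd(2)] by simp
    qed
    have "Legendre p q * (Legendre q p * Legendre q p) = Legendre q p * (if p mod 4 = 1 then 1 else chi4 q)"
      using R sgn by (simp add: mult_ac)
    moreover have "Legendre q p * Legendre q p = 1" using nz Legendre_values[of q p] by auto
    ultimately show ?thesis using False by (simp add: qchar_def)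
  qed
qed

lemma qchar_mult: "prime p \<Longrightarrow> qchar p (a * b) = qchar p a * qchar p b"
  using Legendre_mult[of p a b] prime_ge_2_nat[of p]
  by (auto simp: qchar_def chi8_mult chi4_mult)

lemma abs_chi4_le_1: "\<bar>chi4 m\<bar> \<le> 1"
  by (simp add: chi4_def)

lemma abs_qchar_le_1: "\<bar>qchar p m\<bar> \<le> 1"
proof -
  have "\<bar>Legendre m p\<bar> * \<bar>chi4 m\<bar> \<le> 1 * 1"
    by (intro mult_mono abs_Legendre_le_1 abs_chi4_le_1) auto
  thus ?thesis using abs_Legendre_le_1[of m p] by (auto simp: qchar_def chi8_def abs_mult)
qed

lemma chi4_periodic: "4 dvd D \<Longrightarrow> chi4 (m + D) = chi4 m"
  by (auto simp: chi4_def elim!: dvdE)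

lemma qchar_periodic:
  assumes "8 * int p dvd D"
  shows "qchar p (m + D) = qchar p m"
proof -
  have "8 dvd D" "int p dvd D"
    using assms dvd_mult_left dvd_mult_right by blast+
  moreover from this have "4 dvd D" using dvd_trans[of 4 8 D] by simp
  ultimately have D: "4 dvd D" "8 dvd D" "int p dvd D" by blast+
  hence "chi4 (m + D) = chi4 m" "chi8 (m + D) = chi8 m" "Legendre (m + D) p = Legendre m p"
    using D by (auto simp: chi4_periodic chi8_def cong_iff_dvd_diff mod_add_right_eq[symmetric] intro!: Legendre_cong)
  thus ?thesis by (simp add: qchar_def)
qed

text \<open>For nonzero \<open>k\<close> a real Dirichlet character of modulus dividing
  \<open>8 * \<bar>k\<bar>\<close> which agrees with (k/q) at every odd prime \<open>q\<close>. It
  turns a function of the modulus \<open>q\<close> into a periodic function of \<open>q\<close>, as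
  the sieve requires.\<close>

definition jac :: "int \<Rightarrow> int \<Rightarrow> int" where
  "jac k m = (if k < 0 then chi4 m else 1) * (\<Prod>p\<in>#prime_factorization (nat \<bar>k\<bar>). qchar p m)"

lemma Legendre_prod_mset:
  assumes "prime (q::nat)" "q > 2"
  shows "Legendre (int (\<Prod>\<^sub># M)) q = (\<Prod>p\<in>#M. Legendre (int p) q)"
  by (induction M) (use assms in \<open>auto simp: Legendre_1 Legendre_mult\<close>)

lemma jac_eq_Legendre:
  assumes q: "prime (q::nat)" "q > 2" and k: "k \<noteq> 0"
  shows "jac k (int q) = Legendre k q"
proof -
  have "(\<Prod>p\<in>#prime_factorization (nat \<bar>k\<bar>). qchar p (int q)) =
        (\<Prod>p\<in>#prime_factorization (nat \<bar>k\<bar>). Legendre (int p) q)"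
    by (intro arg_cong[of _ _ prod_mset] image_mset_cong)
       (auto intro!: qchar_eq_Legendre q dest: in_prime_factors_imp_prime)
  also have "\<dots> = Legendre (int (\<Prod>\<^sub># (prime_factorization (nat \<bar>k\<bar>)))) q"
    by (rule Legendre_prod_mset[OF q, symmetric])
  also have "int (\<Prod>\<^sub># (prime_factorization (nat \<bar>k\<bar>))) = \<bar>k\<bar>"
    using k by (simp add: prod_mset_prime_factorization_nat)
  finally have *: "jac k (int q) = (if k < 0 then chi4 (int q) else 1) * Legendre \<bar>k\<bar> q"
    by (simp add: jac_def)
  show ?thesis
  proof (cases "k < 0")
    case True
    hence "Legendre k q = Legendre (-1) q * Legendre \<bar>k\<bar> q"
      by (simp flip: Legendre_mult[OF q])
    thus ?thesis using * True by (simp add: Legendre_minus_1[OF q])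
  next
    case False
    thus ?thesis using * by simp
  qed
qed

lemma abs_prod_mset_le_1: "(\<And>x. x \<in># M \<Longrightarrow> \<bar>f x\<bar> \<le> 1) \<Longrightarrow> \<bar>\<Prod>x\<in>#M. f x\<bar> \<le> (1::int)"
proof (induction M)
  case (add x M)
  have "\<bar>f x\<bar> * \<bar>\<Prod>x\<in>#M. f x\<bar> \<le> 1 * 1" using add by (intro mult_mono) auto
  thus ?case by (simp add: abs_mult)
qed simp

lemma abs_jac_le_1: "\<bar>jac k m\<bar> \<le> 1"
proof -
  have "\<bar>if k < 0 then chi4 m else 1\<bar> * \<bar>\<Prod>p\<in>#prime_factorization (nat \<bar>k\<bar>). qchar p m\<bar> \<le> 1 * 1"
    by (intro mult_mono abs_prod_mset_le_1 abs_qchar_le_1) (auto simp: abs_chi4_le_1)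
  thus ?thesis by (simp add: jac_def abs_mult)
qed

lemma jac_mult_right: "jac k (a * m) = jac k a * jac k m"
proof -
  have "(\<Prod>p\<in>#prime_factorization (nat \<bar>k\<bar>). qchar p (a * m)) =
    (\<Prod>p\<in>#prime_factorization (nat \<bar>k\<bar>). qchar p a * qchar p m)"
    by (intro arg_cong[of _ _ prod_mset] image_mset_cong)
       (auto intro!: qchar_mult dest: in_prime_factors_imp_prime)
  thus ?thesis by (simp add: jac_def chi4_mult prod_mset.distrib)
qed

lemma jac_periodic:
  assumes "8 * \<bar>k\<bar> dvd D"
  shows "jac k (m + D) = jac k m"
proof -
  have "qchar p (m + D) = qchar p m" if "p \<in># prime_factorization (nat \<bar>k\<bar>)" for p
  proof (rule qchar_periodic)
    have "p dvd nat \<bar>k\<bar>" using that by auto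
    hence "int p dvd \<bar>k\<bar>" by (simp add: int_dvd_int_iff[symmetric] del: int_dvd_int_iff)
    hence "8 * int p dvd 8 * \<bar>k\<bar>" by simp
    thus "8 * int p dvd D" using assms dvd_trans by blast
  qed
  moreover have "4 dvd D" using assms by (auto elim!: dvdE)
  ultimately show ?thesis by (simp add: jac_def chi4_periodic cong: image_mset_cong)
qed

lemma exists_odd_multiplicity:
  assumes "n > 0" "\<nexists>s. n = (s::nat)\<^sup>2"
  shows "\<exists>p. prime p \<and> odd (multiplicity p n)"
proof (rule ccontr)
  assume "\<not> ?thesis"
  hence ev: "even (multiplicity p n)" if "prime p" for p using that by blast
  have "n = (\<Prod>p\<in>prime_factors n. p ^ multiplicity p n)"
    using assms(1) prime_factorization_nat by simp
  also have "\<dots> = (\<Prod>p\<in>prime_factors n. (p ^ (multiplicity p n div 2))\<^sup>2)"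
    by (intro prod.cong refl) (auto simp: ev in_prime_factors_imp_prime simp flip: power_mult)
  also have "\<dots> = (\<Prod>p\<in>prime_factors n. p ^ (multiplicity p n div 2))\<^sup>2"
    by (simp add: prod_power_distrib)
  finally show False using assms(2) by blast
qed

text \<open>Choose a prime \<open>p\<close> of odd multiplicity in \<open>n\<close>. By the Chinese
  remainder theorem there is an \<open>a\<close> for which \<open>qchar p\<close> is -1 and which is
  1 modulo every other odd prime of \<open>n * M\<close>; then only \<open>p\<close> contributes,
  with an odd power of -1. The condition \<open>chi4 a = 1\<close> makes the factors
  \<open>chi4\<close> in \<open>qchar\<close> and the sign of an integer in \<open>jac\<close>
  harmless.\<close>

lemma exists_character_witness:
  assumes n: "n > 0" "\<nexists>s. n = (s::nat)\<^sup>2" and M: "M > 0"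
  shows "\<exists>a. coprime a (int (8 * n * M)) \<and> chi4 a = 1 \<and> (\<Prod>p\<in>#prime_factorization n. qchar p a) = -1"
proof -
  obtain p where p: "prime p" "odd (multiplicity p n)" using exists_odd_multiplicity[OF n] by blast
  have pn: "p \<in> prime_factors n"
    using p n by (auto simp: prime_factors_multiplicity odd_pos)
  define S where "S = prime_factors (n * M) - {p, 2}"
  define W where "W = int (\<Prod>S)"
  have S: "finite S" "\<And>r. r \<in> S \<Longrightarrow> prime r" "2 \<notin> S" "p \<notin> S" by (auto simp: S_def)
  have rW: "int r dvd W" if "r \<in> S" for r
    using that S(1) by (auto simp: W_def intro!: dvd_prodI)
  have copW: "coprime (int r) W" if "prime r" "r \<notin> S" for r
    unfolding W_def using that S by (auto intro!: prod_coprime_right primes_coprime)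
  have cop8W: "coprime 8 W" using copW[of 2] S(3) coprime_power_left_iff[of "2::int" 3 W] by simp
  \<comment> \<open>For \<open>p = 2\<close> the residue 5 modulo 8 is the one with
    \<open>chi8\<close> equal to -1 and \<open>chi4\<close> equal to 1.\<close>
  have "\<exists>a. [a = 1] (mod W) \<and> (p = 2 \<longrightarrow> [a = 5] (mod 8)) \<and> (p \<noteq> 2 \<longrightarrow> [a = 1] (mod 8) \<and> Legendre a p = -1)"
  proof (cases "p = 2")
    case True
    obtain a where "[a = 5] (mod 8)" "[a = 1] (mod W)"
      using binary_chinese_remainder_int[OF cop8W, of 5 1] by blast
    thus ?thesis using True by blast
  next
    case False
    hence p2: "p > 2" using p prime_ge_2_nat[of p] by linarith
    obtain r where r: "Legendre r p = -1" using exists_nonresidue[OF p(1) p2] by blast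
    have "coprime (int p) 2" using prime_odd_nat[OF p(1) p2] by simp
    hence "coprime (int p) 8" using coprime_power_right_iff[of "int p" 2 3] by simp
    hence "coprime (int p) (8 * W)" using copW[OF p(1) S(4)] by (rule coprime_mult_right_iff[THEN iffD2, OF conjI])
    then obtain a where a: "[a = r] (mod int p)" "[a = 1] (mod 8 * W)"
      using binary_chinese_remainder_int[of "int p" "8 * W" r 1] by blast
    have "[a = 1] (mod W)" "[a = 1] (mod 8)" by (rule cong_dvd_modulus[OF a(2)], simp)+
    moreover have "Legendre a p = -1" using Legendre_cong[OF a(1)] r by simp
    ultimately show ?thesis using False by blast
  qed
  then obtain a where a: "[a = 1] (mod W)" "p = 2 \<Longrightarrow> [a = 5] (mod 8)"
    "p \<noteq> 2 \<Longrightarrow> [a = 1] (mod 8)" "p \<noteq> 2 \<Longrightarrow> Legendre a p = -1" by blast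
  have a8: "a mod 8 = (if p = 2 then 5 else 1)" using a by (auto simp: cong_def)
  hence a4: "a mod 4 = 1" by presburger
  hence chi4a: "chi4 a = 1" by (simp add: chi4_def)
  have ar: "[a = 1] (mod int r)" if "r \<in> S" for r using a(1) rW[OF that] cong_dvd_modulus by blast
  have "\<not> int r dvd a" if r: "r \<in> prime_factors (8 * n * M)" for r
  proof
    assume d: "int r dvd a"
    have pr: "prime r" using r by auto
    have "r dvd 8 * (n * M)" using r by (auto simp: mult.assoc)
    hence "r dvd 8 \<or> r dvd n * M" using pr by (simp add: prime_dvd_mult_iff)
    hence "r = 2 \<or> r = p \<or> r \<in> S"
    proof
      assume "r dvd 8"
      hence "r dvd 2 ^ 3" by simp
      hence "r dvd 2" using pr prime_dvd_power by blast
      thus ?thesis using pr by (simp add: primes_dvd_imp_eq)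
    next
      assume "r dvd n * M"
      thus ?thesis using pr n M by (auto simp: S_def in_prime_factors_iff)
    qed
    moreover have False if "r = 2" using that d a4 by presburger
    moreover have False if "r = p" "p \<noteq> 2" using that d a(4) by (auto simp: Legendre_def cong_0_iff)
    moreover have False if "r \<in> S"
    proof -
      have "int r dvd a - 1" using ar[OF that] by (simp add: cong_iff_dvd_diff)
      hence "int r dvd 1" using dvd_diff[OF d, of "a - 1"] by simp
      thus False using pr by auto
    qed
    ultimately show False by blast
  qed
  hence "coprime a (int (8 * n * M))"
  proof -
    assume *: "\<And>r. r \<in> prime_factors (8 * n * M) \<Longrightarrow> \<not> int r dvd a"
    show ?thesis
    proof (rule ccontr)
      assume "\<not> coprime a (int (8 * n * M))"
      define g where "g = gcd a (int (8*n*M))"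
      have "g \<noteq> 1" "g \<ge> 0" using \<open>\<not> coprime _ _\<close> by (simp_all only: g_def coprime_iff_gcd_eq_1 gcd_ge_0_int simp_thms)
      hence "nat g \<noteq> 1" by simp
      then obtain r where r: "prime r" "r dvd nat g" using prime_factor_nat by blast
      have "int r dvd int (nat g)" using r(2) by (simp only: int_dvd_int_iff)
      hence rg: "int r dvd g" using \<open>g \<ge> 0\<close> by simp
      have "int r dvd a" "int r dvd int (8*n*M)"
        unfolding g_def by (rule dvd_trans[OF rg[unfolded g_def]], rule gcd_dvd1, rule dvd_trans[OF rg[unfolded g_def]], rule gcd_dvd2)
      hence "r dvd 8*n*M" by (simp only: int_dvd_int_iff)
      hence "r \<in> prime_factors (8*n*M)" using r(1) n M by (auto simp: in_prime_factors_iff)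
      thus False using * \<open>int r dvd a\<close> by blast
    qed
  qed
  moreover have "(\<Prod>r\<in>#prime_factorization n. qchar r a) = -1"
  proof -
    have q1: "qchar r a = 1" if "r \<in> prime_factors n - {p}" for r
    proof (cases "r = 2")
      case True
      thus ?thesis using that a8 by (auto simp: qchar_def chi8_def)
    next
      case False
      hence "r \<in> S" using that M by (auto simp: S_def prime_factors_product n)
      have "prime r" using that by auto
      hence "Legendre a r = 1" using Legendre_cong[OF ar[OF \<open>r \<in> S\<close>]] prime_gt_1_nat[of r] by (simp add: Legendre_1)
      thus ?thesis using False chi4a by (simp add: qchar_def)
    qed
    have qp: "qchar p a = -1" using a8 a(4) chi4a by (auto simp: qchar_def chi8_def)
    have "(\<Prod>r\<in>#prime_factorization n. qchar r a) = (\<Prod>r\<in>prime_factors n. qchar r a ^ multiplicity r n)"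
      by (subst image_prod_mset_multiplicity)
         (auto intro!: prod.cong simp: count_prime_factorization_prime in_prime_factors_imp_prime)
    also have "\<dots> = qchar p a ^ multiplicity p n * (\<Prod>r\<in>prime_factors n - {p}. qchar r a ^ multiplicity r n)"
      using pn by (intro prod.remove) auto
    also have "\<dots> = -1" using q1 qp p(2) by simp
    finally show ?thesis .
  qed
  ultimately show ?thesis using chi4a by blast
qed

text \<open>Replacing \<open>m\<close> by \<open>a * m\<close> negates the product of the two
  characters, hence every complete sum of it over a period. Coprimality to \<open>M\<close>, later a
  product of sieve moduli, keeps the divisibility conditions of the sieve unchanged under the
  substitution.\<close>

lemma jac_character_witness:
  assumes k: "k \<noteq> 0" "l \<noteq> 0" "\<nexists>s. nat \<bar>k * l\<bar> = s\<^sup>2" and M: "M > 0"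
  shows "\<exists>a. coprime a (8 * \<bar>k\<bar> * \<bar>l\<bar> * int M) \<and> jac k a * jac l a = -1"
proof -
  have "nat \<bar>k * l\<bar> > 0" using k by simp
  from exists_character_witness[OF this k(3) M] obtain a where a:
    "coprime a (int (8 * nat \<bar>k * l\<bar> * M))" "chi4 a = 1"
    "(\<Prod>p\<in>#prime_factorization (nat \<bar>k * l\<bar>). qchar p a) = -1" by blast
  have "nat \<bar>k * l\<bar> = nat \<bar>k\<bar> * nat \<bar>l\<bar>" by (simp add: abs_mult nat_mult_distrib)
  hence "prime_factorization (nat \<bar>k * l\<bar>) = prime_factorization (nat \<bar>k\<bar>) + prime_factorization (nat \<bar>l\<bar>)"
    using k by (simp add: prime_factorization_mult)
  hence "(\<Prod>p\<in>#prime_factorization (nat \<bar>k\<bar>). qchar p a) * (\<Prod>p\<in>#prime_factorization (nat \<bar>l\<bar>). qchar p a) = -1"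
    using a(3) by simp
  hence "jac k a * jac l a = -1" using a(2) unfolding jac_def by (simp only: if_cancel mult_1)
  moreover have "int (8 * nat \<bar>k * l\<bar> * M) = 8 * \<bar>k\<bar> * \<bar>l\<bar> * int M" by (simp add: abs_mult)
  ultimately show ?thesis using a(1) by metis
qed

section \<open>Sums of periodic functions\<close>

definition periodic :: "(int \<Rightarrow> 'a) \<Rightarrow> nat \<Rightarrow> bool" where
  "periodic F D \<longleftrightarrow> (\<forall>m. F (m + int D) = F m)"

lemma periodic_mult_period: "periodic F D \<Longrightarrow> F (m + int D * t) = F m"
proof (induction t rule: int_induct[of _ 0])
  case (step1 i)
  have "F (m + int D * (i + 1)) = F ((m + int D * i) + int D)" by (simp add: algebra_simps)
  thus ?case using step1 by (simp add: periodic_def)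
next
  case (step2 i)
  have "F (m + int D * i) = F ((m + int D * (i - 1)) + int D)" by (simp add: algebra_simps)
  thus ?case using step2 by (simp add: periodic_def)
qed simp

lemma periodic_mod: "periodic F D \<Longrightarrow> F (m mod int D) = F m"
  using periodic_mult_period[of F D "m mod int D" "m div int D"] by (simp add: mult.commute)

lemma periodic_mult: "periodic F D \<Longrightarrow> periodic G D \<Longrightarrow> periodic (\<lambda>m. F m * G m :: 'a::times) D"
  by (simp add: periodic_def)

lemma sum_periodic_coprime:
  fixes F :: "int \<Rightarrow> 'a::comm_monoid_add"
  assumes F: "periodic F D" and D: "D > 0" and a: "coprime a (int D)"
  shows "(\<Sum>m\<in>{0..<int D}. F (a * m)) = (\<Sum>m\<in>{0..<int D}. F m)"
proof -
  have inj: "inj_on (\<lambda>m. a * m mod int D) {0..<int D}"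
  proof (rule inj_onI)
    fix x y assume x: "x \<in> {0..<int D}" and y: "y \<in> {0..<int D}"
      and eq: "a * x mod int D = a * y mod int D"
    hence "[a * x = a * y] (mod int D)" by (simp add: cong_def)
    hence "[x = y] (mod int D)" using a by (simp add: cong_mult_lcancel)
    thus "x = y" using x y by (simp add: cong_def)
  qed
  have "(\<lambda>m. a * m mod int D) ` {0..<int D} = {0..<int D}"
    by (rule card_subset_eq) (use D inj in \<open>auto simp: card_image\<close>)
  hence "(\<Sum>m\<in>{0..<int D}. F m) = (\<Sum>m\<in>{0..<int D}. F (a * m mod int D))"
    using sum.reindex[OF inj, of F] by simp
  thus ?thesis by (simp add: periodic_mod[OF F])
qed

lemma sum_periodic_shift:
  fixes F :: "int \<Rightarrow> 'a::comm_monoid_add"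
  assumes F: "periodic F D" and D: "D > 0"
  shows "(\<Sum>m\<in>{A..<A + int D}. F m) = (\<Sum>m\<in>{0..<int D}. F m)"
proof -
  have inj: "inj_on (\<lambda>m. m mod int D) {A..<A + int D}"
  proof (rule inj_onI)
    fix x y assume "x \<in> {A..<A + int D}" "y \<in> {A..<A + int D}" "x mod int D = y mod int D"
    hence "int D dvd x - y" "\<bar>x - y\<bar> < int D" by (auto simp: mod_eq_dvd_iff)
    thus "x = y" using zdvd_imp_le[of "int D" "\<bar>x - y\<bar>"] by (cases "x = y") auto
  qed
  have "(\<lambda>m. m mod int D) ` {A..<A + int D} = {0..<int D}"
    by (rule card_subset_eq) (use D inj in \<open>auto simp: card_image\<close>)
  hence "(\<Sum>m\<in>{0..<int D}. F m) = (\<Sum>m\<in>{A..<A + int D}. F (m mod int D))"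
    using sum.reindex[OF inj, of F] by simp
  thus ?thesis by (simp add: periodic_mod[OF F])
qed

lemma sum_periodic_multiple:
  fixes F :: "int \<Rightarrow> real"
  assumes F: "periodic F D" and D: "D > 0"
  shows "(\<Sum>m\<in>{A..<A + int (D * t)}. F m) = real t * (\<Sum>m\<in>{0..<int D}. F m)"
proof (induction t)
  case (Suc t)
  have "{A..<A + int (D * Suc t)} = {A..<A + int (D * t)} \<union> {A + int (D * t)..<(A + int (D * t)) + int D}"
    by (auto simp: ivl_disj_un algebra_simps simp del: of_nat_mult)
  hence "(\<Sum>m\<in>{A..<A + int (D * Suc t)}. F m) =
     (\<Sum>m\<in>{A..<A + int (D * t)}. F m) + (\<Sum>m\<in>{A + int (D * t)..<(A + int (D * t)) + int D}. F m)"
    by (simp add: sum.union_disjoint)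
  thus ?case unfolding sum_periodic_shift[OF F D] Suc by (simp add: algebra_simps)
qed simp

lemma sum_periodic_interval:
  fixes F :: "int \<Rightarrow> real"
  assumes F: "periodic F D" and D: "D > 0" and B: "\<And>m. \<bar>F m\<bar> \<le> B"
  shows "\<bar>(\<Sum>m\<in>{A..<A + int L}. F m) - real (L div D) * (\<Sum>m\<in>{0..<int D}. F m)\<bar> \<le> real D * B"
proof -
  define t where "t = L div D"
  have L: "L = D * t + L mod D" by (simp add: t_def)
  have le: "D * t \<le> L" by (simp add: t_def)
  have B0: "B \<ge> 0" using B[of 0] by linarith
  have "{A..<A + int L} = {A..<A + int (D * t)} \<union> {A + int (D * t)..<A + int L}"
    using le by (auto simp del: of_nat_mult)
  hence "(\<Sum>m\<in>{A..<A + int L}. F m) = (\<Sum>m\<in>{A..<A + int (D * t)}. F m) + (\<Sum>m\<in>{A + int (D * t)..<A + int L}. F m)"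
    by (simp add: sum.union_disjoint)
  moreover have "\<bar>\<Sum>m\<in>{A + int (D * t)..<A + int L}. F m\<bar> \<le> real D * B"
  proof -
    have "\<bar>\<Sum>m\<in>{A + int (D * t)..<A + int L}. F m\<bar> \<le> (\<Sum>m\<in>{A + int (D * t)..<A + int L}. B)"
      by (rule order_trans[OF sum_abs]) (intro sum_mono B)
    also have "\<dots> = real (L mod D) * B"
    proof -
      have "nat (A + int L - (A + int (D * t))) = L mod D" using L by linarith
      thus ?thesis by simp
    qed
    also have "\<dots> \<le> real D * B" using B0 D by (intro mult_right_mono) auto
    finally show ?thesis .
  qed
  ultimately show ?thesis using sum_periodic_multiple[OF F D, of A t] by (simp add: t_def)
qed

section \<open>The majorant of the primes\<close>

definition local_factor :: "nat \<Rightarrow> int \<Rightarrow> real" where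
  "local_factor p m = (if int p dvd m then 1 - real p else 1)"

text \<open>For a finite set \<open>S\<close> of primes with product \<open>f\<close> this is the
  Ramanujan sum c_f(m) times the Moebius function of \<open>f\<close>; the sign makes its value 1 at
  every \<open>m\<close> coprime to \<open>f\<close>.\<close>

definition psi :: "nat set \<Rightarrow> int \<Rightarrow> real" where
  "psi S m = (\<Prod>p\<in>S. local_factor p m)"

lemma local_factor_periodic: "p dvd D \<Longrightarrow> local_factor p (m + int D) = local_factor p m"
  by (simp add: local_factor_def dvd_add_left_iff)

lemma psi_periodic:
  assumes "\<And>p. p \<in> S \<Longrightarrow> p dvd D"
  shows "periodic (psi S) D"
  using assms by (auto simp: periodic_def psi_def local_factor_periodic intro!: prod.cong)

lemma psi_coprime_mult:
  assumes "coprime a (int D)" "\<And>p. p \<in> S \<Longrightarrow> p dvd D"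
  shows "psi S (a * m) = psi S m"
  unfolding psi_def
proof (rule prod.cong)
  fix p assume p: "p \<in> S"
  have "coprime a (int p)" using assms(1) assms(2)[OF p]
    by (meson coprime_divisors dvd_refl int_dvd_int_iff)
  hence "int p dvd a * m \<longleftrightarrow> int p dvd m"
    by (simp add: coprime_commute coprime_dvd_mult_right_iff)
  thus "local_factor p (a * m) = local_factor p m" by (simp add: local_factor_def)
qed auto

lemma abs_psi_le:
  assumes "\<And>p. p \<in> S \<Longrightarrow> p \<ge> 1"
  shows "\<bar>psi S m\<bar> \<le> real (\<Prod>S)"
proof -
  have "\<bar>psi S m\<bar> = (\<Prod>p\<in>S. \<bar>local_factor p m\<bar>)" by (simp add: psi_def abs_prod)
  also have "\<dots> \<le> (\<Prod>p\<in>S. real p)"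
  proof (intro prod_mono conjI)
    fix p assume "p \<in> S" thus "\<bar>local_factor p m\<bar> \<le> real p"
      using assms[of p] by (auto simp: local_factor_def)
  qed auto
  finally show ?thesis by simp
qed

lemma sum_multiples_periodic:
  fixes F :: "int \<Rightarrow> real"
  assumes F: "periodic F D" and D: "D > 0" and p: "p > 0" "coprime p D"
  shows "(\<Sum>m | m \<in> {0..<int (p * D)} \<and> int p dvd m. F m) = (\<Sum>m\<in>{0..<int D}. F m)"
proof -
  have "{m. m \<in> {0..<int (p * D)} \<and> int p dvd m} = (\<lambda>t. int p * t) ` {0..<int D}"
    using p by (auto simp: zero_le_mult_iff elim!: dvdE)
  hence "(\<Sum>m | m \<in> {0..<int (p * D)} \<and> int p dvd m. F m) = (\<Sum>t\<in>{0..<int D}. F (int p * t))"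
    using p by (simp add: sum.reindex inj_on_def)
  also have "\<dots> = (\<Sum>m\<in>{0..<int D}. F m)" by (rule sum_periodic_coprime[OF F D]) (use p in simp)
  finally show ?thesis .
qed

text \<open>By the Chinese remainder theorem, \<open>p * D\<close> consecutive integers meet each
  residue modulo \<open>D\<close> exactly \<open>p\<close> times, once at a multiple of
  \<open>p\<close>. The values \<open>u = 1 - p\<close>, \<open>v = 1\<close> of
  \<open>local_factor\<close> annihilate the sum, which is the source of orthogonality.\<close>

lemma sum_weighted_multiples:
  assumes F: "periodic F D" and D: "D > 0" and p: "p > 0" "coprime p D"
  shows "(\<Sum>m\<in>{0..<int (p * D)}. F m * (if int p dvd m then u else v)) =
     (u + (real p - 1) * v) * (\<Sum>m\<in>{0..<int D}. F m)"
proof -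
  have "(\<Sum>m\<in>{0..<int (p * D)}. F m * (if int p dvd m then u else v)) =
     (\<Sum>m\<in>{0..<int (p * D)}. v * F m + (u - v) * (if int p dvd m then F m else 0))"
    by (intro sum.cong) (auto simp: algebra_simps)
  also have "\<dots> = v * (\<Sum>m\<in>{0..<int (p * D)}. F m) +
     (u - v) * (\<Sum>m | m \<in> {0..<int (p * D)} \<and> int p dvd m. F m)"
    by (simp add: sum.distrib sum_distrib_left[symmetric] sum.inter_filter[symmetric])
  also have "(\<Sum>m\<in>{0..<int (p * D)}. F m) = real p * (\<Sum>m\<in>{0..<int D}. F m)"
    using sum_periodic_multiple[OF F D, of 0 p] by (simp add: mult.commute)
  also have "(\<Sum>m | m \<in> {0..<int (p * D)} \<and> int p dvd m. F m) = (\<Sum>m\<in>{0..<int D}. F m)"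
    by (rule sum_multiples_periodic[OF F D p])
  finally show ?thesis by (simp add: algebra_simps)
qed

text \<open>Each prime contributes the factor
  \<open>(p - 1)\<^sup>2 + (p - 1) = p\<^sup>2 - p\<close>, here bounded by
  \<open>p\<^sup>2\<close>.\<close>

lemma sum_psi_square:
  assumes "finite S" "\<And>p. p \<in> S \<Longrightarrow> prime p"
  shows "(\<Sum>m\<in>{0..<int (\<Prod>S)}. (psi S m)\<^sup>2) \<le> real (\<Prod>S) ^ 2"
  using assms
proof (induction S rule: finite_induct)
  case empty
  show ?case by (simp add: psi_def)
next
  case (insert p S)
  have pr: "prime p" "\<And>q. q \<in> S \<Longrightarrow> prime q" using insert by auto
  have D: "\<Prod>S > 0" using pr prime_gt_0_nat by (auto intro!: prod_pos)
  have cop: "coprime p (\<Prod>S)" using pr insert(2) by (auto intro!: prod_coprime_right primes_coprime)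
  have per: "periodic (\<lambda>m. (psi S m)\<^sup>2) (\<Prod>S)"
    unfolding power2_eq_square by (intro periodic_mult psi_periodic) (use insert(1) in \<open>auto intro: dvd_prodI\<close>)
  have "(\<Sum>m\<in>{0..<int (\<Prod>(insert p S))}. (psi (insert p S) m)\<^sup>2) =
     (\<Sum>m\<in>{0..<int (p * \<Prod>S)}. (psi S m)\<^sup>2 * (if int p dvd m then (1 - real p)\<^sup>2 else 1))"
    using insert by (intro sum.cong) (auto simp: psi_def local_factor_def power_mult_distrib)
  also have "\<dots> = ((1 - real p)\<^sup>2 + (real p - 1) * 1) * (\<Sum>m\<in>{0..<int (\<Prod>S)}. (psi S m)\<^sup>2)"
    using sum_weighted_multiples[OF per D prime_gt_0_nat[OF pr(1)] cop] by simp
  also have "\<dots> \<le> (real p)\<^sup>2 * (real (\<Prod>S) ^ 2)"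
  proof (intro mult_mono)
    have "(1 - real p)\<^sup>2 + (real p - 1) * 1 = (real p)\<^sup>2 - real p" by (simp add: power2_eq_square algebra_simps)
    thus "(1 - real p)\<^sup>2 + (real p - 1) * 1 \<le> (real p)\<^sup>2" by simp
  qed (use insert in \<open>auto intro: sum_nonneg\<close>)
  also have "\<dots> = real (\<Prod>(insert p S)) ^ 2" using insert by (simp add: power_mult_distrib)
  finally show ?case .
qed

lemma sum_psi_orthogonal_aux:
  assumes S: "finite S" "\<And>p. p \<in> S \<Longrightarrow> prime p" and S': "finite S'" "\<And>p. p \<in> S' \<Longrightarrow> prime p"
    and p: "p \<in> S" "p \<notin> S'"
  shows "(\<Sum>m\<in>{0..<int (\<Prod>S * \<Prod>S')}. psi S m * psi S' m) = 0"
proof -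
  define D where "D = \<Prod>(S - {p}) * \<Prod>S'"
  have pr: "prime p" using S p by auto
  have DS: "\<Prod>S * \<Prod>S' = p * D" using S p by (simp add: D_def prod.remove mult.assoc)
  have D: "D > 0" using S S' prime_gt_0_nat by (auto simp: D_def intro!: prod_pos)
  have cop: "coprime p D" using S S' p pr by (auto simp: D_def intro!: prod_coprime_right primes_coprime)
  have per: "periodic (\<lambda>m. psi (S - {p}) m * psi S' m) D"
    by (intro periodic_mult psi_periodic) (use S S' in \<open>auto simp: D_def intro!: dvd_prodI intro: dvd_mult dvd_mult2\<close>)
  have "(\<Sum>m\<in>{0..<int (\<Prod>S * \<Prod>S')}. psi S m * psi S' m) =
    (\<Sum>m\<in>{0..<int (p * D)}. (psi (S - {p}) m * psi S' m) * (if int p dvd m then 1 - real p else 1))"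
    unfolding DS using S p by (intro sum.cong) (auto simp: psi_def prod.remove local_factor_def)
  also have "\<dots> = ((1 - real p) + (real p - 1) * 1) * (\<Sum>m\<in>{0..<int D}. psi (S - {p}) m * psi S' m)"
    by (rule sum_weighted_multiples[OF per D prime_gt_0_nat[OF pr] cop])
  finally show ?thesis by simp
qed

lemma sum_psi_orthogonal:
  assumes S: "finite S" "\<And>p. p \<in> S \<Longrightarrow> prime p" and S': "finite S'" "\<And>p. p \<in> S' \<Longrightarrow> prime p"
    and ne: "S \<noteq> S'"
  shows "(\<Sum>m\<in>{0..<int (\<Prod>S * \<Prod>S')}. psi S m * psi S' m) = 0"
proof (cases "S \<subseteq> S'")
  case False
  then obtain p where "p \<in> S" "p \<notin> S'" by blast
  thus ?thesis using sum_psi_orthogonal_aux[OF S S'] by blast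
next
  case True
  then obtain p where "p \<in> S'" "p \<notin> S" using ne by blast
  thus ?thesis using sum_psi_orthogonal_aux[OF S' S] by (simp add: mult.commute)
qed

definition sqfree :: "nat \<Rightarrow> nat set" where
  "sqfree R = {f \<in> {1..R}. squarefree f}"

text \<open>The counterpart of the sum of 1/phi(f) over squarefree \<open>f\<close> in Selberg's
  sieve. The weights 1/f still give the order \<open>ln R\<close>, and a lower bound follows from
  the squarefree decomposition of integers.\<close>

definition sieve_mass :: "nat \<Rightarrow> real" where
  "sieve_mass R = (\<Sum>f\<in>sqfree R. 1 / real f)"

text \<open>The Selberg-type majorant is \<open>(sieve_poly R m / sieve_mass R)\<^sup>2\<close>: it is \<open>1\<close> at primes
  exceeding \<open>R\<close>, and the functions \<open>psi\<close> are pairwise orthogonal over the integers.\<close>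

definition sieve_poly :: "nat \<Rightarrow> int \<Rightarrow> real" where
  "sieve_poly R m = (\<Sum>f\<in>sqfree R. psi (prime_factors f) m / real f)"

lemma finite_sqfree [simp]: "finite (sqfree R)"
  by (simp add: sqfree_def)

lemma card_sqfree_le: "card (sqfree R) \<le> R"
proof -
  have "card (sqfree R) \<le> card {1..R}" by (rule card_mono) (auto simp: sqfree_def)
  thus ?thesis by simp
qed

lemma sqfree_D:
  assumes "f \<in> sqfree R"
  shows "f \<ge> 1" "f \<le> R" "\<Prod>(prime_factors f) = f"
proof -
  show f: "f \<ge> 1" "f \<le> R" using assms by (auto simp: sqfree_def)
  have "f = (\<Prod>p\<in>prime_factors f. p ^ multiplicity p f)" using prime_factorization_nat f by simp
  also have "\<dots> = (\<Prod>p\<in>prime_factors f. p)"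
  proof (intro prod.cong refl)
    fix p assume p: "p \<in> prime_factors f"
    have "multiplicity p f \<le> 1" using assms p by (auto simp: sqfree_def squarefree_factorial_semiring')
    moreover have "multiplicity p f > 0" using p by (simp add: prime_factors_multiplicity)
    ultimately have "multiplicity p f = 1" by linarith
    thus "p ^ multiplicity p f = p" by simp
  qed
  finally show "\<Prod>(prime_factors f) = f" by simp
qed

lemma sieve_poly_prime:
  assumes "prime q" "q > R"
  shows "sieve_poly R (int q) = sieve_mass R"
  unfolding sieve_poly_def sieve_mass_def
proof (intro sum.cong refl)
  fix f assume f: "f \<in> sqfree R"
  have "psi (prime_factors f) (int q) = (\<Prod>p\<in>prime_factors f. 1)"
    unfolding psi_def
  proof (intro prod.cong refl)
    fix p assume p: "p \<in> prime_factors f"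
    have "p \<le> f" using p f by (auto intro: dvd_imp_le simp: sqfree_def)
    hence "p \<noteq> q" using assms f by (auto simp: sqfree_def)
    moreover have "prime p" using p by auto
    ultimately have "\<not> p dvd q" using assms(1) primes_dvd_imp_eq by blast
    thus "local_factor p (int q) = 1" by (simp add: local_factor_def)
  qed
  thus "psi (prime_factors f) (int q) / real f = 1 / real f" by simp
qed

lemma sieve_mass_ge_1: "R \<ge> 1 \<Longrightarrow> sieve_mass R \<ge> 1"
  unfolding sieve_mass_def using member_le_sum[of 1 "sqfree R" "\<lambda>f. 1 / real f"]
  by (simp add: sqfree_def)

lemma sieve_bilinear:
  assumes E: "\<And>f g. f \<in> sqfree R \<Longrightarrow> g \<in> sqfree R \<Longrightarrow>
     \<bar>\<Sum>m\<in>I. psi (prime_factors f) m * psi (prime_factors g) m * \<phi> m\<bar> \<le> E f g"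
  shows "\<bar>\<Sum>m\<in>I. (sieve_poly R m)\<^sup>2 * \<phi> m\<bar> \<le> (\<Sum>f\<in>sqfree R. \<Sum>g\<in>sqfree R. E f g / (real f * real g))"
proof -
  have "(\<Sum>m\<in>I. (sieve_poly R m)\<^sup>2 * \<phi> m) =
    (\<Sum>m\<in>I. \<Sum>f\<in>sqfree R. \<Sum>g\<in>sqfree R. psi (prime_factors f) m * psi (prime_factors g) m * \<phi> m / (real f * real g))"
    unfolding sieve_poly_def power2_eq_square sum_product
    unfolding sum_distrib_right by (intro sum.cong refl) simp
  also have "\<dots> = (\<Sum>f\<in>sqfree R. \<Sum>m\<in>I. \<Sum>g\<in>sqfree R. psi (prime_factors f) m * psi (prime_factors g) m * \<phi> m / (real f * real g))"
    by (rule sum.swap)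
  also have "\<dots> = (\<Sum>f\<in>sqfree R. \<Sum>g\<in>sqfree R. (\<Sum>m\<in>I. psi (prime_factors f) m * psi (prime_factors g) m * \<phi> m) / (real f * real g))"
    by (intro sum.cong refl, subst sum.swap) (simp add: sum_divide_distrib)
  also have "\<bar>\<dots>\<bar> \<le> (\<Sum>f\<in>sqfree R. \<Sum>g\<in>sqfree R. E f g / (real f * real g))"
    by (intro order_trans[OF sum_abs] sum_mono)
       (use E in \<open>auto simp: abs_mult intro!: divide_right_mono\<close>)
  finally show ?thesis .
qed

lemma prime_factors_sqfree_props:
  assumes "f \<in> sqfree R"
  shows "finite (prime_factors f)" "\<And>p. p \<in> prime_factors f \<Longrightarrow> prime p"
    "\<And>p. p \<in> prime_factors f \<Longrightarrow> p dvd f" "\<bar>psi (prime_factors f) m\<bar> \<le> real f"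
  using abs_psi_le[of "prime_factors f" m] sqfree_D[OF assms] by (auto intro: Suc_leI prime_gt_0_nat)

text \<open>Orthogonality removes the off-diagonal main terms, so the main term is linear in
  \<open>sieve_mass R\<close>. After division by its square there remains
  \<open>L / sieve_mass R\<close>, which has the order of the number of primes.\<close>

lemma sieve_total_mass:
  assumes R: "R \<ge> 1"
  shows "(\<Sum>m\<in>{A..<A + int L}. (sieve_poly R m)\<^sup>2) \<le> real L * sieve_mass R + 2 * real R ^ 4"
proof -
  \<comment> \<open>On the diagonal the summands are nonnegative, so the interval may be enlarged to
    \<open>L div f + 1\<close> full periods. Off the diagonal complete periods contribute 0, and
    fewer than \<open>f * g\<close> terms of size at most \<open>f * g\<close> are left.\<close>
  define E where "E f g = (if f = g then (real L / f + 1) * real f ^ 2 else real f ^ 2 * real g ^ 2)" for f g :: nat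
  have "\<bar>\<Sum>m\<in>{A..<A + int L}. (sieve_poly R m)\<^sup>2 * 1\<bar> \<le> (\<Sum>f\<in>sqfree R. \<Sum>g\<in>sqfree R. E f g / (real f * real g))"
  proof (rule sieve_bilinear)
    fix f g assume f: "f \<in> sqfree R" and g: "g \<in> sqfree R"
    define F where "F m = psi (prime_factors f) m * psi (prime_factors g) m" for m
    have f0: "f > 0" "g > 0" using sqfree_D[OF f] sqfree_D[OF g] by auto
    have bF: "\<bar>F m\<bar> \<le> real f * real g" for m
      unfolding F_def abs_mult
      by (intro mult_mono prime_factors_sqfree_props(4)[OF f] prime_factors_sqfree_props(4)[OF g]) auto
    show "\<bar>\<Sum>m\<in>{A..<A + int L}. psi (prime_factors f) m * psi (prime_factors g) m * 1\<bar> \<le> E f g"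
    proof (cases "f = g")
      case True
      have per: "periodic F f" unfolding F_def using True prime_factors_sqfree_props[OF f]
        by (intro periodic_mult psi_periodic) auto
      have F2: "F m = (psi (prime_factors f) m)\<^sup>2" for m using True by (simp add: F_def power2_eq_square)
      have S: "(\<Sum>m\<in>{0..<int f}. F m) \<le> real f ^ 2"
        using sum_psi_square[OF prime_factors_sqfree_props(1,2)[OF f]] sqfree_D(3)[OF f] by (simp add: F2)
      have le: "L \<le> f * (L div f + 1)"
        using mult_div_mod_eq[of f L] mod_less_divisor[OF f0(1), of L]
        by (simp only: distrib_left mult_1_right)
      have "\<bar>\<Sum>m\<in>{A..<A + int L}. F m\<bar> = (\<Sum>m\<in>{A..<A + int L}. F m)"
        by (simp add: F2 sum_nonneg)
      also have "\<dots> \<le> (\<Sum>m\<in>{A..<A + int (f * (L div f + 1))}. F m)"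
        using le by (intro sum_mono2) (auto simp: F2 simp del: of_nat_mult)
      also have "\<dots> = real (L div f + 1) * (\<Sum>m\<in>{0..<int f}. F m)"
        by (rule sum_periodic_multiple[OF per f0(1)])
      also have "\<dots> \<le> (real L / f + 1) * real f ^ 2"
        using of_nat_div_le_of_nat[of L f] by (intro mult_mono S) (auto simp: F2 sum_nonneg)
      finally show ?thesis using True by (simp add: E_def F_def)
    next
      case False
      have per: "periodic F (f * g)" unfolding F_def
        using prime_factors_sqfree_props[OF f] prime_factors_sqfree_props[OF g]
        by (intro periodic_mult psi_periodic) (auto intro: dvd_mult dvd_mult2)
      have ne: "prime_factors f \<noteq> prime_factors g"
        using False sqfree_D(3)[OF f] sqfree_D(3)[OF g] by metis
      have "(\<Sum>m\<in>{0..<int (f * g)}. F m) = 0"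
        using sum_psi_orthogonal[OF prime_factors_sqfree_props(1,2)[OF f] prime_factors_sqfree_props(1,2)[OF g] ne]
          sqfree_D(3)[OF f] sqfree_D(3)[OF g] by (simp add: F_def)
      hence "\<bar>\<Sum>m\<in>{A..<A + int L}. F m\<bar> \<le> real (f * g) * (real f * real g)"
        using sum_periodic_interval[OF per _ bF, of A L] f0 by simp
      thus ?thesis using False by (simp add: E_def F_def power2_eq_square mult_ac)
    qed
  qed
  also have "\<dots> \<le> (\<Sum>f\<in>sqfree R. \<Sum>g\<in>sqfree R. (if g = f then real L / real f + 1 else 0) + real R ^ 2)"
  proof (intro sum_mono)
    fix f g assume f: "f \<in> sqfree R" and g: "g \<in> sqfree R"
    have f0: "f > 0" "g > 0" using sqfree_D[OF f] sqfree_D[OF g] by auto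
    have "real f * real g \<le> real R * real R"
      using sqfree_D[OF f] sqfree_D[OF g] by (intro mult_mono) auto
    thus "E f g / (real f * real g) \<le> (if g = f then real L / real f + 1 else 0) + real R ^ 2"
      using f0 by (auto simp: E_def power2_eq_square)
  qed
  also have "\<dots> = (\<Sum>f\<in>sqfree R. real L / real f + 1) + real (card (sqfree R)) ^ 2 * real R ^ 2"
    by (simp add: sum.distrib sum.delta power2_eq_square)
  also have "(\<Sum>f\<in>sqfree R. real L / real f + 1) = real L * sieve_mass R + real (card (sqfree R))"
    by (simp add: sum.distrib sieve_mass_def sum_distrib_left)
  also have "real L * sieve_mass R + real (card (sqfree R)) + real (card (sqfree R)) ^ 2 * real R ^ 2
     \<le> real L * sieve_mass R + real R ^ 4 + real R ^ 2 * real R ^ 2"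
  proof (intro add_mono[OF add_mono[OF order_refl]] mult_mono power_mono)
    have "real (card (sqfree R)) \<le> real R ^ 1" using card_sqfree_le[of R] by simp
    also have "\<dots> \<le> real R ^ 4" using R by (intro power_increasing) auto
    finally show "real (card (sqfree R)) \<le> real R ^ 4" .
  qed (use card_sqfree_le in auto)
  finally show ?thesis by (simp flip: power_add)
qed

text \<open>For each pair \<open>f\<close>, \<open>g\<close> the summand is periodic modulo
  \<open>D = 8 * \<bar>k\<bar> * \<bar>l\<bar> * f * g\<close> and has sum 0 over a period, by
  \<open>jac_character_witness\<close>. Only an incomplete period remains, and the weights
  \<open>1 / (f * g)\<close> cancel the size of the two \<open>psi\<close>.\<close>

lemma sieve_character_sum:
  assumes k: "k \<noteq> 0" "l \<noteq> 0" "\<nexists>s. nat \<bar>k * l\<bar> = s\<^sup>2"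
    and Z: "\<bar>k\<bar> \<le> int Z" "\<bar>l\<bar> \<le> int Z"
  shows "\<bar>\<Sum>m\<in>{A..<A + int L}. (sieve_poly R m)\<^sup>2 * (real_of_int (jac k m) * real_of_int (jac l m))\<bar>
     \<le> 8 * real Z ^ 2 * real R ^ 4"
proof -
  have "\<bar>\<Sum>m\<in>{A..<A + int L}. (sieve_poly R m)\<^sup>2 * (real_of_int (jac k m) * real_of_int (jac l m))\<bar>
     \<le> (\<Sum>f\<in>sqfree R. \<Sum>g\<in>sqfree R. (8 * real Z ^ 2 * real R ^ 2 * (real f * real g)) / (real f * real g))"
  proof (rule sieve_bilinear)
    fix f g assume f: "f \<in> sqfree R" and g: "g \<in> sqfree R"
    have f0: "f > 0" "g > 0" using sqfree_D[OF f] sqfree_D[OF g] by auto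
    define F where "F m = psi (prime_factors f) m * psi (prime_factors g) m *
       (real_of_int (jac k m) * real_of_int (jac l m))" for m
    define D where "D = 8 * nat \<bar>k\<bar> * nat \<bar>l\<bar> * (f * g)"
    have D: "D > 0" using k f0 by (simp add: D_def)
    have Di: "int D = 8 * \<bar>k\<bar> * \<bar>l\<bar> * int (f * g)" by (simp add: D_def)
    have per: "periodic F D"
      unfolding F_def
    proof (intro periodic_mult psi_periodic)
      show "p dvd D" if "p \<in> prime_factors f" for p
        using prime_factors_sqfree_props(3)[OF f that] by (simp add: D_def)
      show "p dvd D" if "p \<in> prime_factors g" for p
        using prime_factors_sqfree_props(3)[OF g that] by (simp add: D_def)
      have "8 * \<bar>k\<bar> dvd int D" "8 * \<bar>l\<bar> dvd int D" unfolding Di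
        by (metis dvd_mult2 dvd_triv_left, metis dvd_mult2 dvd_triv_left mult.assoc mult.commute)
      thus "periodic (\<lambda>m. real_of_int (jac k m)) D" "periodic (\<lambda>m. real_of_int (jac l m)) D"
        by (simp_all add: periodic_def jac_periodic)
    qed
    have bF: "\<bar>F m\<bar> \<le> real f * real g * (1 * 1)" for m
      unfolding F_def abs_mult
      by (intro mult_mono prime_factors_sqfree_props(4)[OF f] prime_factors_sqfree_props(4)[OF g])
         (use abs_jac_le_1 in \<open>auto simp flip: of_int_abs\<close>)
    obtain a where a: "coprime a (8 * \<bar>k\<bar> * \<bar>l\<bar> * int (f * g))" "jac k a * jac l a = -1"
      using jac_character_witness[OF k, of "f * g"] f0 by auto
    have cop: "coprime a (int D)" using a(1) by (simp only: Di)
    have "coprime a (int (f * g))" using a(1) by (simp only: coprime_mult_right_iff)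
    hence ps: "psi (prime_factors f) (a * m) = psi (prime_factors f) m"
         "psi (prime_factors g) (a * m) = psi (prime_factors g) m" for m
      using prime_factors_sqfree_props(3)[OF f] prime_factors_sqfree_props(3)[OF g]
      by (auto intro!: psi_coprime_mult[of a "f * g"])
    have "F (a * m) = - F m" for m
    proof -
      have "real_of_int (jac k (a * m)) * real_of_int (jac l (a * m)) =
          real_of_int (jac k a * jac l a) * (real_of_int (jac k m) * real_of_int (jac l m))"
        by (simp add: jac_mult_right)
      thus ?thesis unfolding F_def ps a(2) by simp
    qed
    hence "(\<Sum>m\<in>{0..<int D}. F m) = - (\<Sum>m\<in>{0..<int D}. F m)"
      using sum_periodic_coprime[OF per D cop] by (simp add: sum_negf)
    hence "(\<Sum>m\<in>{0..<int D}. F m) = 0" by simp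
    hence "\<bar>\<Sum>m\<in>{A..<A + int L}. F m\<bar> \<le> real D * (real f * real g * (1 * 1))"
      using sum_periodic_interval[OF per D bF, of A L] by simp
    also have "real D = 8 * (real (nat \<bar>k\<bar>) * real (nat \<bar>l\<bar>)) * (real f * real g)" by (simp add: D_def)
    also have "8 * (real (nat \<bar>k\<bar>) * real (nat \<bar>l\<bar>)) * (real f * real g) * (real f * real g * (1 * 1)) \<le>
       8 * (real Z * real Z) * (real R * real R) * (real f * real g * (1 * 1))"
      using Z sqfree_D[OF f] sqfree_D[OF g]
      by (intro mult_mono mult_right_mono) (auto simp: nat_le_iff)
    finally show "\<bar>\<Sum>m\<in>{A..<A + int L}. psi (prime_factors f) m * psi (prime_factors g) m *
       (real_of_int (jac k m) * real_of_int (jac l m))\<bar> \<le> 8 * real Z ^ 2 * real R ^ 2 * (real f * real g)"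
      by (simp add: F_def power2_eq_square mult_ac)
  qed
  also have "\<dots> \<le> (\<Sum>f\<in>sqfree R. \<Sum>g\<in>sqfree R. 8 * real Z ^ 2 * real R ^ 2)"
    using sqfree_D(1) by (intro sum_mono) auto
  also have "\<dots> = real (card (sqfree R)) ^ 2 * (8 * real Z ^ 2 * real R ^ 2)"
    by (simp add: power2_eq_square)
  also have "\<dots> \<le> real R ^ 2 * (8 * real Z ^ 2 * real R ^ 2)"
    using card_sqfree_le[of R] by (intro mult_right_mono power_mono) auto
  finally show ?thesis by (simp add: mult_ac flip: power_add)
qed

text \<open>The majorant is 1 at the primes in question and nonnegative elsewhere, so the sum over
  primes is at most a weighted sum over all integers of the interval. Opening the square there, a
  pair with square product is bounded trivially by the total mass, and every other pair by the small
  character sum.\<close>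

lemma quadratic_large_sieve:
  fixes \<beta> :: "'a \<Rightarrow> complex" and s :: "'a \<Rightarrow> int" and A L R Z :: nat
  assumes K: "finite K" and s: "\<And>\<kappa>. \<kappa> \<in> K \<Longrightarrow> s \<kappa> \<noteq> 0" "\<And>\<kappa>. \<kappa> \<in> K \<Longrightarrow> \<bar>s \<kappa>\<bar> \<le> int Z"
    and R: "R \<ge> 1" and P: "finite P" "\<And>q. q \<in> P \<Longrightarrow> prime q \<and> q > R \<and> q > 2 \<and> q \<in> {A..<A + L}"
  defines "sq \<equiv> {(\<kappa>, \<mu>). \<kappa> \<in> K \<and> \<mu> \<in> K \<and> (\<exists>t. nat \<bar>s \<kappa> * s \<mu>\<bar> = t\<^sup>2)}"
  shows "(\<Sum>q\<in>P. cmod (\<Sum>\<kappa>\<in>K. \<beta> \<kappa> * of_int (Legendre (s \<kappa>) (int q))) ^ 2) \<le>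
    (real L / sieve_mass R + 2 * real R ^ 4) * (\<Sum>(\<kappa>,\<mu>)\<in>sq. cmod (\<beta> \<kappa>) * cmod (\<beta> \<mu>))
     + 8 * real Z ^ 2 * real R ^ 4 * (\<Sum>\<kappa>\<in>K. cmod (\<beta> \<kappa>)) ^ 2"
proof -
  define G where "G = sieve_mass R"
  have G: "G \<ge> 1" using sieve_mass_ge_1[OF R] by (simp add: G_def)
  define I where "I = {int A..<int A + int L}"
  define f where "f m = (\<Sum>\<kappa>\<in>K. \<beta> \<kappa> * of_int (jac (s \<kappa>) m))" for m
  define T where "T \<kappa> \<mu> = (\<Sum>m\<in>I. (sieve_poly R m)\<^sup>2 * (real_of_int (jac (s \<kappa>) m) * real_of_int (jac (s \<mu>) m)))" for \<kappa> \<mu>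
  define W where "W = real L * G + 2 * real R ^ 4"
  define E where "E = 8 * real Z ^ 2 * real R ^ 4"
  have WE: "W \<ge> 0" "E \<ge> 0" using G by (auto simp: W_def E_def)
  have "(\<Sum>q\<in>P. cmod (\<Sum>\<kappa>\<in>K. \<beta> \<kappa> * of_int (Legendre (s \<kappa>) (int q))) ^ 2) =
    (\<Sum>q\<in>P. (sieve_poly R (int q) / G)\<^sup>2 * cmod (f (int q)) ^ 2)"
  proof (intro sum.cong refl)
    fix q assume q: "q \<in> P"
    have "(\<Sum>\<kappa>\<in>K. \<beta> \<kappa> * of_int (Legendre (s \<kappa>) (int q))) = f (int q)"
      unfolding f_def using P(2)[OF q] s(1) by (intro sum.cong) (auto simp: jac_eq_Legendre)
    moreover have "sieve_poly R (int q) / G = 1"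
      using sieve_poly_prime[of q R] P(2)[OF q] G by (simp add: G_def)
    ultimately show "cmod (\<Sum>\<kappa>\<in>K. \<beta> \<kappa> * of_int (Legendre (s \<kappa>) (int q))) ^ 2 =
      (sieve_poly R (int q) / G)\<^sup>2 * cmod (f (int q)) ^ 2" by simp
  qed
  also have "\<dots> = (\<Sum>m\<in>int ` P. (sieve_poly R m / G)\<^sup>2 * cmod (f m) ^ 2)"
    by (simp add: sum.reindex)
  also have "\<dots> \<le> (\<Sum>m\<in>I. (sieve_poly R m / G)\<^sup>2 * cmod (f m) ^ 2)"
    using P(1) by (intro sum_mono2) (use P(2) in \<open>force simp: I_def\<close>)+
  also have "\<dots> = (\<Sum>m\<in>I. (sieve_poly R m)\<^sup>2 * cmod (f m) ^ 2) / G\<^sup>2"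
    by (simp add: sum_divide_distrib power_divide)
  also have "(\<Sum>m\<in>I. (sieve_poly R m)\<^sup>2 * cmod (f m) ^ 2) = cmod (\<Sum>m\<in>I. of_real ((sieve_poly R m)\<^sup>2) * (f m * cnj (f m)))"
  proof -
    have "(\<Sum>m\<in>I. of_real ((sieve_poly R m)\<^sup>2) * (f m * cnj (f m))) =
       complex_of_real (\<Sum>m\<in>I. (sieve_poly R m)\<^sup>2 * cmod (f m) ^ 2)"
      by (simp add: complex_norm_square[symmetric])
    hence "cmod (\<Sum>m\<in>I. of_real ((sieve_poly R m)\<^sup>2) * (f m * cnj (f m))) = \<bar>\<Sum>m\<in>I. (sieve_poly R m)\<^sup>2 * cmod (f m) ^ 2\<bar>"
      by (simp only: norm_of_real)
    thus ?thesis by (simp add: sum_nonneg)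
  qed
  also have "(\<Sum>m\<in>I. of_real ((sieve_poly R m)\<^sup>2) * (f m * cnj (f m))) =
     (\<Sum>\<kappa>\<in>K. \<Sum>\<mu>\<in>K. \<beta> \<kappa> * cnj (\<beta> \<mu>) * of_real (T \<kappa> \<mu>))"
  proof -
    have "(\<Sum>m\<in>I. of_real ((sieve_poly R m)\<^sup>2) * (f m * cnj (f m))) =
      (\<Sum>m\<in>I. \<Sum>\<kappa>\<in>K. \<Sum>\<mu>\<in>K. \<beta> \<kappa> * cnj (\<beta> \<mu>) * of_real ((sieve_poly R m)\<^sup>2 * (real_of_int (jac (s \<kappa>) m) * real_of_int (jac (s \<mu>) m))))"
      by (intro sum.cong refl) (simp add: f_def sum_product sum_distrib_left mult_ac, subst sum.swap, simp add: mult_ac)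
    also have "\<dots> = (\<Sum>\<kappa>\<in>K. \<Sum>\<mu>\<in>K. \<Sum>m\<in>I. \<beta> \<kappa> * cnj (\<beta> \<mu>) * of_real ((sieve_poly R m)\<^sup>2 * (real_of_int (jac (s \<kappa>) m) * real_of_int (jac (s \<mu>) m))))"
      by (subst sum.swap, intro sum.cong refl, rule sum.swap)
    also have "\<dots> = (\<Sum>\<kappa>\<in>K. \<Sum>\<mu>\<in>K. \<beta> \<kappa> * cnj (\<beta> \<mu>) * of_real (T \<kappa> \<mu>))"
      by (simp only: T_def of_real_sum sum_distrib_left)
    finally show ?thesis .
  qed
  also have "cmod (\<Sum>\<kappa>\<in>K. \<Sum>\<mu>\<in>K. \<beta> \<kappa> * cnj (\<beta> \<mu>) * of_real (T \<kappa> \<mu>)) \<le>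
     (\<Sum>\<kappa>\<in>K. \<Sum>\<mu>\<in>K. (if (\<kappa>,\<mu>) \<in> sq then W * (cmod (\<beta> \<kappa>) * cmod (\<beta> \<mu>)) else 0) + E * (cmod (\<beta> \<kappa>) * cmod (\<beta> \<mu>)))"
  proof (intro order_trans[OF norm_sum] sum_mono)
    fix \<kappa> \<mu> assume \<kappa>: "\<kappa> \<in> K" and \<mu>: "\<mu> \<in> K"
    have "\<bar>T \<kappa> \<mu>\<bar> \<le> (if (\<kappa>,\<mu>) \<in> sq then W else 0) + E"
    proof (cases "(\<kappa>,\<mu>) \<in> sq")
      case True
      have "\<bar>T \<kappa> \<mu>\<bar> \<le> (\<Sum>m\<in>I. (sieve_poly R m)\<^sup>2)"
        unfolding T_def
      proof (intro order_trans[OF sum_abs] sum_mono)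
        fix m
        have "\<bar>real_of_int (jac (s \<kappa>) m)\<bar> * \<bar>real_of_int (jac (s \<mu>) m)\<bar> \<le> 1 * 1"
          using abs_jac_le_1 by (intro mult_mono) (auto simp flip: of_int_abs)
        hence "(sieve_poly R m)\<^sup>2 * (\<bar>real_of_int (jac (s \<kappa>) m)\<bar> * \<bar>real_of_int (jac (s \<mu>) m)\<bar>) \<le> (sieve_poly R m)\<^sup>2 * (1 * 1)"
          by (intro mult_left_mono) auto
        thus "\<bar>(sieve_poly R m)\<^sup>2 * (real_of_int (jac (s \<kappa>) m) * real_of_int (jac (s \<mu>) m))\<bar> \<le> (sieve_poly R m)\<^sup>2"
          by (simp add: abs_mult)
      qed
      also have "\<dots> \<le> W" using sieve_total_mass[OF R, of "int A" L] by (simp add: I_def W_def G_def)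
      finally show ?thesis using True WE by simp
    next
      case False
      hence ns: "\<nexists>t. nat \<bar>s \<kappa> * s \<mu>\<bar> = t\<^sup>2" using \<kappa> \<mu> by (auto simp: sq_def)
      show ?thesis
        using False sieve_character_sum[OF s(1)[OF \<kappa>] s(1)[OF \<mu>] ns s(2)[OF \<kappa>] s(2)[OF \<mu>], of R "int A" L]
        by (simp add: T_def E_def I_def)
    qed
    hence "cmod (\<beta> \<kappa>) * cmod (\<beta> \<mu>) * \<bar>T \<kappa> \<mu>\<bar> \<le> cmod (\<beta> \<kappa>) * cmod (\<beta> \<mu>) * ((if (\<kappa>,\<mu>) \<in> sq then W else 0) + E)"
      by (intro mult_left_mono) auto
    thus "cmod (\<beta> \<kappa> * cnj (\<beta> \<mu>) * of_real (T \<kappa> \<mu>)) \<le>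
       (if (\<kappa>,\<mu>) \<in> sq then W * (cmod (\<beta> \<kappa>) * cmod (\<beta> \<mu>)) else 0) + E * (cmod (\<beta> \<kappa>) * cmod (\<beta> \<mu>))"
      by (auto simp: norm_mult algebra_simps)
  qed
  also have "\<dots> = W * (\<Sum>(\<kappa>,\<mu>)\<in>sq. cmod (\<beta> \<kappa>) * cmod (\<beta> \<mu>)) + E * (\<Sum>\<kappa>\<in>K. cmod (\<beta> \<kappa>)) ^ 2"
  proof -
    have "(\<Sum>\<kappa>\<in>K. \<Sum>\<mu>\<in>K. if (\<kappa>,\<mu>) \<in> sq then W * (cmod (\<beta> \<kappa>) * cmod (\<beta> \<mu>)) else 0) =
      (\<Sum>z\<in>K\<times>K. if z \<in> sq then W * (cmod (\<beta> (fst z)) * cmod (\<beta> (snd z))) else 0)"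
      by (subst sum.cartesian_product) (intro sum.cong, auto)
    also have "\<dots> = (\<Sum>z\<in>sq. W * (cmod (\<beta> (fst z)) * cmod (\<beta> (snd z))))"
    proof -
      have "K \<times> K \<inter> sq = sq" by (auto simp: sq_def)
      thus ?thesis using K sum.inter_restrict[of "K\<times>K" "\<lambda>z. W * (cmod (\<beta> (fst z)) * cmod (\<beta> (snd z)))" sq] by simp
    qed
    finally show ?thesis
      by (simp add: sum.distrib sum_distrib_left power2_eq_square sum_product case_prod_unfold mult_ac)
  qed
  finally have "(\<Sum>q\<in>P. cmod (\<Sum>\<kappa>\<in>K. \<beta> \<kappa> * of_int (Legendre (s \<kappa>) (int q))) ^ 2) \<le>
    (W * (\<Sum>(\<kappa>,\<mu>)\<in>sq. cmod (\<beta> \<kappa>) * cmod (\<beta> \<mu>)) + E * (\<Sum>\<kappa>\<in>K. cmod (\<beta> \<kappa>)) ^ 2) / G\<^sup>2"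
    using G by (simp add: divide_right_mono)
  also have "\<dots> = W / G\<^sup>2 * (\<Sum>(\<kappa>,\<mu>)\<in>sq. cmod (\<beta> \<kappa>) * cmod (\<beta> \<mu>)) + E / G\<^sup>2 * (\<Sum>\<kappa>\<in>K. cmod (\<beta> \<kappa>)) ^ 2"
    by (simp add: add_divide_distrib)
  also have "\<dots> \<le> (real L / G + 2 * real R ^ 4) * (\<Sum>(\<kappa>,\<mu>)\<in>sq. cmod (\<beta> \<kappa>) * cmod (\<beta> \<mu>)) + E * (\<Sum>\<kappa>\<in>K. cmod (\<beta> \<kappa>)) ^ 2"
  proof (intro add_mono mult_right_mono)
    have G2: "G\<^sup>2 \<ge> 1" using G by (simp add: one_le_power)
    show "E / G\<^sup>2 \<le> E" using WE G2 by (simp add: divide_le_eq mult_left_mono[of 1 _ E, simplified])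
    have "W / G\<^sup>2 = real L / G + (2 * real R ^ 4) / G\<^sup>2"
      using G by (simp add: W_def add_divide_distrib power2_eq_square)
    also have "(2 * real R ^ 4) / G\<^sup>2 \<le> 2 * real R ^ 4"
      using G2 mult_left_mono[of 1 "G\<^sup>2" "2 * real R ^ 4"] by (simp add: divide_le_eq)
    finally show "W / G\<^sup>2 \<le> real L / G + 2 * real R ^ 4" by simp
  qed (auto intro: sum_nonneg)
  finally show ?thesis by (simp add: G_def E_def)
qed

text \<open>Writing \<open>k = f * s\<^sup>2\<close> with \<open>f\<close> squarefree bounds the
  harmonic sum by \<open>sieve_mass R\<close> times the sum of the inverse squares, which is at most
  2.\<close>

lemma sieve_mass_ge_ln:
  assumes "R \<ge> 1"
  shows "sieve_mass R \<ge> ln (real R + 1) / 2"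
proof -
  have sq: "(\<Sum>s=1..n. 1 / real s ^ 2) \<le> 2 - 1 / real n" if "n \<ge> 1" for n
    using that
  proof (induction n rule: nat_induct_at_least)
    case (Suc n)
    have "1 / real (Suc n) ^ 2 \<le> 1 / (real n * real (Suc n))"
      using Suc by (intro divide_left_mono) (auto simp: power2_eq_square intro: mult_right_mono)
    also have "\<dots> = 1 / real n - 1 / real (Suc n)" using Suc by (simp add: field_simps)
    finally show ?case using Suc by simp
  qed simp
  have har: "ln (real n + 1) \<le> (\<Sum>k=1..n. 1 / real k)" for n
  proof (induction n)
    case (Suc n)
    have "ln (real (Suc n) + 1) - ln (real n + 1) = ln (1 + 1 / (real n + 1))"
    proof -
      have "1 + 1 / (real n + 1) = (real (Suc n) + 1) / (real n + 1)" by (simp add: field_simps)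
      thus ?thesis by (simp add: ln_div)
    qed
    also have "\<dots> \<le> 1 / (real n + 1)" by (rule ln_add_one_self_le_self) simp
    finally show ?case using Suc by (simp add: add.commute)
  qed simp
  have "ln (real R + 1) \<le> (\<Sum>k=1..R. 1 / real k)" by (rule har)
  also have "\<dots> \<le> (\<Sum>(f,s)\<in>sqfree R \<times> {1..R}. 1 / (real f * real s ^ 2))"
  proof -
    define h where "h n = (squarefree_part n, square_part n)" for n :: nat
    have n: "n = squarefree_part n * square_part n ^ 2" for n :: nat
      by (rule squarefree_decompose)
    have inj: "inj_on h {1..R}" by (rule inj_onI) (metis h_def n prod.inject)
    have sub: "h ` {1..R} \<subseteq> sqfree R \<times> {1..R}"
    proof
      fix z assume "z \<in> h ` {1..R}"
      then obtain k where k: "k \<in> {1..R}" and z: "z = h k" by blast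
      define a b where ab: "a = squarefree_part k" "b = square_part k"
      have e: "k = a * b ^ 2" using n[of k] ab by simp
      hence "a > 0" "b > 0" using k by (auto intro!: Nat.gr0I)
      hence "a \<le> k" "b \<le> k" using e by (auto simp: power2_eq_square)
      moreover have "squarefree a" using k ab by (simp add: squarefree_squarefree_part)
      ultimately show "z \<in> sqfree R \<times> {1..R}"
        using k \<open>a > 0\<close> \<open>b > 0\<close> by (auto simp: sqfree_def z h_def ab)
    qed
    have "(\<Sum>k=1..R. 1 / real k) = (\<Sum>k=1..R. (case h k of (f,s) \<Rightarrow> 1 / (real f * real s ^ 2)))"
      by (intro sum.cong refl) (metis (mono_tags, lifting) case_prod_conv h_def n of_nat_mult of_nat_power)
    also have "\<dots> = (\<Sum>(f,s)\<in>h ` {1..R}. 1 / (real f * real s ^ 2))" by (subst sum.reindex[OF inj]) (simp add: comp_def)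
    also have "\<dots> \<le> (\<Sum>(f,s)\<in>sqfree R \<times> {1..R}. 1 / (real f * real s ^ 2))"
      by (intro sum_mono2 sub) auto
    finally show ?thesis .
  qed
  also have "\<dots> = sieve_mass R * (\<Sum>s=1..R. 1 / real s ^ 2)"
    by (simp add: sieve_mass_def sum_product sum.cartesian_product)
  also have "\<dots> \<le> sieve_mass R * 2"
    using sq[OF assms] sieve_mass_ge_1[OF assms] by (intro mult_left_mono) (auto intro: order_trans)
  finally show ?thesis by simp
qed

section \<open>Primes in dyadic intervals\<close>

lemma multiplicity_eq_card_powers:
  assumes "prime p" "0 < n" "n \<le> (K::nat)"
  shows "multiplicity p n = card {k\<in>{1..K}. p ^ k dvd n}"
proof -
  have le: "multiplicity p n \<le> K"
  proof -
    have "p ^ multiplicity p n \<le> n" using assms by (intro dvd_imp_le multiplicity_dvd) auto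
    moreover have "multiplicity p n < p ^ multiplicity p n"
      using assms(1) by (intro power_gt_expt) (auto dest: prime_gt_1_nat)
    ultimately show ?thesis using assms by linarith
  qed
  have dvd: "p ^ k dvd n \<longleftrightarrow> k \<le> multiplicity p n" for k
    using assms by (intro power_dvd_iff_le_multiplicity) auto
  have "{k\<in>{1..K}. p ^ k dvd n} = {1..multiplicity p n}"
    unfolding dvd using le by auto
  thus ?thesis by simp
qed

text \<open>Legendre's formula; the summands with \<open>p ^ k > n\<close> vanish, so any
  \<open>K \<ge> n\<close> may serve as the upper limit.\<close>

lemma multiplicity_fact:
  assumes p: "prime p" and "n \<le> (K::nat)"
  shows "multiplicity p (fact n :: nat) = (\<Sum>k=1..K. n div p ^ k)"
  using assms(2)
proof (induction n)
  case (Suc n)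
  have "multiplicity p (fact (Suc n) :: nat) = multiplicity p (Suc n) + multiplicity p (fact n :: nat)"
    unfolding fact_Suc using p by (subst prime_elem_multiplicity_mult_distrib) auto
  also have "multiplicity p (Suc n) = (\<Sum>k=1..K. if p ^ k dvd Suc n then 1 else 0)"
    using multiplicity_eq_card_powers[OF p, of "Suc n" K] Suc by (simp add: sum.If_cases Int_def)
  also have "\<dots> + multiplicity p (fact n :: nat) = (\<Sum>k=1..K. (if p ^ k dvd Suc n then 1 else 0) + n div p ^ k)"
    using Suc by (simp add: sum.distrib)
  also have "\<dots> = (\<Sum>k=1..K. Suc n div p ^ k)"
    by (intro sum.cong refl) (auto simp: div_Suc dvd_eq_mod_eq_0)
  finally show ?case .
qed simp

lemma div_double_bounds:
  assumes "m > (0::nat)"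
  shows "2 * (n div m) \<le> (2*n) div m" "(2*n) div m \<le> 2 * (n div m) + 1"
proof -
  have n: "n = m * (n div m) + n mod m" by simp
  have lt: "n mod m < m" using assms by simp
  have "2 * (n div m) * m \<le> 2 * n" using n by (metis div_times_less_eq_dividend mult.assoc mult_le_mono2)
  thus "2 * (n div m) \<le> (2*n) div m" using assms by (simp add: less_eq_div_iff_mult_less_eq)
  have "2 * n < (2 * (n div m) + 2) * m"
  proof -
    have "2 * n = 2 * (m * (n div m)) + 2 * (n mod m)" using n by linarith
    moreover have "(2 * (n div m) + 2) * m = 2 * (m * (n div m)) + 2 * m" by (simp add: algebra_simps)
    ultimately show ?thesis using lt by linarith
  qed
  hence "(2*n) div m < 2 * (n div m) + 2" using assms by (simp add: div_less_iff_less_mult)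
  thus "(2*n) div m \<le> 2 * (n div m) + 1" by simp
qed

lemma multiplicity_central_binomial:
  assumes p: "prime p"
  shows "multiplicity p ((2*n) choose n) = (\<Sum>k=1..2*n. (2*n) div p ^ k - 2 * (n div p ^ k))"
proof -
  have "fact n * fact (2*n - n) * ((2*n) choose n) = (fact (2*n) :: nat)"
    by (rule binomial_fact_lemma) simp
  hence "multiplicity p (fact (2*n) :: nat) = multiplicity p (fact n * fact n * ((2*n) choose n))" by simp
  also have "\<dots> = 2 * multiplicity p (fact n :: nat) + multiplicity p ((2*n) choose n)"
    using p by (simp add: prime_elem_multiplicity_mult_distrib)
  finally have "(\<Sum>k=1..2*n. (2*n) div p ^ k) = (\<Sum>k=1..2*n. 2 * (n div p ^ k)) + multiplicity p ((2*n) choose n)"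
    by (simp add: multiplicity_fact[OF p, where K = "2*n"] sum_distrib_left)
  moreover have "(\<Sum>k=1..2*n. (2*n) div p ^ k) = (\<Sum>k=1..2*n. 2 * (n div p ^ k) + ((2*n) div p ^ k - 2 * (n div p ^ k)))"
    using p by (intro sum.cong refl) (simp add: div_double_bounds(1) prime_gt_0_nat)
  ultimately show ?thesis by (simp add: sum.distrib)
qed

text \<open>In the formula for the multiplicity each summand is 0 or 1, and it is 0 unless
  \<open>p ^ k \<le> 2 * n\<close>. Hence the multiplicity is at most the largest such
  \<open>k\<close>.\<close>

lemma central_binomial_prime_power_le:
  assumes p: "prime p" and n: "n \<ge> 1"
  shows "p ^ multiplicity p ((2*n) choose n) \<le> 2 * n"
proof -
  define S where "S = {k\<in>{1..2*n}. p ^ k \<le> 2 * n}"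
  have p1: "p > 1" using p prime_gt_1_nat by blast
  have "multiplicity p ((2*n) choose n) \<le> (\<Sum>k=1..2*n. if k \<in> S then 1 else 0)"
    unfolding multiplicity_central_binomial[OF p]
  proof (rule sum_mono)
    fix k assume k: "k \<in> {1..2*n}"
    have "(2*n) div p ^ k \<le> 2 * (n div p ^ k) + 1" using p1 by (intro div_double_bounds) auto
    moreover have "(2*n) div p ^ k = 0" if "k \<notin> S" using that k by (simp add: S_def)
    ultimately show "(2*n) div p ^ k - 2 * (n div p ^ k) \<le> (if k \<in> S then 1 else 0)" by auto
  qed
  also have "\<dots> = card S" by (simp add: S_def sum.If_cases Int_def)
  finally have le: "multiplicity p ((2*n) choose n) \<le> card S" .
  show ?thesis
  proof (cases "S = {}")
    case True
    thus ?thesis using le n by simp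
  next
    case False
    have fin: "finite S" by (simp add: S_def)
    have M: "Max S \<in> S" using fin False by simp
    have "S \<subseteq> {1..Max S}" using fin by (auto simp: S_def)
    hence "card S \<le> Max S" using card_mono[of "{1..Max S}" S] by simp
    hence "p ^ multiplicity p ((2*n) choose n) \<le> p ^ Max S" using le p1 by (intro power_increasing) auto
    also have "\<dots> \<le> 2 * n" using M by (simp add: S_def)
    finally show ?thesis .
  qed
qed

lemma central_binomial_multiplicity_le_1:
  assumes p: "prime p" and "p\<^sup>2 > 2 * n"
  shows "multiplicity p ((2*n) choose n) \<le> (2*n) div p - 2 * (n div p)"
proof -
  have p1: "p > 1" using p prime_gt_1_nat by blast
  have z: "(2*n) div p ^ k = 0" if "k \<ge> 2" for k
  proof -
    have "p\<^sup>2 \<le> p ^ k" using p1 that by (intro power_increasing) auto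
    thus ?thesis using assms by simp
  qed
  have "(\<Sum>k=1..2*n. (2*n) div p ^ k - 2 * (n div p ^ k)) \<le> (\<Sum>k\<in>{1}. (2*n) div p ^ k - 2 * (n div p ^ k))"
  proof (cases "n = 0")
    case False
    show ?thesis by (rule eq_refl, rule sum.mono_neutral_right) (use False z in auto)
  qed simp
  thus ?thesis using multiplicity_central_binomial[OF p, of n] by simp
qed

lemma prod_subset_le_nat:
  fixes f :: "'a \<Rightarrow> nat"
  assumes "finite B" "A \<subseteq> B" "\<And>b. b \<in> B \<Longrightarrow> f b \<ge> 1"
  shows "prod f A \<le> prod f B"
proof (rule dvd_imp_le)
  show "prod f A dvd prod f B" using assms by (intro prod_dvd_prod_subset)
  show "0 < prod f B" using assms(3) by (intro prod_pos) (auto simp: Suc_le_eq)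
qed

lemma prod_primes_dvd:
  assumes "finite T" "\<And>p. p \<in> T \<Longrightarrow> prime p \<and> p dvd (B::nat)"
  shows "\<Prod>T dvd B"
  using assms
proof (induction T rule: finite_induct)
  case (insert p T)
  have "coprime p (\<Prod>T)"
    using insert by (intro prod_coprime_right primes_coprime) auto
  thus ?case using insert by (simp add: divides_mult)
qed simp

text \<open>Erdos's induction: for \<open>n = 2 * m + 1\<close> the primes in the interval from
  \<open>m + 2\<close> to \<open>n\<close> all divide \<open>n choose m\<close>, which occurs twice
  in a row of sum \<open>2 ^ n\<close> and is therefore at most \<open>4 ^ m\<close>.\<close>

lemma primorial_le: "(\<Prod>p | prime p \<and> p \<le> n. p) \<le> (4::nat) ^ n"
proof (induction n rule: less_induct)
  case (less n)
  have fin: "finite {p::nat. prime p \<and> p \<le> m}" for m by simp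
  consider "n \<le> 2" | "n > 2" "even n" | "n > 2" "odd n" by linarith
  thus ?case
  proof cases
    case 1
    have two: "p = 2 \<and> n = 2" if "prime p" "p \<le> n" for p
      using 1 prime_ge_2_nat[OF that(1)] that(2) by linarith
    show ?thesis
    proof (cases "n = 2")
      case True
      have "{p::nat. prime p \<and> p \<le> n} = {2}"
      proof (intro equalityI subsetI)
        fix p assume "p \<in> {p::nat. prime p \<and> p \<le> n}"
        thus "p \<in> {2}" using two[of p] by blast
      qed (use True in simp)
      note e = this
      show ?thesis unfolding e using True by simp
    next
      case False
      hence e: "{p::nat. prime p \<and> p \<le> n} = {}" using two by blast
      show ?thesis unfolding e by simp
    qed
  next
    case 2
    have "\<not> prime n" using 2 prime_odd_nat by auto
    have e: "{p::nat. prime p \<and> p \<le> n} = {p. prime p \<and> p \<le> n - 1}"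
    proof (rule Collect_cong)
      fix p show "(prime p \<and> p \<le> n) = (prime p \<and> p \<le> n - 1)"
        using \<open>\<not> prime n\<close> 2 by (cases "p = n") auto
    qed
    have "(\<Prod>p | prime p \<and> p \<le> n - 1. p) \<le> (4::nat) ^ (n - 1)" using 2 by (intro less) auto
    moreover have "(4::nat) ^ (n - 1) \<le> 4 ^ n" by (intro power_increasing) auto
    ultimately show ?thesis unfolding e by linarith
  next
    case 3
    then obtain m where n: "n = 2 * m + 1" by (auto elim: oddE)
    have m: "m \<ge> 1" using 3 n by simp
    define T where "T = {p::nat. prime p \<and> m + 1 < p \<and> p \<le> n}"
    define B where "B = n choose m"
    have "{p::nat. prime p \<and> p \<le> n} = {p. prime p \<and> p \<le> m + 1} \<union> T"
      using n m by (auto simp: T_def)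
    moreover have "finite T" "{p. prime p \<and> p \<le> m + 1} \<inter> T = {}" by (auto simp: T_def)
    ultimately have eq: "(\<Prod>p | prime p \<and> p \<le> n. p) = (\<Prod>p | prime p \<and> p \<le> m + 1. p) * \<Prod>T"
      using fin[of "m+1"] by (simp only: prod.union_disjoint)
    have "\<Prod>T dvd B"
    proof (rule prod_primes_dvd)
      fix p assume p: "p \<in> T"
      hence pr: "prime p" by (simp add: T_def)
      have "fact m * fact (n - m) * B = (fact n :: nat)"
        unfolding B_def by (rule binomial_fact_lemma) (use n in simp)
      moreover have "p dvd (fact n :: nat)" using p pr by (simp add: prime_dvd_fact_iff T_def)
      ultimately have "p dvd fact m * fact (n - m) * B" by simp
      moreover have "\<not> p dvd (fact m :: nat)" "\<not> p dvd (fact (n - m) :: nat)"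
        using p n prime_dvd_fact_iff[OF pr, of m] prime_dvd_fact_iff[OF pr, of "n - m"] by (auto simp: T_def)
      ultimately show "prime p \<and> p dvd B" using pr by (simp add: prime_dvd_mult_iff)
    qed (simp add: T_def)
    moreover have "B > 0" using n by (simp add: B_def)
    ultimately have "\<Prod>T \<le> B" by (rule dvd_imp_le)
    moreover have "B \<le> 4 ^ m"
    proof -
      have "n choose (m + 1) = B" using binomial_symmetric[of m n] n by (simp add: B_def)
      hence "2 * B = (\<Sum>k\<in>{m, m+1}. n choose k)" by (simp add: B_def)
      also have "\<dots> \<le> (\<Sum>k\<le>n. n choose k)" by (intro sum_mono2) (auto simp: n)
      also have "\<dots> = 2 ^ n" by (rule choose_row_sum)
      also have "\<dots> = 2 * 4 ^ m" by (simp add: n power_mult)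
      finally show ?thesis by simp
    qed
    moreover have "(\<Prod>p | prime p \<and> p \<le> m + 1. p) \<le> (4::nat) ^ (m + 1)" using m n by (intro less) auto
    ultimately have "(\<Prod>p | prime p \<and> p \<le> n. p) \<le> 4 ^ (m + 1) * 4 ^ m"
      unfolding eq by (intro mult_mono) auto
    also have "\<dots> = 4 ^ n" by (simp add: n flip: power_add)
    finally show ?thesis .
  qed
qed

lemma finite_primes_dyadic [simp]: "finite (primes_dyadic n)"
  by (rule finite_subset[of _ "{..2*n}"]) (auto simp: primes_dyadic_def)

text \<open>Erdos's factorisation from the proof of Bertrand's postulate. Every prime power in the
  coefficient is at most \<open>2 * n\<close>; a prime above \<open>sqrt (2 * n)\<close> occurs at
  most once; a prime \<open>p\<close> with \<open>2 * n < 3 * p\<close> and \<open>p \<le> n\<close>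
  does not occur at all. The three factors come from the ranges \<open>S1\<close>,
  \<open>S2\<close>, \<open>S3\<close>.\<close>

lemma central_binomial_le:
  assumes n: "n \<ge> 3"
  shows "((2*n) choose n) \<le> (2*n) ^ (nat \<lfloor>sqrt (2*n)\<rfloor>) * 4 ^ ((2*n) div 3) * (2*n) ^ card (primes_dyadic n)"
proof -
  define B where "B = (2*n) choose n"
  define s where "s = nat \<lfloor>sqrt (2*n)\<rfloor>"
  define f where "f p = p ^ multiplicity p B" for p
  define S1 where "S1 = {p. prime p \<and> p \<le> s}"
  define S2 where "S2 = {p. prime p \<and> s < p \<and> p \<le> (2*n) div 3}"
  define S3 where "S3 = {p. prime p \<and> n < p \<and> p \<le> 2 * n}"
  have fin: "finite S1" "finite S2" "finite S3" by (auto simp: S1_def S2_def S3_def)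
  have B0: "B > 0" by (simp add: B_def)
  have big: "p\<^sup>2 > 2 * n" if "p > s" for p
  proof -
    have "sqrt (2*n) < real p" using that unfolding s_def by linarith
    hence "sqrt (2*n) ^ 2 < real p ^ 2" by (intro power_strict_mono) auto
    hence "real (2*n) < real (p\<^sup>2)" by simp
    thus ?thesis by (simp only: of_nat_less_iff)
  qed
  have f1: "f p = 1 \<or> p \<in> S1 \<union> S2 \<union> S3" if p: "p \<in> prime_factors B" for p
  proof (rule ccontr)
    assume ne: "\<not> (f p = 1 \<or> p \<in> S1 \<union> S2 \<union> S3)"
    have pr: "prime p" using p by auto
    have "p \<le> f p" using p pr B0 unfolding f_def
      by (intro self_le_power) (auto simp: prime_factors_multiplicity prime_gt_0_nat Suc_leI)
    hence "p \<le> 2 * n" using central_binomial_prime_power_le[OF pr, of n] n by (simp add: f_def B_def)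
    hence *: "p > s" "p > (2*n) div 3" "p \<le> n" using ne pr by (auto simp: S1_def S2_def S3_def)
    have "multiplicity p B \<le> (2*n) div p - 2 * (n div p)"
      unfolding B_def by (rule central_binomial_multiplicity_le_1[OF pr big[OF *(1)]])
    \<comment> \<open>Together with \<open>n div p \<ge> 1\<close> this makes the difference at most
      \<open>2 - 2 * 1 = 0\<close>.\<close>
    moreover have "(2*n) div p < 3" using * pr by (simp add: div_less_iff_less_mult prime_gt_0_nat)
    moreover have "n div p \<ge> 1" using * pr by (simp add: less_eq_div_iff_mult_less_eq prime_gt_0_nat)
    ultimately have "multiplicity p B = 0" by linarith
    thus False using ne by (simp add: f_def)
  qed
  have f2: "f p \<le> 2 * n" if "prime p" for p
    using central_binomial_prime_power_le[OF that, of n] n by (simp add: f_def B_def)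
  have f3: "f p \<le> p" if "prime p" "p > s" for p
  proof -
    have "multiplicity p B \<le> (2*n) div p - 2 * (n div p)"
      unfolding B_def by (rule central_binomial_multiplicity_le_1[OF that(1) big[OF that(2)]])
    moreover have "(2*n) div p \<le> 2 * (n div p) + 1" using that by (intro div_double_bounds) (auto simp: prime_gt_0_nat)
    ultimately have "multiplicity p B \<le> 1" by linarith
    hence "f p \<le> p ^ 1" unfolding f_def using that by (intro power_increasing) (auto simp: prime_gt_0_nat Suc_leI)
    thus ?thesis by simp
  qed
  have fge: "f p \<ge> 1" if "prime p" for p using that by (simp add: f_def Suc_le_eq prime_gt_0_nat)
  have "B = (\<Prod>p\<in>prime_factors B. f p)" using prime_factorization_nat[OF B0] by (simp add: f_def)
  also have "\<dots> = (\<Prod>p\<in>prime_factors B \<inter> (S1 \<union> S2 \<union> S3). f p)"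
    by (rule prod.mono_neutral_right) (use f1 in auto)
  also have "\<dots> \<le> (\<Prod>p\<in>S1 \<union> S2 \<union> S3. f p)"
    by (rule prod_subset_le_nat) (use fin fge in \<open>auto simp: S1_def S2_def S3_def\<close>)
  also have "\<dots> = (\<Prod>p\<in>S1. f p) * (\<Prod>p\<in>S2. f p) * (\<Prod>p\<in>S3. f p)"
  proof -
    have "S1 \<inter> S2 = {}" "(S1 \<union> S2) \<inter> S3 = {}"
    proof -
      show "S1 \<inter> S2 = {}" by (auto simp: S1_def S2_def)
      have "sqrt (2*n) \<le> n"
      proof (rule real_le_lsqrt)
        have "2 * n \<le> n * n" using n by (intro mult_right_mono) auto
        thus "real (2 * n) \<le> (real n)\<^sup>2" by (simp add: power2_eq_square flip: of_nat_mult)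
      qed auto
      hence "s \<le> n" unfolding s_def by linarith
      thus "(S1 \<union> S2) \<inter> S3 = {}" by (auto simp: S1_def S2_def S3_def)
    qed
    thus ?thesis using fin by (simp add: prod.union_disjoint)
  qed
  also have "\<dots> \<le> (2*n) ^ s * 4 ^ ((2*n) div 3) * (2*n) ^ card (primes_dyadic n)"
  proof (intro mult_mono)
    have "(\<Prod>p\<in>S1. f p) \<le> (\<Prod>p\<in>S1. 2 * n)" using f2 by (intro prod_mono) (auto simp: S1_def)
    also have "\<dots> = (2*n) ^ card S1" by simp
    also have "\<dots> \<le> (2*n) ^ s"
    proof (rule power_increasing)
      have "S1 \<subseteq> {1..s}" by (auto simp: S1_def prime_gt_0_nat Suc_leI)
      thus "card S1 \<le> s" using card_mono[of "{1..s}" S1] by simp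
    qed (use n in simp)
    finally show "(\<Prod>p\<in>S1. f p) \<le> (2*n) ^ s" .
    have "(\<Prod>p\<in>S2. f p) \<le> (\<Prod>p\<in>S2. p)" using f3 by (intro prod_mono) (auto simp: S2_def)
    also have "\<dots> \<le> (\<Prod>p | prime p \<and> p \<le> (2*n) div 3. p)"
      by (rule prod_subset_le_nat) (auto simp: S2_def prime_gt_0_nat Suc_leI)
    also have "\<dots> \<le> 4 ^ ((2*n) div 3)" by (rule primorial_le)
    finally show "(\<Prod>p\<in>S2. f p) \<le> 4 ^ ((2*n) div 3)" .
    have "(\<Prod>p\<in>S3. f p) \<le> (\<Prod>p\<in>S3. 2 * n)" using f2 by (intro prod_mono) (auto simp: S3_def)
    also have "\<dots> = (2*n) ^ card S3" by simp
    also have "\<dots> \<le> (2*n) ^ card (primes_dyadic n)"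
      by (intro power_increasing card_mono) (use n in \<open>auto simp: S3_def primes_dyadic_def\<close>)
    finally show "(\<Prod>p\<in>S3. f p) \<le> (2*n) ^ card (primes_dyadic n)" .
  qed auto
  finally show ?thesis by (simp add: B_def s_def)
qed

text \<open>Of the logarithm \<open>n * ln 4\<close> of the central binomial coefficient, the primes
  up to \<open>2 * n / 3\<close> account for about two thirds at most, so at least
  \<open>n / 3\<close> comes from primes in the dyadic block, each contributing at most
  \<open>ln (2 * n)\<close>. Replacing 1/3 by 1/4 absorbs the lower-order terms.\<close>

theorem card_primes_dyadic_ge:
  "\<exists>Q0. \<forall>Q\<ge>Q0. real (card (primes_dyadic Q)) \<ge> real Q / (4 * ln (real Q))"
proof -
  have bound: "real (card (primes_dyadic n)) \<ge> (real n / 3) / ln (2 * real n) - sqrt (2 * real n) - 1"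
    if n: "n \<ge> 3" for n
  proof -
    define p where "p = card (primes_dyadic n)"
    define l where "l = ln (2 * real n)"
    have l: "l > 0" using n by (simp add: l_def)
    have "4 ^ n / (2 * real n) \<le> real ((2*n) choose n)"
      using n by (intro central_binomial_lower_bound) auto
    also have "\<dots> \<le> real ((2*n) ^ (nat \<lfloor>sqrt (2*n)\<rfloor>) * 4 ^ ((2*n) div 3) * (2*n) ^ p)"
      using central_binomial_le[OF n] unfolding p_def by (simp only: of_nat_le_iff)
    finally have "ln (4 ^ n / (2 * real n)) \<le> ln (real ((2*n) ^ (nat \<lfloor>sqrt (2*n)\<rfloor>) * 4 ^ ((2*n) div 3) * (2*n) ^ p))"
      using n by (subst ln_le_cancel_iff) auto
    also have "\<dots> = real (nat \<lfloor>sqrt (2*n)\<rfloor>) * l + real ((2*n) div 3) * ln 4 + p * l"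
      using n by (simp add: ln_mult ln_realpow l_def algebra_simps)
    also have "real (nat \<lfloor>sqrt (2*n)\<rfloor>) * l \<le> sqrt (2 * real n) * l"
      using l by (intro mult_right_mono) auto
    also have "real ((2*n) div 3) * ln 4 \<le> (2 * real n / 3) * ln 4"
      using of_nat_div_le_of_nat[of "2*n" 3, where 'a=real] by (intro mult_right_mono) auto
    finally have "ln (4 ^ n / (2 * real n)) \<le> sqrt (2 * real n) * l + (2 * real n / 3) * ln 4 + p * l" by simp
    moreover have "ln (4 ^ n / (2 * real n)) = n * ln 4 - l" using n by (simp add: ln_div ln_realpow l_def)
    ultimately have "(real n / 3) * ln 4 \<le> (sqrt (2 * real n) + 1 + p) * l" by (simp add: algebra_simps)
    moreover have "ln (4::real) \<ge> 1"
    proof -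
      have "exp (1::real) \<le> 4" using exp_le by simp
      thus ?thesis using ln_ge_iff[of 4 1] by simp
    qed
    hence "real n / 3 * 1 \<le> (real n / 3) * ln 4" by (intro mult_left_mono) auto
    ultimately have "real n / 3 \<le> (sqrt (2 * real n) + 1 + p) * l" by simp
    hence "real n / 3 / l \<le> sqrt (2 * real n) + 1 + p" using l by (simp add: pos_divide_le_eq)
    thus ?thesis by (simp add: l_def p_def)
  qed
  have "eventually (\<lambda>x::real. (x / 3) / ln (2 * x) - sqrt (2 * x) - 1 \<ge> x / (4 * ln x)) at_top"
    by real_asymp
  hence "eventually (\<lambda>n. (real n / 3) / ln (2 * real n) - sqrt (2 * real n) - 1 \<ge> real n / (4 * ln (real n))) sequentially"
    using filterlim_real_sequentially by (rule eventually_compose_filterlim)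
  then obtain N where N: "\<And>n. n \<ge> N \<Longrightarrow> (real n / 3) / ln (2 * real n) - sqrt (2 * real n) - 1 \<ge> real n / (4 * ln (real n))"
    by (auto simp: eventually_sequentially)
  show ?thesis
  proof (intro exI[of _ "max N 3"] allI impI)
    fix Q :: nat assume Q: "Q \<ge> max N 3"
    show "real (card (primes_dyadic Q)) \<ge> real Q / (4 * ln (real Q))"
      using N[of Q] bound[of Q] Q by simp
  qed
qed

section \<open>The large sieve measured against the number of primes\<close>

definition square_pairs :: "'a set \<Rightarrow> ('a \<Rightarrow> int) \<Rightarrow> ('a \<times> 'a) set" where
  "square_pairs K s = {(\<kappa>, \<mu>). \<kappa> \<in> K \<and> \<mu> \<in> K \<and> (\<exists>t. nat \<bar>s \<kappa> * s \<mu>\<bar> = t\<^sup>2)}"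

text \<open>With \<open>R\<close> a power of \<open>Q\<close>, \<open>sieve_mass R\<close> is of
  order \<open>ln Q\<close>; the lower bound for the number of primes then turns the main term into
  a multiple of \<open>card (primes_dyadic Q)\<close>. This makes later bounds on exceptional primes
  relative to the primes rather than to the integers.\<close>

theorem dyadic_large_sieve:
  obtains C :: real and Q0 :: nat where "C > 0"
    "\<And>Q K (\<beta> :: 'a \<Rightarrow> complex) s Z. Q \<ge> Q0 \<Longrightarrow> finite K \<Longrightarrow>
      (\<And>\<kappa>. \<kappa> \<in> K \<Longrightarrow> s \<kappa> \<noteq> 0 \<and> \<bar>s \<kappa>\<bar> \<le> int Z) \<Longrightarrow>
      (\<Sum>q\<in>primes_dyadic Q. cmod (\<Sum>\<kappa>\<in>K. \<beta> \<kappa> * of_int (Legendre (s \<kappa>) (int q))) ^ 2) \<le>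
      C * real (card (primes_dyadic Q)) * (\<Sum>(\<kappa>,\<mu>)\<in>square_pairs K s. cmod (\<beta> \<kappa>) * cmod (\<beta> \<mu>))
      + C * sqrt (real Q) * real Z ^ 2 * (\<Sum>\<kappa>\<in>K. cmod (\<beta> \<kappa>)) ^ 2"
proof -
  obtain Q0 where Q0: "\<And>Q. Q \<ge> Q0 \<Longrightarrow> real (card (primes_dyadic Q)) \<ge> real Q / (4 * ln (real Q))"
    using card_primes_dyadic_ge by blast
  show ?thesis
  \<comment> \<open>The bounds \<open>b1\<close>, \<open>b2\<close>, \<open>b3\<close> give
    \<open>32 * 4 + 2 * 2 * 4 = 144\<close> for the main term, and the error term has the constant
    8.\<close>
  proof (rule that[of "200::real" "max Q0 3"])
    fix Q :: nat and K :: "'a set" and \<beta> :: "'a \<Rightarrow> complex" and s :: "'a \<Rightarrow> int" and Z :: nat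
    assume Q: "Q \<ge> max Q0 3" and K: "finite K" and s: "\<And>\<kappa>. \<kappa> \<in> K \<Longrightarrow> s \<kappa> \<noteq> 0 \<and> \<bar>s \<kappa>\<bar> \<le> int Z"
    \<comment> \<open>The exponent 1/8 makes \<open>R ^ 4\<close> at most
      \<open>sqrt Q\<close>.\<close>
    define R where "R = nat \<lfloor>real Q powr (1/8)\<rfloor>"
    define P where "P = real (card (primes_dyadic Q))"
    have Q3: "real Q \<ge> 3" using Q by linarith
    have powr1: "real Q powr (1/8) \<ge> 1" using Q3 by (intro ge_one_powr_ge_zero) auto
    have R1: "R \<ge> 1" using powr1 by (simp add: R_def le_nat_floor)
    have Rle: "real R \<le> real Q powr (1/8)" unfolding R_def by simp
    have "real Q powr (1/8) < real Q powr 1" using Q3 by (intro powr_less_mono) auto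
    hence RQ: "R < Q" using Rle Q3 by simp
    have "real R ^ 4 \<le> (real Q powr (1/8)) ^ 4" using Rle by (intro power_mono) auto
    also have "\<dots> = real Q powr (1/2)" using Q3 by (simp add: powr_realpow[symmetric] powr_powr)
    finally have R4: "real R ^ 4 \<le> sqrt (real Q)" using Q3 by (simp add: powr_half_sqrt)
    have lnQ: "ln (real Q) > 0" using Q3 by simp
    have "real Q powr (1/8) \<le> real R + 1" unfolding R_def by linarith
    hence "ln (real Q powr (1/8)) \<le> ln (real R + 1)" using Q3 by (subst ln_le_cancel_iff) auto
    hence "ln (real Q) / 16 \<le> ln (real R + 1) / 2" using Q3 by (simp add: ln_powr)
    hence G: "ln (real Q) / 16 \<le> sieve_mass R" using sieve_mass_ge_ln[OF R1] by linarith
    have "real (Q + 1) / sieve_mass R \<le> real (Q + 1) / (ln (real Q) / 16)"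
      using G lnQ by (intro divide_left_mono) auto
    also have "\<dots> = 16 * (real Q + 1) / ln (real Q)" by simp
    also have "\<dots> \<le> 32 * real Q / ln (real Q)" using lnQ Q3 by (intro divide_right_mono) auto
    finally have b1: "real (Q + 1) / sieve_mass R \<le> 32 * (real Q / ln (real Q))" by simp
    have "ln (real Q) = 2 * ln (sqrt (real Q))" using Q3 by (simp add: ln_sqrt)
    also have "\<dots> \<le> 2 * sqrt (real Q)" using Q3 ln_le_minus_one[of "sqrt (real Q)"] by simp
    finally have "sqrt (real Q) * ln (real Q) \<le> sqrt (real Q) * (2 * sqrt (real Q))" by (intro mult_left_mono) auto
    moreover have "sqrt (real Q) * (2 * sqrt (real Q)) = 2 * real Q" by (simp add: mult.left_commute[of "sqrt _"])
    ultimately have b2: "sqrt (real Q) \<le> 2 * (real Q / ln (real Q))" using lnQ by (simp add: pos_le_divide_eq)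
    have "real Q / (4 * ln (real Q)) \<le> P" using Q0[of Q] Q by (simp add: P_def)
    hence b3: "real Q / ln (real Q) \<le> 4 * P" by (simp add: mult.commute)
    have W: "real (Q + 1) / sieve_mass R + 2 * real R ^ 4 \<le> 200 * P" using b1 b2 b3 R4 of_nat_0_le_iff[of "card (primes_dyadic Q)", where 'a=real] unfolding P_def by linarith
    have "(\<Sum>q\<in>primes_dyadic Q. cmod (\<Sum>\<kappa>\<in>K. \<beta> \<kappa> * of_int (Legendre (s \<kappa>) (int q))) ^ 2) \<le>
      (real (Q + 1) / sieve_mass R + 2 * real R ^ 4) * (\<Sum>(\<kappa>,\<mu>)\<in>square_pairs K s. cmod (\<beta> \<kappa>) * cmod (\<beta> \<mu>))
       + 8 * real Z ^ 2 * real R ^ 4 * (\<Sum>\<kappa>\<in>K. cmod (\<beta> \<kappa>)) ^ 2"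
      unfolding square_pairs_def
      by (rule quadratic_large_sieve[where A = Q]) (use K s R1 RQ Q3 in \<open>auto simp: primes_dyadic_def\<close>)
    also have "\<dots> \<le> 200 * P * (\<Sum>(\<kappa>,\<mu>)\<in>square_pairs K s. cmod (\<beta> \<kappa>) * cmod (\<beta> \<mu>))
       + 200 * sqrt (real Q) * real Z ^ 2 * (\<Sum>\<kappa>\<in>K. cmod (\<beta> \<kappa>)) ^ 2"
    proof (intro add_mono mult_right_mono W)
      have "8 * real Z ^ 2 * real R ^ 4 \<le> 200 * real Z ^ 2 * sqrt (real Q)"
        using R4 by (intro mult_mono) auto
      thus "8 * real Z ^ 2 * real R ^ 4 \<le> 200 * sqrt (real Q) * real Z ^ 2" by (simp add: mult_ac)
    qed (auto intro!: sum_nonneg)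
    finally show "(\<Sum>q\<in>primes_dyadic Q. cmod (\<Sum>\<kappa>\<in>K. \<beta> \<kappa> * of_int (Legendre (s \<kappa>) (int q))) ^ 2) \<le>
      200 * real (card (primes_dyadic Q)) * (\<Sum>(\<kappa>,\<mu>)\<in>square_pairs K s. cmod (\<beta> \<kappa>) * cmod (\<beta> \<mu>))
      + 200 * sqrt (real Q) * real Z ^ 2 * (\<Sum>\<kappa>\<in>K. cmod (\<beta> \<kappa>)) ^ 2" by (simp add: P_def)
  qed simp
qed

section \<open>Moments of trigonometric polynomials\<close>

definition wave :: "nat \<Rightarrow> int \<Rightarrow> complex" where
  "wave q k = cis (2 * pi * real_of_int k / real q)"

lemma wave_0 [simp]: "wave q 0 = 1"
  by (simp add: wave_def)

lemma wave_add: "wave q (k + l) = wave q k * wave q l"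
  by (simp add: wave_def cis_mult add_divide_distrib distrib_left)

lemma wave_minus: "wave q (- k) = cnj (wave q k)"
  by (simp add: wave_def cis_cnj)

lemma norm_wave [simp]: "cmod (wave q k) = 1"
  by (simp add: wave_def)

lemma wave_sum: "wave q (\<Sum>i\<in>I. f i) = (\<Prod>i\<in>I. wave q (f i))"
  by (induction I rule: infinite_finite_induct) (auto simp: wave_add)

lemma wave_period: "q > 0 \<Longrightarrow> wave q (int q * k) = 1"
proof -
  assume "q > 0"
  hence "2 * pi * real_of_int (int q * k) / real q = 2 * pi * real_of_int k" by simp
  thus ?thesis unfolding wave_def by (simp add: cis_multiple_2pi)
qed

lemma wave_mult_nat: "wave q (k * int n) = wave q k ^ n"
proof -
  have "2 * pi * real_of_int (k * int n) / real q = real n * (2 * pi * real_of_int k / real q)" by simp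
  thus ?thesis unfolding wave_def by (simp only: Complex.DeMoivre)
qed

lemma wave_eq_1_iff:
  assumes "q > 0"
  shows "wave q k = 1 \<longleftrightarrow> int q dvd k"
proof
  assume "wave q k = 1"
  hence "cos (2 * pi * real_of_int k / real q) = 1" by (simp add: wave_def complex_eq_iff)
  then obtain n :: int where "2 * pi * real_of_int k / real q = of_int n * 2 * pi"
    using cos_one_2pi_int by auto
  hence "real_of_int k = real_of_int (n * int q)" using assms by (simp add: field_simps)
  hence "k = n * int q" by (simp only: of_int_eq_iff)
  thus "int q dvd k" by simp
next
  assume "int q dvd k"
  thus "wave q k = 1" using wave_period[OF assms] by (auto elim!: dvdE)
qed

lemma sum_int_nat: "(\<Sum>x\<in>{0..<int q}. f x) = (\<Sum>n<q. f (int n))"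
  by (rule sum.reindex_bij_witness[of _ int nat]) auto

lemma sum_wave:
  assumes q: "q > 0"
  shows "(\<Sum>x\<in>{0..<int q}. wave q (k * x)) = (if int q dvd k then of_nat q else 0)"
proof -
  have "(\<Sum>x\<in>{0..<int q}. wave q (k * x)) = (\<Sum>n<q. wave q k ^ n)"
    by (simp add: sum_int_nat wave_mult_nat)
  also have "\<dots> = (if int q dvd k then of_nat q else 0)"
  proof (cases "int q dvd k")
    case True
    hence "wave q k = 1" using wave_eq_1_iff[OF q] by simp
    thus ?thesis using True by simp
  next
    case False
    hence ne: "wave q k \<noteq> 1" using wave_eq_1_iff[OF q] by simp
    have "wave q k ^ q = 1" using wave_period[OF q, of k] by (simp add: wave_mult_nat[symmetric] mult.commute)
    thus ?thesis using ne False by (simp add: geometric_sum)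
  qed
  finally show ?thesis .
qed

definition zero_sums :: "nat set \<Rightarrow> int set \<Rightarrow> (nat \<Rightarrow> int) set" where
  "zero_sums I A = {\<kappa> \<in> PiE I (\<lambda>_. A). (\<Sum>i\<in>I. \<kappa> i) = 0}"

lemma finite_zero_sums [simp]: "finite I \<Longrightarrow> finite A \<Longrightarrow> finite (zero_sums I A)"
  by (simp add: zero_sums_def finite_PiE)

definition tuple_sum :: "(int \<Rightarrow> complex) \<Rightarrow> int set \<Rightarrow> nat set \<Rightarrow> complex" where
  "tuple_sum a A I = (\<Sum>\<kappa>\<in>zero_sums I A. \<Prod>i\<in>I. a (\<kappa> i))"

text \<open>The frequencies are so small compared with \<open>q\<close> that the congruence \<open>\<Sum>\<kappa> = 0 mod q\<close>
  picked out by orthogonality is an equality.\<close>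

lemma moment_eq_tuple_sum:
  assumes I: "finite I" and A: "finite A" "\<And>k. k \<in> A \<Longrightarrow> \<bar>k\<bar> \<le> int N"
    and q: "card I * N < q"
  shows "(\<Sum>x\<in>{0..<int q}. (\<Sum>k\<in>A. a k * wave q (k * x)) ^ card I) = of_nat q * tuple_sum a A I"
proof -
  have q0: "q > 0" using q by linarith
  have "(\<Sum>x\<in>{0..<int q}. (\<Sum>k\<in>A. a k * wave q (k * x)) ^ card I) =
    (\<Sum>x\<in>{0..<int q}. \<Sum>\<kappa>\<in>PiE I (\<lambda>_. A). (\<Prod>i\<in>I. a (\<kappa> i)) * wave q ((\<Sum>i\<in>I. \<kappa> i) * x))"
  proof (intro sum.cong refl)
    fix x
    have "(\<Sum>k\<in>A. a k * wave q (k * x)) ^ card I = (\<Prod>i\<in>I. \<Sum>k\<in>A. a k * wave q (k * x))" by simp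
    also have "\<dots> = (\<Sum>\<kappa>\<in>PiE I (\<lambda>_. A). \<Prod>i\<in>I. a (\<kappa> i) * wave q (\<kappa> i * x))"
      by (rule prod_sum_PiE) (use I A in auto)
    also have "\<dots> = (\<Sum>\<kappa>\<in>PiE I (\<lambda>_. A). (\<Prod>i\<in>I. a (\<kappa> i)) * wave q ((\<Sum>i\<in>I. \<kappa> i) * x))"
      by (simp add: prod.distrib wave_sum sum_distrib_right)
    finally show "(\<Sum>k\<in>A. a k * wave q (k * x)) ^ card I =
      (\<Sum>\<kappa>\<in>PiE I (\<lambda>_. A). (\<Prod>i\<in>I. a (\<kappa> i)) * wave q ((\<Sum>i\<in>I. \<kappa> i) * x))" .
  qed
  also have "\<dots> = (\<Sum>\<kappa>\<in>PiE I (\<lambda>_. A). (\<Prod>i\<in>I. a (\<kappa> i)) * (\<Sum>x\<in>{0..<int q}. wave q ((\<Sum>i\<in>I. \<kappa> i) * x)))"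
    by (subst sum.swap) (simp only: sum_distrib_left)
  also have "\<dots> = (\<Sum>\<kappa>\<in>PiE I (\<lambda>_. A). if (\<Sum>i\<in>I. \<kappa> i) = 0 then of_nat q * (\<Prod>i\<in>I. a (\<kappa> i)) else 0)"
  proof (intro sum.cong refl)
    fix \<kappa> assume \<kappa>: "\<kappa> \<in> PiE I (\<lambda>_. A)"
    have "\<bar>\<Sum>i\<in>I. \<kappa> i\<bar> \<le> (\<Sum>i\<in>I. int N)"
      by (rule order_trans[OF sum_abs]) (intro sum_mono A(2) PiE_mem[OF \<kappa>])
    hence "\<bar>\<Sum>i\<in>I. \<kappa> i\<bar> < int q" using q by (simp flip: of_nat_mult)
    hence "int q dvd (\<Sum>i\<in>I. \<kappa> i) \<longleftrightarrow> (\<Sum>i\<in>I. \<kappa> i) = 0"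
      using zdvd_imp_le[of "int q" "\<bar>\<Sum>i\<in>I. \<kappa> i\<bar>"] by (cases "(\<Sum>i\<in>I. \<kappa> i) = 0") auto
    thus "(\<Prod>i\<in>I. a (\<kappa> i)) * (\<Sum>x\<in>{0..<int q}. wave q ((\<Sum>i\<in>I. \<kappa> i) * x)) =
      (if (\<Sum>i\<in>I. \<kappa> i) = 0 then of_nat q * (\<Prod>i\<in>I. a (\<kappa> i)) else 0)"
      unfolding sum_wave[OF q0] by simp
  qed
  also have "\<dots> = (\<Sum>\<kappa>\<in>zero_sums I A. of_nat q * (\<Prod>i\<in>I. a (\<kappa> i)))"
    unfolding zero_sums_def using I A by (subst sum.inter_filter) (auto intro: finite_PiE)
  finally show ?thesis by (simp add: tuple_sum_def sum_distrib_left)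
qed

text \<open>A cancelling pair drops out of the linear relation: the other coordinates form a zero
  sum by themselves, and the value at \<open>i0\<close> ranges freely over \<open>A\<close>.\<close>

lemma zero_sums_insert_pair:
  assumes I: "finite I" "i0 \<in> I" "j \<in> I" "j \<noteq> i0" and A: "\<And>k. k \<in> A \<Longrightarrow> - k \<in> A"
  shows "(\<Sum>\<kappa> | \<kappa> \<in> zero_sums I A \<and> \<kappa> j = - \<kappa> i0. \<Prod>i\<in>I. a (\<kappa> i)) =
    (\<Sum>k\<in>A. a k * a (- k)) * tuple_sum a A (I - {i0, j})"
proof -
  define I' where "I' = I - {i0, j}"
  have I': "I = insert i0 (insert j I')" "i0 \<notin> insert j I'" "j \<notin> I'" "finite I'"
    using I by (auto simp: I'_def)
  have "(\<Sum>\<kappa> | \<kappa> \<in> zero_sums I A \<and> \<kappa> j = - \<kappa> i0. \<Prod>i\<in>I. a (\<kappa> i)) =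
    (\<Sum>(k, \<kappa>)\<in>A \<times> zero_sums I' A. (a k * a (- k)) * (\<Prod>i\<in>I'. a (\<kappa> i)))"
  proof (rule sum.reindex_bij_witness[of _ "\<lambda>(k,\<kappa>). \<kappa>(i0 := k, j := - k)" "\<lambda>\<kappa>. (\<kappa> i0, restrict \<kappa> I')"])
    fix \<kappa> assume "\<kappa> \<in> {\<kappa>. \<kappa> \<in> zero_sums I A \<and> \<kappa> j = - \<kappa> i0}"
    hence \<kappa>: "\<kappa> \<in> PiE I (\<lambda>_. A)" "(\<Sum>i\<in>I. \<kappa> i) = 0" "\<kappa> j = - \<kappa> i0" by (auto simp: zero_sums_def)
    show "(case (\<kappa> i0, restrict \<kappa> I') of (k, \<kappa>) \<Rightarrow> \<kappa>(i0 := k, j := - k)) = \<kappa>"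
    proof
      fix i show "(case (\<kappa> i0, restrict \<kappa> I') of (k, \<kappa>) \<Rightarrow> \<kappa>(i0 := k, j := - k)) i = \<kappa> i"
        using \<kappa>(3) PiE_arb[OF \<kappa>(1), of i] I' by (cases "i \<in> I") auto
    qed
    have "(\<Sum>i\<in>I. \<kappa> i) = \<kappa> i0 + (\<kappa> j + (\<Sum>i\<in>I'. \<kappa> i))" using I' by simp
    hence "(\<Sum>i\<in>I'. \<kappa> i) = 0" using \<kappa> by simp
    moreover have "(\<Sum>i\<in>I'. restrict \<kappa> I' i) = (\<Sum>i\<in>I'. \<kappa> i)" by (intro sum.cong) auto
    ultimately show "(\<kappa> i0, restrict \<kappa> I') \<in> A \<times> zero_sums I' A"
      using PiE_mem[OF \<kappa>(1)] I' by (auto simp: zero_sums_def)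
    have "(\<Prod>i\<in>I'. a (restrict \<kappa> I' i)) = (\<Prod>i\<in>I'. a (\<kappa> i))" by (intro prod.cong) auto
    thus "(case (\<kappa> i0, restrict \<kappa> I') of (k, \<kappa>) \<Rightarrow> (a k * a (- k)) * (\<Prod>i\<in>I'. a (\<kappa> i))) = (\<Prod>i\<in>I. a (\<kappa> i))"
      using I' \<kappa>(3) by simp
  next
    fix z assume "z \<in> A \<times> zero_sums I' A"
    then obtain k \<kappa> where z: "z = (k, \<kappa>)" and k: "k \<in> A" and \<kappa>: "\<kappa> \<in> PiE I' (\<lambda>_. A)" "(\<Sum>i\<in>I'. \<kappa> i) = 0"
      by (auto simp: zero_sums_def)
    define \<kappa>' where "\<kappa>' = \<kappa>(i0 := k, j := - k)"
    have v: "\<kappa>' i0 = k" "\<kappa>' j = - k" "\<And>i. i \<in> I' \<Longrightarrow> \<kappa>' i = \<kappa> i" using I' by (auto simp: \<kappa>'_def)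
    have "restrict \<kappa>' I' = \<kappa>"
    proof
      fix i show "restrict \<kappa>' I' i = \<kappa> i" using v PiE_arb[OF \<kappa>(1), of i] by (cases "i \<in> I'") auto
    qed
    thus "(\<lambda>\<kappa>. (\<kappa> i0, restrict \<kappa> I')) (case z of (k, \<kappa>) \<Rightarrow> \<kappa>(i0 := k, j := - k)) = z"
      using v z by (simp add: \<kappa>'_def[symmetric])
    have "(\<Sum>i\<in>I. \<kappa>' i) = \<kappa>' i0 + (\<kappa>' j + (\<Sum>i\<in>I'. \<kappa>' i))" using I' by simp
    also have "\<dots> = 0" using v \<kappa> by simp
    finally have "(\<Sum>i\<in>I. \<kappa>' i) = 0" .
    moreover have "\<kappa>' \<in> PiE I (\<lambda>_. A)"
    proof (rule PiE_I)
      fix i assume "i \<in> I" thus "\<kappa>' i \<in> A" using v k A[OF k] PiE_mem[OF \<kappa>(1)] I'(1) by auto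
    next
      fix i assume "i \<notin> I" thus "\<kappa>' i = undefined" using I' PiE_arb[OF \<kappa>(1), of i] by (auto simp: \<kappa>'_def)
    qed
    ultimately show "(case z of (k, \<kappa>) \<Rightarrow> \<kappa>(i0 := k, j := - k)) \<in> {\<kappa>. \<kappa> \<in> zero_sums I A \<and> \<kappa> j = - \<kappa> i0}"
      using v z by (simp add: \<kappa>'_def[symmetric] zero_sums_def)
  qed
  thus ?thesis
    by (simp add: tuple_sum_def I'_def sum_product sum.cartesian_product)
qed

text \<open>Summing over the position \<open>j\<close> of a partner of the first variable counts a
  tuple once for each partner. The weight is the error of this count, and it vanishes when there is
  exactly one partner.\<close>

definition unpaired_sum :: "(int \<Rightarrow> complex) \<Rightarrow> int set \<Rightarrow> nat \<Rightarrow> complex" where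
  "unpaired_sum a A m = (\<Sum>\<kappa>\<in>zero_sums {..<m} A.
     (1 - of_nat (card {j\<in>{1..<m}. \<kappa> j = - \<kappa> 0})) * (\<Prod>i<m. a (\<kappa> i)))"

text \<open>The discrete analogue of Gaussian integration by parts: pairing off the first variable.\<close>

lemma tuple_sum_recursion:
  assumes m: "m \<ge> 2" and A: "finite A" "\<And>k. k \<in> A \<Longrightarrow> - k \<in> A"
    and card_dep: "\<And>I. finite I \<Longrightarrow> card I = m - 2 \<Longrightarrow> tuple_sum a A I = T"
  shows "tuple_sum a A {..<m} = of_nat (m - 1) * (\<Sum>k\<in>A. a k * a (- k)) * T + unpaired_sum a A m"
proof -
  define Z where "Z = zero_sums {..<m} A"
  have Z: "finite Z" using A by (simp add: Z_def)
  define p where "p \<kappa> = (\<Prod>i<m. a (\<kappa> i))" for \<kappa> :: "nat \<Rightarrow> int"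
  have "(\<Sum>\<kappa>\<in>Z. of_nat (card {j\<in>{1..<m}. \<kappa> j = - \<kappa> 0}) * p \<kappa>) =
    (\<Sum>\<kappa>\<in>Z. \<Sum>j\<in>{1..<m}. if \<kappa> j = - \<kappa> 0 then p \<kappa> else 0)"
    by (intro sum.cong refl) (simp add: sum.inter_filter[symmetric])
  also have "\<dots> = (\<Sum>j\<in>{1..<m}. \<Sum>\<kappa>\<in>Z. if \<kappa> j = - \<kappa> 0 then p \<kappa> else 0)" by (rule sum.swap)
  also have "\<dots> = (\<Sum>j\<in>{1..<m}. (\<Sum>k\<in>A. a k * a (- k)) * T)"
  proof (intro sum.cong refl)
    fix j assume j: "j \<in> {1..<m}"
    have "(\<Sum>\<kappa>\<in>Z. if \<kappa> j = - \<kappa> 0 then p \<kappa> else 0) = (\<Sum>\<kappa> | \<kappa> \<in> Z \<and> \<kappa> j = - \<kappa> 0. p \<kappa>)"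
      using Z by (simp add: sum.inter_filter[symmetric])
    also have "\<dots> = (\<Sum>k\<in>A. a k * a (- k)) * tuple_sum a A ({..<m} - {0, j})"
      unfolding Z_def p_def by (rule zero_sums_insert_pair) (use j A in auto)
    \<comment> \<open>The remaining index set is not an initial segment; \<open>card_dep\<close>
      replaces a relabelling of the tuples.\<close>
    also have "tuple_sum a A ({..<m} - {0, j}) = T"
      by (rule card_dep) (use j in \<open>auto simp: card_Diff_subset\<close>)
    finally show "(\<Sum>\<kappa>\<in>Z. if \<kappa> j = - \<kappa> 0 then p \<kappa> else 0) = (\<Sum>k\<in>A. a k * a (- k)) * T" .
  qed
  also have "\<dots> = of_nat (m - 1) * (\<Sum>k\<in>A. a k * a (- k)) * T" by simp
  finally have "(\<Sum>\<kappa>\<in>Z. of_nat (card {j\<in>{1..<m}. \<kappa> j = - \<kappa> 0}) * p \<kappa>) =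
    of_nat (m - 1) * (\<Sum>k\<in>A. a k * a (- k)) * T" .
  moreover have "unpaired_sum a A m = (\<Sum>\<kappa>\<in>Z. p \<kappa>) - (\<Sum>\<kappa>\<in>Z. of_nat (card {j\<in>{1..<m}. \<kappa> j = - \<kappa> 0}) * p \<kappa>)"
    by (simp add: unpaired_sum_def Z_def p_def left_diff_distrib sum_subtractf)
  ultimately show ?thesis by (simp add: tuple_sum_def Z_def p_def)
qed

lemma Legendre_prod:
  assumes "prime (q::nat)" "q > 2" "finite I"
  shows "Legendre (\<Prod>i\<in>I. \<kappa> i) q = (\<Prod>i\<in>I. Legendre (\<kappa> i) q)"
  using assms(3) by (induction I rule: finite_induct) (use assms in \<open>auto simp: Legendre_1 Legendre_mult\<close>)

text \<open>The phase contributes only the factor \<open>w ^ m\<close> of modulus 1, and the symbols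
  multiply to the symbol of the product. The dependence on \<open>q\<close> is thus confined to one
  Legendre symbol per tuple, the form to which the large sieve applies.\<close>

lemma unpaired_sum_twist:
  assumes q: "prime (q::nat)" "q > 2" and w: "cmod w = 1"
  shows "cmod (unpaired_sum (\<lambda>k. w * b k * of_int (Legendre k q)) A m) =
    cmod (\<Sum>\<kappa>\<in>zero_sums {..<m} A. ((1 - of_nat (card {j\<in>{1..<m}. \<kappa> j = - \<kappa> 0})) * (\<Prod>i<m. b (\<kappa> i)))
       * of_int (Legendre (\<Prod>i<m. \<kappa> i) q))"
proof -
  have "unpaired_sum (\<lambda>k. w * b k * of_int (Legendre k q)) A m =
    w ^ m * (\<Sum>\<kappa>\<in>zero_sums {..<m} A. ((1 - of_nat (card {j\<in>{1..<m}. \<kappa> j = - \<kappa> 0})) * (\<Prod>i<m. b (\<kappa> i)))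
       * of_int (Legendre (\<Prod>i<m. \<kappa> i) q))"
    unfolding unpaired_sum_def sum_distrib_left
    by (intro sum.cong refl) (simp add: prod.distrib Legendre_prod[OF q] mult_ac)
  thus ?thesis using w by (simp add: norm_mult norm_power)
qed

section \<open>The mean square of the defect over a dyadic block\<close>

definition grid_scale :: "nat \<Rightarrow> real" where
  "grid_scale n = exp (- sqrt (real n))"

definition cutoff :: "nat \<Rightarrow> nat \<Rightarrow> nat" where
  "cutoff l n = nat \<lfloor>real l / grid_scale n\<rfloor>"

definition freqs :: "nat \<Rightarrow> nat \<Rightarrow> int set" where
  "freqs l n = {- int (cutoff l n)..int (cutoff l n)} - {0}"

text \<open>The \<open>k\<close>-th Fourier coefficient of the indicator function of an interval of length
  \<open>\<alpha>\<close> on the circle, divided by \<open>sqrt \<alpha>\<close>.\<close>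

definition coef :: "real \<Rightarrow> int \<Rightarrow> complex" where
  "coef \<alpha> k = (cis (2 * pi * of_int k * \<alpha>) - 1) / (2 * pi * \<i> * of_int k * of_real (sqrt \<alpha>))"

text \<open>The right-hand side of \<open>unpaired_sum_twist\<close> with the rounded density: all
  coefficients depend on \<open>l\<close>, \<open>n\<close>, \<open>m\<close> but not on
  \<open>q\<close>.\<close>

definition defect :: "nat \<Rightarrow> nat \<Rightarrow> nat \<Rightarrow> nat \<Rightarrow> real" where
  "defect l n m q = cmod (\<Sum>\<kappa>\<in>zero_sums {..<m} (freqs l n).
     ((1 - of_nat (card {j\<in>{1..<m}. \<kappa> j = - \<kappa> 0})) * (\<Prod>i<m. coef (grid_scale n) (\<kappa> i)))
       * of_int (Legendre (\<Prod>i<m. \<kappa> i) q))"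

lemma grid_scale_pos: "grid_scale n > 0" and grid_scale_le_1: "grid_scale n \<le> 1"
  by (simp_all add: grid_scale_def)

lemma norm_cis_diff_1_le: "cmod (cis x - 1) \<le> \<bar>x\<bar>"
  using iexp_approx1[of x 0] by (simp add: cis_conv_exp mult.commute)

lemma norm_coef_le:
  assumes "\<alpha> > 0" "k \<noteq> 0"
  shows "cmod (coef \<alpha> k) \<le> sqrt \<alpha>"
proof -
  have s: "sqrt \<alpha> > 0" using assms by simp
  have "cmod (coef \<alpha> k) = cmod (cis (2 * pi * of_int k * \<alpha>) - 1) / (2 * pi * \<bar>of_int k\<bar> * sqrt \<alpha>)"
    using assms by (simp add: coef_def norm_divide norm_mult)
  also have "\<dots> \<le> \<bar>2 * pi * of_int k * \<alpha>\<bar> / (2 * pi * \<bar>of_int k\<bar> * sqrt \<alpha>)"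
    by (intro divide_right_mono norm_cis_diff_1_le) (use assms in auto)
  also have "\<dots> = \<alpha> / sqrt \<alpha>" using assms by (simp add: abs_mult)
  also have "\<dots> = sqrt \<alpha>" using assms by (simp add: real_div_sqrt)
  finally show ?thesis .
qed

lemma cutoff_bounds:
  assumes "l \<ge> 1"
  shows "cutoff l n \<ge> 1" "real (cutoff l n) \<le> real l / grid_scale n" "real l / grid_scale n \<le> 2 * real (cutoff l n)"
proof -
  have "1 \<le> real l / grid_scale n" using assms grid_scale_pos[of n] grid_scale_le_1[of n] by (simp add: pos_le_divide_eq)
  thus 1: "cutoff l n \<ge> 1" by (simp add: cutoff_def le_nat_floor)
  show "real (cutoff l n) \<le> real l / grid_scale n" using grid_scale_pos[of n] by (simp add: cutoff_def)
  have "real l / grid_scale n < real (cutoff l n) + 1" unfolding cutoff_def by linarith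
  thus "real l / grid_scale n \<le> 2 * real (cutoff l n)" using 1 by simp
qed

definition merge_tuples :: "nat \<Rightarrow> (nat \<Rightarrow> int) \<Rightarrow> (nat \<Rightarrow> int) \<Rightarrow> nat \<Rightarrow> int" where
  "merge_tuples m \<kappa> \<mu> = (\<lambda>i\<in>{..<2*m}. if i < m then \<kappa> i else \<mu> (i - m))"

lemma prod_double: "(\<Prod>i<2*m. f i) = (\<Prod>i<m. f i) * (\<Prod>i<m. f (i + m :: nat))" for f :: "nat \<Rightarrow> nat"
proof -
  have "(\<Prod>i<2*m. f i) = (\<Prod>i<m. f i) * (\<Prod>i=m..<m+m. f i)"
    using prod.atLeastLessThan_concat[of 0 m "m + m" f] by (simp add: atLeast0LessThan mult_2)
  also have "(\<Prod>i=m..<m+m. f i) = (\<Prod>i<m. f (i + m))"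
    using prod.shift_bounds_nat_ivl[of f 0 m m] by (simp add: atLeast0LessThan)
  finally show ?thesis .
qed

lemma card_square_pairs_le:
  fixes m N :: nat
  assumes m: "m \<ge> 1"
  defines "A \<equiv> {- int N..int N} - {0}"
  defines "K \<equiv> {\<kappa> \<in> zero_sums {..<m} A. card {j\<in>{1..<m}. \<kappa> j = - \<kappa> 0} \<noteq> 1}"
  shows "card (square_pairs K (\<lambda>\<kappa>. \<Prod>i<m. \<kappa> i)) \<le> card (unpaired_tuples m N)"
proof (rule card_inj_on_le)
  show "finite (unpaired_tuples m N)" by (simp add: unpaired_tuples_def)
  have ext: "\<kappa> i = undefined" if "\<kappa> \<in> K" "\<not> i < m" for \<kappa> i
    using that by (auto simp: K_def zero_sums_def PiE_def extensional_def)
  show "inj_on (\<lambda>(\<kappa>,\<mu>). merge_tuples m \<kappa> \<mu>) (square_pairs K (\<lambda>\<kappa>. \<Prod>i<m. \<kappa> i))"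
  proof (rule inj_onI, clarify)
    fix \<kappa> \<mu> \<kappa>' \<mu>'
    assume 1: "(\<kappa>,\<mu>) \<in> square_pairs K (\<lambda>\<kappa>. \<Prod>i<m. \<kappa> i)" "(\<kappa>',\<mu>') \<in> square_pairs K (\<lambda>\<kappa>. \<Prod>i<m. \<kappa> i)"
      and eq: "merge_tuples m \<kappa> \<mu> = merge_tuples m \<kappa>' \<mu>'"
    have K: "\<kappa> \<in> K" "\<mu> \<in> K" "\<kappa>' \<in> K" "\<mu>' \<in> K" using 1 by (auto simp: square_pairs_def)
    have "\<kappa> i = \<kappa>' i" for i
      using fun_cong[OF eq, of i] ext[OF K(1), of i] ext[OF K(3), of i] by (cases "i < m") (auto simp: merge_tuples_def)
    moreover have "\<mu> i = \<mu>' i" for i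
      using fun_cong[OF eq, of "i + m"] ext[OF K(2), of i] ext[OF K(4), of i] by (cases "i < m") (auto simp: merge_tuples_def)
    ultimately show "\<kappa> = \<kappa>' \<and> \<mu> = \<mu>'" by auto
  qed
  show "(\<lambda>(\<kappa>,\<mu>). merge_tuples m \<kappa> \<mu>) ` square_pairs K (\<lambda>\<kappa>. \<Prod>i<m. \<kappa> i) \<subseteq> unpaired_tuples m N"
  proof clarify
    fix \<kappa> \<mu> assume "(\<kappa>,\<mu>) \<in> square_pairs K (\<lambda>\<kappa>. \<Prod>i<m. \<kappa> i)"
    then obtain t where K: "\<kappa> \<in> K" "\<mu> \<in> K" and t: "nat \<bar>(\<Prod>i<m. \<kappa> i) * (\<Prod>i<m. \<mu> i)\<bar> = t\<^sup>2"
      by (auto simp: square_pairs_def)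
    define k where "k = merge_tuples m \<kappa> \<mu>"
    have k1: "k i = \<kappa> i" if "i < m" for i using that by (simp add: k_def merge_tuples_def)
    have k2: "k (i + m) = \<mu> i" if "i < m" for i using that by (simp add: k_def merge_tuples_def)
    have PiE: "\<kappa> \<in> PiE {..<m} (\<lambda>_. A)" "\<mu> \<in> PiE {..<m} (\<lambda>_. A)" using K by (auto simp: K_def zero_sums_def)
    have "(\<Prod>i<2*m. nat \<bar>k i\<bar>) = (\<Prod>i<m. nat \<bar>\<kappa> i\<bar>) * (\<Prod>i<m. nat \<bar>\<mu> i\<bar>)"
      unfolding prod_double by (intro arg_cong2[of _ _ _ _ "(*)"] prod.cong refl) (simp_all add: k1 k2)
    also have "int \<dots> = \<bar>(\<Prod>i<m. \<kappa> i) * (\<Prod>i<m. \<mu> i)\<bar>"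
      by (simp add: abs_mult abs_prod)
    hence "(\<Prod>i<m. nat \<bar>\<kappa> i\<bar>) * (\<Prod>i<m. nat \<bar>\<mu> i\<bar>) = t\<^sup>2" using t by linarith
    finally have sq: "(\<Prod>i<2*m. nat \<bar>k i\<bar>) = t\<^sup>2" .
    have "k \<in> PiE {..<2*m} (\<lambda>_. A)"
    proof (rule PiE_I)
      fix i assume i: "i \<in> {..<2*m}"
      show "k i \<in> A"
      proof (cases "i < m")
        case True
        thus ?thesis using k1 PiE_mem[OF PiE(1), of i] by simp
      next
        case False
        thus ?thesis using k2[of "i - m"] PiE_mem[OF PiE(2), of "i - m"] i by simp
      qed
    qed (simp add: k_def merge_tuples_def)
    hence "k \<in> square_tuples {..<2*m} N" using sq by (auto simp: square_tuples_def A_def)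
    moreover have "(\<Sum>i<m. k i) = 0" using K k1 by (simp add: K_def zero_sums_def)
    moreover have "{j\<in>{1..<m}. k j = - k 0} = {j\<in>{1..<m}. \<kappa> j = - \<kappa> 0}" using k1 m by auto
    ultimately show "merge_tuples m \<kappa> \<mu> \<in> unpaired_tuples m N"
      using K by (simp add: unpaired_tuples_def K_def k_def)
  qed
qed

lemma ln_le_4_root: "x \<ge> 1 \<Longrightarrow> ln x \<le> 4 * x powr (1/4)" for x :: real
  using ln_powr_bound[of x "1/4"] by simp

text \<open>With \<open>\<alpha>\<close> the rounded density and \<open>N\<close> the cutoff, the
  square pairs number about \<open>N powr (m - c)\<close>, each of weight at most
  \<open>m\<^sup>2 * \<alpha> ^ m\<close>. Since \<open>N * \<alpha> \<le> l\<close>, this leaves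
  \<open>\<alpha> powr c = exp (- c * sqrt n)\<close>. The error term of the large sieve grows like
  \<open>N ^ (4 * m)\<close>: half of the exponent comes from the size of the products, half from
  the number of tuples. The hypothesis on \<open>ln Q\<close> keeps it below the main bound.\<close>

theorem defect_mean_square:
  assumes l: "l \<ge> 1" and m: "m \<ge> 1"
  shows "\<exists>D>0. \<exists>c>0. \<exists>Q0. \<forall>n Q. Q \<ge> Q0 \<longrightarrow> ln (real Q) \<ge> real (4 * (4 * m + 1)) * sqrt (real n) \<longrightarrow>
     (\<Sum>q\<in>primes_dyadic Q. (defect l n m q)\<^sup>2) \<le> D * exp (- c * sqrt (real n)) * real (card (primes_dyadic Q))"
proof -
  obtain C Q1 where C: "C > 0" and LS: "\<And>Q K (\<beta> :: (nat \<Rightarrow> int) \<Rightarrow> complex) s Z. Q \<ge> Q1 \<Longrightarrow> finite K \<Longrightarrow>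
     (\<And>\<kappa>. \<kappa> \<in> K \<Longrightarrow> s \<kappa> \<noteq> 0 \<and> \<bar>s \<kappa>\<bar> \<le> int Z) \<Longrightarrow>
    (\<Sum>q\<in>primes_dyadic Q. cmod (\<Sum>\<kappa>\<in>K. \<beta> \<kappa> * of_int (Legendre (s \<kappa>) (int q))) ^ 2) \<le>
      C * real (card (primes_dyadic Q)) * (\<Sum>(\<kappa>,\<mu>)\<in>square_pairs K s. cmod (\<beta> \<kappa>) * cmod (\<beta> \<mu>))
      + C * sqrt (real Q) * real Z ^ 2 * (\<Sum>\<kappa>\<in>K. cmod (\<beta> \<kappa>)) ^ 2"
    by (rule dyadic_large_sieve[where 'a = "nat \<Rightarrow> int"]) blast
  obtain Q2 where Q2: "\<And>Q. Q \<ge> Q2 \<Longrightarrow> real (card (primes_dyadic Q)) \<ge> real Q / (4 * ln (real Q))"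
    using card_primes_dyadic_ge by blast
  obtain D0 c where D0: "D0 > 0" "c > 0" "c \<le> 1"
    "\<And>N. N \<ge> 1 \<Longrightarrow> real (card (unpaired_tuples m N)) \<le> D0 * real N powr (real m - c)"
    using card_unpaired_tuples[OF m] by blast
  define D where "D = C * D0 * real m ^ 2 * real l powr (real m - c) + 16 * C * real m ^ 2 * 4 ^ m * real l ^ (4 * m)"
  have Dpos: "D > 0" unfolding D_def using C D0 m l by (intro add_pos_nonneg mult_pos_pos) auto
  show ?thesis
  proof (rule exI[of _ D], rule conjI[OF Dpos], rule exI[of _ c], rule conjI[OF D0(2)],
      rule exI[of _ "max (max Q1 Q2) 3"], intro allI impI)
    fix n Q assume Q: "Q \<ge> max (max Q1 Q2) 3" and nQ: "ln (real Q) \<ge> real (4 * (4 * m + 1)) * sqrt (real n)"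
    define \<alpha> where "\<alpha> = grid_scale n"
    define N where "N = cutoff l n"
    define A where "A = {- int N..int N} - {0}"
    define J where "J \<kappa> = card {j\<in>{1..<m}. \<kappa> j = - \<kappa> 0}" for \<kappa> :: "nat \<Rightarrow> int"
    define K where "K = {\<kappa> \<in> zero_sums {..<m} A. J \<kappa> \<noteq> 1}"
    define s where "s \<kappa> = (\<Prod>i<m. \<kappa> i)" for \<kappa> :: "nat \<Rightarrow> int"
    define \<beta> where "\<beta> \<kappa> = (1 - of_nat (J \<kappa>)) * (\<Prod>i<m. coef \<alpha> (\<kappa> i))" for \<kappa>
    define P where "P = real (card (primes_dyadic Q))"
    have \<alpha>: "\<alpha> > 0" "\<alpha> \<le> 1" by (auto simp: \<alpha>_def grid_scale_pos grid_scale_le_1)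
    have N: "N \<ge> 1" "real N \<le> real l / \<alpha>" using cutoff_bounds[OF l, of n] by (auto simp: N_def \<alpha>_def)
    have Q3: "real Q \<ge> 3" using Q by linarith
    have fA: "finite A" by (simp add: A_def)
    have fK: "finite K" using fA by (simp add: K_def)
    have memK: "\<kappa> i \<in> A" if "\<kappa> \<in> K" "i < m" for \<kappa> i
      using that by (auto simp: K_def zero_sums_def PiE_def Pi_def)
    have "defect l n m q = cmod (\<Sum>\<kappa>\<in>K. \<beta> \<kappa> * of_int (Legendre (s \<kappa>) (int q)))" for q
    proof -
      have "(\<Sum>\<kappa>\<in>zero_sums {..<m} A. \<beta> \<kappa> * of_int (Legendre (s \<kappa>) (int q))) = (\<Sum>\<kappa>\<in>K. \<beta> \<kappa> * of_int (Legendre (s \<kappa>) (int q)))"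
        by (rule sum.mono_neutral_right) (use fA in \<open>auto simp: K_def \<beta>_def\<close>)
      thus ?thesis by (simp add: defect_def freqs_def A_def N_def \<beta>_def \<alpha>_def s_def J_def)
    qed
    hence "(\<Sum>q\<in>primes_dyadic Q. (defect l n m q)\<^sup>2) =
       (\<Sum>q\<in>primes_dyadic Q. cmod (\<Sum>\<kappa>\<in>K. \<beta> \<kappa> * of_int (Legendre (s \<kappa>) (int q))) ^ 2)" by simp
    also have "\<dots> \<le> C * P * (\<Sum>(\<kappa>,\<mu>)\<in>square_pairs K s. cmod (\<beta> \<kappa>) * cmod (\<beta> \<mu>))
      + C * sqrt (real Q) * real (N ^ m) ^ 2 * (\<Sum>\<kappa>\<in>K. cmod (\<beta> \<kappa>)) ^ 2"
      unfolding P_def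
    proof (rule LS)
      show "Q \<ge> Q1" using Q by simp
      fix \<kappa> assume \<kappa>: "\<kappa> \<in> K"
      have "\<bar>s \<kappa>\<bar> = (\<Prod>i<m. \<bar>\<kappa> i\<bar>)" by (simp add: s_def abs_prod)
      also have "\<dots> \<le> (\<Prod>i<m. int N)" 
      proof (intro prod_mono conjI)
        fix i assume "i \<in> {..<m}"
        thus "\<bar>\<kappa> i\<bar> \<le> int N" using memK[OF \<kappa>, of i] by (auto simp: A_def)
      qed auto
      finally show "s \<kappa> \<noteq> 0 \<and> \<bar>s \<kappa>\<bar> \<le> int (N ^ m)" using memK[OF \<kappa>] by (auto simp: s_def A_def)
    qed (use fK in auto)
    also have "\<dots> \<le> C * D0 * real m ^ 2 * real l powr (real m - c) * exp (- c * sqrt (real n)) * P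
       + 16 * C * real m ^ 2 * 4 ^ m * real l ^ (4 * m) * exp (- c * sqrt (real n)) * P"
    proof (rule add_mono)
      have b\<beta>: "cmod (\<beta> \<kappa>) \<le> real m * sqrt \<alpha> ^ m" if \<kappa>: "\<kappa> \<in> K" for \<kappa>
      proof -
        have "cmod (\<Prod>i<m. coef \<alpha> (\<kappa> i)) \<le> (\<Prod>i<m. sqrt \<alpha>)"
          unfolding prod_norm[symmetric]
          by (intro prod_mono conjI norm_coef_le) (use \<alpha> memK[OF \<kappa>] in \<open>auto simp: A_def\<close>)
        moreover have "cmod (1 - of_nat (J \<kappa>)) \<le> real m"
        proof -
          have "J \<kappa> \<le> card {1..<m}" unfolding J_def by (intro card_mono) auto
          hence "\<bar>1 - real (J \<kappa>)\<bar> \<le> real m" using m by (auto simp: abs_le_iff)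
          moreover have "cmod (1 - of_nat (J \<kappa>)) = \<bar>1 - real (J \<kappa>)\<bar>"
            by (metis norm_of_real of_real_1 of_real_diff of_real_of_nat_eq)
          ultimately show ?thesis by simp
        qed
        ultimately show ?thesis unfolding \<beta>_def norm_mult by (intro mult_mono) auto
      qed
      have sm: "(real m * sqrt \<alpha> ^ m) ^ 2 = real m ^ 2 * \<alpha> ^ m"
        using \<alpha> by (simp add: power_mult_distrib power_mult[symmetric] mult.commute[of m 2])
          (simp add: power_mult)
      have "(\<Sum>(\<kappa>,\<mu>)\<in>square_pairs K s. cmod (\<beta> \<kappa>) * cmod (\<beta> \<mu>)) \<le> (\<Sum>z\<in>square_pairs K s. (real m * sqrt \<alpha> ^ m) ^ 2)"
        unfolding power2_eq_square
        by (intro sum_mono) (use \<alpha> in \<open>auto simp: square_pairs_def intro!: mult_mono b\<beta>\<close>)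
      also have "\<dots> = real (card (square_pairs K s)) * (real m ^ 2 * \<alpha> ^ m)" by (simp add: sm)
      also have "\<dots> \<le> (D0 * real N powr (real m - c)) * (real m ^ 2 * \<alpha> ^ m)"
      proof (rule mult_right_mono)
        have "card (square_pairs K s) \<le> card (unpaired_tuples m N)"
          unfolding K_def s_def J_def A_def by (rule card_square_pairs_le[OF m])
        thus "real (card (square_pairs K s)) \<le> D0 * real N powr (real m - c)" using D0(4)[OF N(1)] by linarith
      qed (use \<alpha> in auto)
      also have "\<dots> \<le> (D0 * (real l / \<alpha>) powr (real m - c)) * (real m ^ 2 * \<alpha> ^ m)"
        using N D0 m \<alpha> by (intro mult_right_mono mult_left_mono powr_mono2) auto
      also have "(real l / \<alpha>) powr (real m - c) = real l powr (real m - c) * \<alpha> powr (c - real m)"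
        using \<alpha> l by (simp add: powr_divide powr_diff)
      also have "(D0 * (real l powr (real m - c) * \<alpha> powr (c - real m))) * (real m ^ 2 * \<alpha> ^ m) =
         D0 * real m ^ 2 * real l powr (real m - c) * (\<alpha> powr (c - real m) * \<alpha> powr real m)"
        using \<alpha> by (simp add: powr_realpow mult_ac)
      also have "\<alpha> powr (c - real m) * \<alpha> powr real m = exp (- c * sqrt (real n))"
        unfolding powr_add[symmetric] by (simp add: \<alpha>_def grid_scale_def powr_def)
      finally have "(\<Sum>(\<kappa>,\<mu>)\<in>square_pairs K s. cmod (\<beta> \<kappa>) * cmod (\<beta> \<mu>)) \<le>
         D0 * real m ^ 2 * real l powr (real m - c) * exp (- c * sqrt (real n))" .
      hence "C * P * (\<Sum>(\<kappa>,\<mu>)\<in>square_pairs K s. cmod (\<beta> \<kappa>) * cmod (\<beta> \<mu>)) \<le>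
        C * P * (D0 * real m ^ 2 * real l powr (real m - c) * exp (- c * sqrt (real n)))"
        using C by (intro mult_left_mono) (auto simp: P_def)
      thus "C * P * (\<Sum>(\<kappa>,\<mu>)\<in>square_pairs K s. cmod (\<beta> \<kappa>) * cmod (\<beta> \<mu>)) \<le>
        C * D0 * real m ^ 2 * real l powr (real m - c) * exp (- c * sqrt (real n)) * P"
        by (simp only: mult_ac)
      have "card K \<le> card (PiE {..<m} (\<lambda>_. A))"
        using fA by (intro card_mono) (auto simp: K_def zero_sums_def intro: finite_PiE)
      also have "\<dots> = card A ^ m" by (simp add: card_PiE)
      also have "card A = 2 * N" by (simp add: A_def card_Diff_singleton nat_add_distrib nat_mult_distrib)
      finally have cK: "real (card K) \<le> real ((2 * N) ^ m)" by (simp only: of_nat_le_iff)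
      have "(\<Sum>\<kappa>\<in>K. cmod (\<beta> \<kappa>)) \<le> (\<Sum>\<kappa>\<in>K. real m * sqrt \<alpha> ^ m)" by (intro sum_mono b\<beta>)
      also have "\<dots> = real (card K) * (real m * sqrt \<alpha> ^ m)" by simp
      also have "\<dots> \<le> real ((2 * N) ^ m) * (real m * 1)"
        using \<alpha> cK by (intro mult_mono power_le_one) auto
      finally have s1: "(\<Sum>\<kappa>\<in>K. cmod (\<beta> \<kappa>)) \<le> real ((2 * N) ^ m) * real m" by simp
      have "real (N ^ m) ^ 2 * (\<Sum>\<kappa>\<in>K. cmod (\<beta> \<kappa>)) ^ 2 \<le> real (N ^ m) ^ 2 * (real ((2 * N) ^ m) * real m) ^ 2"
        by (intro mult_left_mono power_mono s1) (auto intro: sum_nonneg)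
      also have "\<dots> = real m ^ 2 * 4 ^ m * real N ^ (4 * m)"
      proof -
        have "(4::real) ^ m = (2 ^ m) ^ 2" by (simp add: power2_eq_square flip: power_mult_distrib)
        moreover have "real N ^ (4 * m) = (real N ^ m) ^ 4" by (simp add: mult.commute flip: power_mult)
        ultimately show ?thesis by (simp add: power_mult_distrib power2_eq_square power4_eq_xxxx mult_ac)
      qed
      also have "\<dots> \<le> real m ^ 2 * 4 ^ m * (real l / \<alpha>) ^ (4 * m)"
        using N by (intro mult_left_mono power_mono) auto
      also have "\<dots> = real m ^ 2 * 4 ^ m * real l ^ (4 * m) * exp (real (4 * m) * sqrt (real n))"
        by (simp add: \<alpha>_def grid_scale_def exp_minus divide_inverse power_mult_distrib exp_of_nat_mult[symmetric])
      finally have t: "real (N ^ m) ^ 2 * (\<Sum>\<kappa>\<in>K. cmod (\<beta> \<kappa>)) ^ 2 \<le>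
         real m ^ 2 * 4 ^ m * real l ^ (4 * m) * exp (real (4 * m) * sqrt (real n))" .
      \<comment> \<open>By hypothesis \<open>exp ((4 * m + 1) * sqrt n) \<le> Q powr (1/4)\<close>,
        so the left-hand side is at most \<open>Q powr (3/4) * exp (- sqrt n)\<close>. Chebyshev's
        bound and \<open>ln_le_4_root\<close> give \<open>Q powr (3/4) \<le> 16 * P\<close>, and
        \<open>c \<le> 1\<close> does the rest.\<close>
      have root: "sqrt (real Q) * exp (real (4 * m) * sqrt (real n)) \<le> 16 * (exp (- c * sqrt (real n)) * P)"
      proof -
        have "exp (real (4 * m) * sqrt (real n)) * exp (sqrt (real n)) = exp (real (4 * m + 1) * sqrt (real n))"
          by (simp add: exp_add[symmetric] algebra_simps)
        also have "\<dots> \<le> exp (ln (real Q) / 4)" using nQ by (simp add: algebra_simps)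
        also have "\<dots> = real Q powr (1/4)" using Q3 by (simp add: powr_def)
        finally have e1: "exp (real (4 * m) * sqrt (real n)) * exp (sqrt (real n)) \<le> real Q powr (1/4)" .
        have "real Q / (4 * ln (real Q)) \<le> P" using Q2[of Q] Q by (simp add: P_def)
        moreover have "real Q / (4 * (4 * real Q powr (1/4))) \<le> real Q / (4 * ln (real Q))"
          using Q3 ln_le_4_root[of "real Q"] by (intro divide_left_mono) auto
        moreover have "real Q / real Q powr (1/4) = sqrt (real Q) * real Q powr (1/4)"
        proof -
          have "sqrt (real Q) * real Q powr (1/4) * real Q powr (1/4) = real Q"
            using Q3 by (simp add: powr_half_sqrt[symmetric] flip: powr_add)
          thus ?thesis using Q3 by (simp add: nonzero_divide_eq_eq)
        qed
        ultimately have e2: "sqrt (real Q) * real Q powr (1/4) \<le> 16 * P" by simp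
        have "sqrt (real Q) * exp (real (4 * m) * sqrt (real n)) =
          sqrt (real Q) * (exp (real (4 * m) * sqrt (real n)) * exp (sqrt (real n))) * exp (- sqrt (real n))"
          by (simp add: exp_minus)
        also have "\<dots> \<le> sqrt (real Q) * real Q powr (1/4) * exp (- sqrt (real n))"
          by (intro mult_right_mono mult_left_mono e1) auto
        also have "\<dots> \<le> 16 * P * exp (- c * sqrt (real n))"
        proof (rule mult_mono[OF e2])
          have "c * sqrt (real n) \<le> 1 * sqrt (real n)" using D0 by (intro mult_right_mono) auto
          thus "exp (- sqrt (real n)) \<le> exp (- c * sqrt (real n))" by simp
        qed (auto simp: P_def)
        finally show ?thesis by (simp add: mult_ac)
      qed
      have "C * sqrt (real Q) * real (N ^ m) ^ 2 * (\<Sum>\<kappa>\<in>K. cmod (\<beta> \<kappa>)) ^ 2 =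
        C * sqrt (real Q) * (real (N ^ m) ^ 2 * (\<Sum>\<kappa>\<in>K. cmod (\<beta> \<kappa>)) ^ 2)" by (simp only: mult_ac)
      also have "\<dots> \<le> C * sqrt (real Q) * (real m ^ 2 * 4 ^ m * real l ^ (4 * m) * exp (real (4 * m) * sqrt (real n)))"
        using C by (intro mult_left_mono t) auto
      also have "\<dots> = C * (real m ^ 2 * 4 ^ m * real l ^ (4 * m)) * (sqrt (real Q) * exp (real (4 * m) * sqrt (real n)))"
        by (simp only: mult_ac)
      also have "\<dots> \<le> C * (real m ^ 2 * 4 ^ m * real l ^ (4 * m)) * (16 * (exp (- c * sqrt (real n)) * P))"
        using C by (intro mult_left_mono root) auto
      finally show "C * sqrt (real Q) * real (N ^ m) ^ 2 * (\<Sum>\<kappa>\<in>K. cmod (\<beta> \<kappa>)) ^ 2 \<le>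
        16 * C * real m ^ 2 * 4 ^ m * real l ^ (4 * m) * exp (- c * sqrt (real n)) * P"
        by (simp only: mult_ac)
    qed
    also have "\<dots> = D * exp (- c * sqrt (real n)) * P" by (simp add: D_def algebra_simps)
    finally show "(\<Sum>q\<in>primes_dyadic Q. (defect l n m q)\<^sup>2) \<le> D * exp (- c * sqrt (real n)) * real (card (primes_dyadic Q))"
      by (simp add: P_def)
  qed
qed

text \<open>A single level \<open>l\<close> fixes the truncation of the Fourier series, the range of
  moments and the tolerance, so that only one parameter has to tend to infinity.\<close>

definition typical :: "nat \<Rightarrow> nat \<Rightarrow> nat \<Rightarrow> bool" where
  "typical l n q \<longleftrightarrow> (\<forall>m\<in>{2..l}. defect l n m q \<le> 1 / real l)"

text \<open>Chebyshev's inequality applied to \<open>defect_mean_square\<close> for each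
  \<open>m \<le> l\<close>. For every \<open>c > 0\<close> the decay
  \<open>exp (- c * sqrt n)\<close> beats \<open>exp (- n powr (3/8))\<close> by any power of
  \<open>n\<close>; the factor \<open>1 / n ^ 3\<close> pays for a later union over levels and grid
  points.\<close>

theorem card_atypical_primes:
  assumes l: "l \<ge> 1"
  shows "\<exists>A. \<forall>n Q. n \<ge> A \<longrightarrow> Q \<ge> A \<longrightarrow> ln (real Q) \<ge> real A * sqrt (real n) \<longrightarrow>
    real (card {q \<in> primes_dyadic Q. \<not> typical l n q}) \<le>
      exp (- (real n powr (3/8))) / real n ^ 3 * real (card (primes_dyadic Q))"
proof -
  have "\<exists>D c Q0. D > 0 \<and> c > 0 \<and> (\<forall>n Q. Q \<ge> Q0 \<longrightarrow> ln (real Q) \<ge> real (4 * (4 * m + 1)) * sqrt (real n) \<longrightarrow>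
     (\<Sum>q\<in>primes_dyadic Q. (defect l n m q)\<^sup>2) \<le> D * exp (- c * sqrt (real n)) * real (card (primes_dyadic Q)))"
    if "m \<in> {2..l}" for m
    using defect_mean_square[OF l, of m] that by auto
  then obtain D c Q0 where D: "\<And>m. m \<in> {2..l} \<Longrightarrow> D m > 0" and c: "\<And>m. m \<in> {2..l} \<Longrightarrow> c m > 0"
    and ms: "\<And>m n Q. m \<in> {2..l} \<Longrightarrow> Q \<ge> Q0 m \<Longrightarrow> ln (real Q) \<ge> real (4 * (4 * m + 1)) * sqrt (real n) \<Longrightarrow>
     (\<Sum>q\<in>primes_dyadic Q. (defect l n m q)\<^sup>2) \<le> D m * exp (- c m * sqrt (real n)) * real (card (primes_dyadic Q))"
    by metis
  \<comment> \<open>The factor \<open>l ^ 2\<close> comes from the tolerance \<open>1 / l\<close> in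
    Chebyshev's inequality, the other \<open>l\<close> from the union over \<open>m\<close>.\<close>
  have "eventually (\<lambda>n::nat. \<forall>m\<in>{2..l}. real l * (real l ^ 2 * (D m * exp (- c m * sqrt (real n)))) \<le>
     exp (- (real n powr (3/8))) / real n ^ 3) sequentially"
  proof (intro eventually_ball_finite ballI)
    fix m assume m: "m \<in> {2..l}"
    define c' D' where "c' = c m" and "D' = real l * (real l ^ 2 * D m)"
    have c': "c' > 0" using c[OF m] by (simp add: c'_def)
    have D': "D' > 0" using D[OF m] l by (simp add: D'_def)
    have "eventually (\<lambda>n::nat. D' * exp (- c' * sqrt (real n)) \<le> exp (- (real n powr (3/8))) / real n ^ 3) sequentially"
      using c' D' by real_asymp
    thus "eventually (\<lambda>n::nat. real l * (real l ^ 2 * (D m * exp (- c m * sqrt (real n)))) \<le>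
     exp (- (real n powr (3/8))) / real n ^ 3) sequentially"
      by (simp add: c'_def D'_def mult_ac)
  qed simp
  then obtain A0 where "\<forall>n\<ge>A0. \<forall>m\<in>{2..l}. real l * (real l ^ 2 * (D m * exp (- c m * sqrt (real n)))) \<le>
     exp (- (real n powr (3/8))) / real n ^ 3"
    unfolding eventually_sequentially by blast
  hence A0: "real l * (real l ^ 2 * (D m * exp (- c m * sqrt (real n)))) \<le> exp (- (real n powr (3/8))) / real n ^ 3" if "n \<ge> A0" "m \<in> {2..l}" for n m
    using that by blast
  \<comment> \<open>\<open>4 * (4 * l + 1)\<close> dominates the constants required by
    \<open>defect_mean_square\<close> for all \<open>m \<le> l\<close>.\<close>
  define A where "A = max (max A0 (4 * (4 * l + 1))) (Max (insert 0 (Q0 ` {2..l})))"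
  show ?thesis
  proof (intro exI[of _ A] allI impI)
    fix n Q :: nat assume n: "n \<ge> A" and Q: "Q \<ge> A" and nQ: "ln (real Q) \<ge> real A * sqrt (real n)"
    define P where "P = real (card (primes_dyadic Q))"
    define E where "E = exp (- (real n powr (3/8))) / real n ^ 3"
    define B where "B m = {q \<in> primes_dyadic Q. defect l n m q > 1 / real l}" for m
    have lB: "real l * real (card (B m)) \<le> E * P" if m: "m \<in> {2..l}" for m
    proof -
      have "Q0 m \<le> Max (insert 0 (Q0 ` {2..l}))" using m by (intro Max_ge) auto
      also have "\<dots> \<le> A" unfolding A_def by (rule max.cobounded2)
      finally have QQ: "Q \<ge> Q0 m" using Q by linarith
      have "4 * (4 * m + 1) \<le> A" using m by (auto simp: A_def)
      hence "real (4 * (4 * m + 1)) * sqrt (real n) \<le> real A * sqrt (real n)" by (intro mult_right_mono) (auto simp only: of_nat_le_iff, auto)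
      hence "ln (real Q) \<ge> real (4 * (4 * m + 1)) * sqrt (real n)" using nQ by linarith
      note MS = ms[OF m QQ this]
      have "real (card (B m)) * (1 / real l) ^ 2 = (\<Sum>q\<in>B m. (1 / real l)\<^sup>2)" by simp
      also have "\<dots> \<le> (\<Sum>q\<in>B m. (defect l n m q)\<^sup>2)" by (intro sum_mono power_mono) (auto simp: B_def)
      also have "\<dots> \<le> (\<Sum>q\<in>primes_dyadic Q. (defect l n m q)\<^sup>2)" by (intro sum_mono2) (auto simp: B_def)
      also note MS
      finally have "real (card (B m)) \<le> real l ^ 2 * (D m * exp (- c m * sqrt (real n)) * P)"
        using l by (simp add: P_def power_divide field_simps)
      hence "real l * real (card (B m)) \<le> real l * (real l ^ 2 * (D m * exp (- c m * sqrt (real n)) * P))"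
        by (intro mult_left_mono) auto
      also have "\<dots> = (real l * (real l ^ 2 * (D m * exp (- c m * sqrt (real n))))) * P" by (simp only: mult_ac)
      also have "\<dots> \<le> E * P"
        unfolding E_def by (intro mult_right_mono A0 m) (use n in \<open>auto simp: A_def P_def\<close>)
      finally show ?thesis .
    qed
    have "{q \<in> primes_dyadic Q. \<not> typical l n q} = (\<Union>m\<in>{2..l}. B m)"
      by (auto simp: typical_def B_def not_le)
    hence "card {q \<in> primes_dyadic Q. \<not> typical l n q} \<le> (\<Sum>m\<in>{2..l}. card (B m))"
      by (simp add: card_UN_le)
    hence "real l * real (card {q \<in> primes_dyadic Q. \<not> typical l n q}) \<le> real l * real (\<Sum>m\<in>{2..l}. card (B m))"
      by (intro mult_left_mono) (auto simp only: of_nat_le_iff)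
    also have "\<dots> = (\<Sum>m\<in>{2..l}. real l * real (card (B m)))" by (simp add: sum_distrib_left)
    also have "\<dots> \<le> (\<Sum>m\<in>{2..l}. E * P)" by (intro sum_mono lB)
    also have "\<dots> = real (l - 1) * (E * P)" by simp
    also have "\<dots> \<le> real l * (E * P)" by (intro mult_right_mono) (auto simp: E_def P_def)
    finally have "real (card {q \<in> primes_dyadic Q. \<not> typical l n q}) \<le> E * P"
      by (rule mult_left_le_imp_le) (use l in simp)
    thus "real (card {q \<in> primes_dyadic Q. \<not> typical l n q}) \<le>
      exp (- (real n powr (3/8))) / real n ^ 3 * real (card (primes_dyadic Q))"
      by (simp add: E_def P_def)
  qed
qed

section \<open>Fourier expansion of the short sums\<close>

definition avg :: "nat \<Rightarrow> (int \<Rightarrow> 'a::real_normed_field) \<Rightarrow> 'a" where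
  "avg q f = (\<Sum>x\<in>{0..<int q}. f x) / of_nat q"

lemma parseval:
  assumes q: "q > 0" and A: "finite A"
    and inj: "\<And>k l. k \<in> A \<Longrightarrow> l \<in> A \<Longrightarrow> int q dvd k - l \<Longrightarrow> k = l"
  shows "(\<Sum>x\<in>{0..<int q}. cmod (\<Sum>k\<in>A. d k * wave q (k * x)) ^ 2) = real q * (\<Sum>k\<in>A. cmod (d k) ^ 2)"
proof -
  have "complex_of_real (\<Sum>x\<in>{0..<int q}. cmod (\<Sum>k\<in>A. d k * wave q (k * x)) ^ 2) =
    (\<Sum>x\<in>{0..<int q}. (\<Sum>k\<in>A. d k * wave q (k * x)) * cnj (\<Sum>k\<in>A. d k * wave q (k * x)))"
    by (simp only: of_real_sum complex_norm_square)
  also have "\<dots> = (\<Sum>x\<in>{0..<int q}. \<Sum>k\<in>A. \<Sum>l\<in>A. (d k * cnj (d l)) * wave q ((k - l) * x))"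
  proof (intro sum.cong refl)
    fix x
    have w: "wave q ((k - l) * x) = wave q (k * x) * cnj (wave q (l * x))" for k l
      using wave_add[of q "k * x" "- (l * x)"] wave_minus[of q "l * x"] by (simp add: left_diff_distrib)
    show "(\<Sum>k\<in>A. d k * wave q (k * x)) * cnj (\<Sum>k\<in>A. d k * wave q (k * x)) =
      (\<Sum>k\<in>A. \<Sum>l\<in>A. (d k * cnj (d l)) * wave q ((k - l) * x))"
      unfolding w by (simp add: sum_product mult_ac)
  qed
  also have "\<dots> = (\<Sum>k\<in>A. \<Sum>x\<in>{0..<int q}. \<Sum>l\<in>A. (d k * cnj (d l)) * wave q ((k - l) * x))"
    by (rule sum.swap)
  also have "\<dots> = (\<Sum>k\<in>A. \<Sum>l\<in>A. \<Sum>x\<in>{0..<int q}. (d k * cnj (d l)) * wave q ((k - l) * x))"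
    by (intro sum.cong refl sum.swap)
  also have "\<dots> = (\<Sum>k\<in>A. \<Sum>l\<in>A. (d k * cnj (d l)) * (\<Sum>x\<in>{0..<int q}. wave q ((k - l) * x)))"
    by (simp only: sum_distrib_left)
  also have "\<dots> = (\<Sum>k\<in>A. \<Sum>l\<in>A. if l = k then of_nat q * (d k * cnj (d k)) else 0)"
  proof (intro sum.cong refl)
    fix k l assume "k \<in> A" "l \<in> A"
    hence "int q dvd k - l \<longleftrightarrow> l = k" using inj[of k l] by auto
    thus "(d k * cnj (d l)) * (\<Sum>x\<in>{0..<int q}. wave q ((k - l) * x)) =
      (if l = k then of_nat q * (d k * cnj (d k)) else 0)" unfolding sum_wave[OF q] by simp
  qed
  also have "\<dots> = complex_of_real (real q * (\<Sum>k\<in>A. cmod (d k) ^ 2))"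
    using A by (simp add: sum_distrib_left complex_norm_square[symmetric])
  finally show ?thesis by (simp only: of_real_eq_iff)
qed

definition gauss_sum :: "nat \<Rightarrow> complex" where
  "gauss_sum q = (\<Sum>x\<in>{0..<int q}. of_int (Legendre x q) * wave q x)"

lemma periodic_Legendre: "periodic (\<lambda>x. of_int (Legendre x (int q))) q"
  by (auto simp: periodic_def intro!: arg_cong[of _ _ of_int] Legendre_cong) (simp add: cong_def)

lemma periodic_wave: "q > 0 \<Longrightarrow> periodic (\<lambda>x. wave q (k * x)) q"
  using wave_period[of q k] by (simp add: periodic_def distrib_left wave_add mult.commute)

lemma Legendre_squared:
  assumes "\<not> int q dvd k"
  shows "Legendre k q * Legendre k q = 1"
  using assms Legendre_values[of k q] by (auto simp: Legendre_def cong_0_iff)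

lemma sum_Legendre:
  assumes q: "prime q" "q > 2"
  shows "(\<Sum>x\<in>{0..<int q}. of_int (Legendre x q)) = (0::complex)"
proof -
  obtain r where r: "Legendre r q = -1" using exists_nonresidue[OF q] by blast
  have "\<not> int q dvd r" using r by (auto simp: Legendre_def cong_0_iff)
  hence cop: "coprime r (int q)" using q(1) prime_imp_coprime[of "int q" r] by (simp add: coprime_commute)
  have "(\<Sum>x\<in>{0..<int q}. of_int (Legendre x q)) = (\<Sum>x\<in>{0..<int q}. complex_of_int (Legendre (r * x) q))"
    by (rule sum_periodic_coprime[OF periodic_Legendre _ cop, symmetric]) (use q in auto)
  also have "\<dots> = - (\<Sum>x\<in>{0..<int q}. of_int (Legendre x q))"
    by (simp add: Legendre_mult[OF q] r sum_negf)
  finally show ?thesis by simp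
qed

lemma gauss_sum_twist:
  assumes q: "prime q" "q > 2"
  shows "(\<Sum>x\<in>{0..<int q}. of_int (Legendre x q) * wave q (k * x)) = of_int (Legendre k q) * gauss_sum q"
proof (cases "int q dvd k")
  case True
  hence "wave q (k * x) = 1" for x using wave_eq_1_iff[of q "k * x"] q by simp
  moreover have "Legendre k q = 0" using True by (simp add: Legendre_def cong_0_iff)
  ultimately show ?thesis using sum_Legendre[OF q] by simp
next
  case False
  hence cop: "coprime k (int q)" using q(1) prime_imp_coprime[of "int q" k] by (simp add: coprime_commute)
  have per: "periodic (\<lambda>x. of_int (Legendre x q) * wave q x) q"
    using periodic_mult[OF periodic_Legendre[where 'a = complex, of q] periodic_wave[of q 1]] q by simp
  have "gauss_sum q = (\<Sum>x\<in>{0..<int q}. of_int (Legendre (k * x) q) * wave q (k * x))"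
    unfolding gauss_sum_def by (rule sum_periodic_coprime[OF per _ cop, symmetric]) (use q in auto)
  also have "\<dots> = of_int (Legendre k q) * (\<Sum>x\<in>{0..<int q}. of_int (Legendre x q) * wave q (k * x))"
    by (simp add: Legendre_mult[OF q] sum_distrib_left mult_ac)
  finally have "of_int (Legendre k q) * gauss_sum q =
    of_int (Legendre k q * Legendre k q) * (\<Sum>x\<in>{0..<int q}. of_int (Legendre x q) * wave q (k * x))"
    by (simp add: mult_ac)
  thus ?thesis by (simp add: Legendre_squared[OF False])
qed

lemma sum_Legendre_norm_square:
  assumes q: "q > 0"
  shows "(\<Sum>x\<in>{0..<int q}. (real_of_int (Legendre x q))\<^sup>2) = real q - 1"
proof -
  have "(\<Sum>x\<in>{0..<int q}. (real_of_int (Legendre x q))\<^sup>2) = (\<Sum>x\<in>{0..<int q}. if x = 0 then 0 else 1)"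
  proof (intro sum.cong refl)
    fix x assume x: "x \<in> {0..<int q}"
    have "real_of_int (Legendre x q * Legendre x q) = 1" if "x \<noteq> 0"
    proof -
      have "\<not> int q dvd x" using x that zdvd_not_zless[of x "int q"] by auto
      thus ?thesis by (metis Legendre_squared of_int_1)
    qed
    thus "(real_of_int (Legendre x q))\<^sup>2 = (if x = 0 then 0 else 1)"
      by (auto simp: power2_eq_square Legendre_def[of 0])
  qed
  also have "\<dots> = (\<Sum>x\<in>{0..<int q}. 1) - (\<Sum>x\<in>{0..<int q}. if x = 0 then 1 else 0)"
    unfolding sum_subtractf[symmetric] by (intro sum.cong) auto
  also have "\<dots> = real q - 1" using q by simp
  finally show ?thesis .
qed

text \<open>By \<open>gauss_sum_twist\<close> the transform of the Legendre symbol is a multiple of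
  the symbol itself, so Parseval's identity compares the same sum \<open>q - 1\<close> on both
  sides.\<close>

lemma norm_gauss_sum:
  assumes q: "prime q" "q > 2"
  shows "cmod (gauss_sum q) ^ 2 = real q"
proof -
  have q0: "q > 0" using q by simp
  have "(\<Sum>k\<in>{0..<int q}. cmod (\<Sum>x\<in>{0..<int q}. of_int (Legendre x q) * wave q (x * k)) ^ 2) =
    real q * (\<Sum>x\<in>{0..<int q}. cmod (of_int (Legendre x q)) ^ 2)"
  proof (rule parseval[OF q0])
    fix k l assume "k \<in> {0..<int q}" "l \<in> {0..<int q}" "int q dvd k - l"
    thus "k = l" using zdvd_imp_le[of "int q" "\<bar>k - l\<bar>"] by (cases "k = l") auto
  qed auto
  moreover have "(\<Sum>x\<in>{0..<int q}. of_int (Legendre x q) * wave q (x * k)) = of_int (Legendre k q) * gauss_sum q" for k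
    using gauss_sum_twist[OF q, of k] by (simp add: mult.commute[of _ k])
  ultimately have "(\<Sum>k\<in>{0..<int q}. (real_of_int (Legendre k q))\<^sup>2) * cmod (gauss_sum q) ^ 2 =
     real q * (\<Sum>x\<in>{0..<int q}. (real_of_int (Legendre x q))\<^sup>2)"
    by (simp add: norm_mult power_mult_distrib sum_distrib_right)
  hence "(real q - 1) * cmod (gauss_sum q) ^ 2 = real q * (real q - 1)"
    by (simp add: sum_Legendre_norm_square[OF q0])
  thus ?thesis using q by simp
qed

lemma cnj_gauss_sum:
  assumes q: "prime q" "q > 2"
  shows "cnj (gauss_sum q) = of_int (Legendre (-1) q) * gauss_sum q"
proof -
  have "cnj (gauss_sum q) = (\<Sum>x\<in>{0..<int q}. of_int (Legendre x q) * wave q ((-1) * x))"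
    by (simp add: gauss_sum_def wave_minus)
  thus ?thesis using gauss_sum_twist[OF q, of "-1"] by simp
qed

text \<open>The sign of the quadratic Gauss sum, up to conjugation; only \<open>|w| = 1\<close> and
  \<open>cnj w = (-1/q) w\<close> matter.\<close>

definition gauss_phase :: "nat \<Rightarrow> complex" where
  "gauss_phase q = cnj (gauss_sum q) / of_real (sqrt (real q))"

lemma norm_gauss_phase:
  assumes q: "prime q" "q > 2"
  shows "cmod (gauss_phase q) = 1"
proof -
  have "cmod (gauss_sum q) = sqrt (real q)"
    using norm_gauss_sum[OF q] by (metis norm_ge_zero real_sqrt_unique)
  thus ?thesis using q by (simp add: gauss_phase_def norm_divide)
qed

lemma cnj_gauss_phase:
  assumes q: "prime q" "q > 2"
  shows "cnj (gauss_phase q) = gauss_phase q * of_int (Legendre (-1) q)"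
proof -
  have "\<not> int q dvd -1" using q by simp
  hence "Legendre (-1) q * Legendre (-1) q = 1" by (rule Legendre_squared)
  hence "complex_of_int (Legendre (-1) q) * of_int (Legendre (-1) q) = 1" by (metis of_int_1 of_int_mult)
  thus ?thesis using cnj_gauss_sum[OF q] by (simp add: gauss_phase_def mult_ac)
qed

definition residues_sym :: "nat \<Rightarrow> int set" where
  "residues_sym q = {- int (q div 2)..int (q div 2)}"

lemma residues_sym_inj:
  assumes "odd q" "k \<in> residues_sym q" "l \<in> residues_sym q" "int q dvd k - l"
  shows "k = l"
proof (rule ccontr)
  assume "k \<noteq> l"
  hence "int q \<le> \<bar>k - l\<bar>" using assms(4) zdvd_imp_le[of "int q" "\<bar>k - l\<bar>"] by auto
  moreover have "q = 2 * (q div 2) + 1" using assms(1) by simp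
  ultimately show False using assms(2,3) unfolding residues_sym_def by auto
qed

lemma sum_residues_sym:
  fixes F :: "int \<Rightarrow> 'a::comm_monoid_add"
  assumes "odd q" "periodic F q"
  shows "(\<Sum>k\<in>residues_sym q. F k) = (\<Sum>k\<in>{0..<int q}. F k)"
proof -
  have "q = 2 * (q div 2) + 1" using assms(1) by simp
  hence "residues_sym q = {- int (q div 2)..<- int (q div 2) + int q}"
    unfolding residues_sym_def by auto
  thus ?thesis using sum_periodic_shift[OF assms(2), of "- int (q div 2)"] assms(1) by (simp add: odd_pos)
qed

lemma Legendre_fourier:
  assumes q: "prime q" "q > 2"
  shows "of_int (Legendre n q) = gauss_phase q / of_real (sqrt (real q)) *
     (\<Sum>k\<in>residues_sym q. of_int (Legendre k q) * wave q (k * n))"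
proof -
  have odd: "odd q" using q prime_odd_nat by auto
  have per: "periodic (\<lambda>k. of_int (Legendre k q) * wave q (k * n)) q"
    using periodic_mult[OF periodic_Legendre[where 'a = complex, of q] periodic_wave[of q n]] q
    by (simp add: mult.commute)
  have "(\<Sum>k\<in>residues_sym q. of_int (Legendre k q) * wave q (k * n)) = of_int (Legendre n q) * gauss_sum q"
    unfolding sum_residues_sym[OF odd per] using gauss_sum_twist[OF q, of n] by (simp add: mult.commute)
  moreover have "gauss_phase q / of_real (sqrt (real q)) * gauss_sum q = 1"
  proof -
    have "cnj (gauss_sum q) * gauss_sum q = of_real (real q)"
      using norm_gauss_sum[OF q] complex_norm_square[of "gauss_sum q"] by (simp add: mult.commute)
    moreover have "of_real (sqrt (real q)) * of_real (sqrt (real q)) = complex_of_real (real q)"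
      by (simp flip: of_real_mult)
    ultimately show ?thesis using q by (simp add: gauss_phase_def field_simps)
  qed
  ultimately show ?thesis by (simp add: mult.left_commute)
qed

text \<open>The exact Fourier coefficient of the normalised short sum, stripped of the Gauss phase
  and the Legendre symbol; \<open>sqrt H\<close> is the normalisation and \<open>sqrt q\<close> the
  modulus of the Gauss sum.\<close>

definition sharp_coef :: "nat \<Rightarrow> real \<Rightarrow> int \<Rightarrow> complex" where
  "sharp_coef q H k = (\<Sum>j=1..nat \<lfloor>H\<rfloor>. wave q (k * int j)) / of_real (sqrt (H * real q))"

definition normalized_sum :: "nat \<Rightarrow> real \<Rightarrow> int \<Rightarrow> real" where
  "normalized_sum q H x = real_of_int (short_sum (\<lambda>n. Legendre n (int q)) H x) / sqrt H"

lemma short_sum_shift: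
  assumes "H \<ge> 0"
  shows "short_sum f H x = (\<Sum>j=1..nat \<lfloor>H\<rfloor>. f (x + int j))"
  unfolding short_sum_altdef
  by (rule sum.reindex_bij_witness[of _ "\<lambda>j. x + int j" "\<lambda>n. nat (n - x)"]) (use assms in \<open>auto simp: nat_le_iff\<close>)

lemma normalized_sum_fourier:
  assumes q: "prime q" "q > 2" and H: "H \<ge> 1"
  shows "of_real (normalized_sum q H x) =
    (\<Sum>k\<in>residues_sym q. (gauss_phase q * of_int (Legendre k q) * sharp_coef q H k) * wave q (k * x))"
proof -
  define s where "s = complex_of_real (sqrt (real q))"
  define t where "t = complex_of_real (sqrt H)"
  have st: "of_real (sqrt (H * real q)) = t * s" by (simp add: s_def t_def real_sqrt_mult)
  have nz: "s \<noteq> 0" "t \<noteq> 0" using q H by (auto simp: s_def t_def)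
  have "of_real (normalized_sum q H x) = (\<Sum>j=1..nat \<lfloor>H\<rfloor>. of_int (Legendre (x + int j) q)) / t"
    using H by (simp add: normalized_sum_def short_sum_shift t_def)
  also have "(\<Sum>j=1..nat \<lfloor>H\<rfloor>. of_int (Legendre (x + int j) q)) =
     (\<Sum>j=1..nat \<lfloor>H\<rfloor>. \<Sum>k\<in>residues_sym q. gauss_phase q / s * (of_int (Legendre k q) * (wave q (k * x) * wave q (k * int j))))"
    unfolding Legendre_fourier[OF q, of "x + int j" for j] s_def[symmetric]
    by (simp add: sum_distrib_left distrib_left wave_add)
  also have "\<dots> = (\<Sum>k\<in>residues_sym q. \<Sum>j=1..nat \<lfloor>H\<rfloor>. gauss_phase q / s * (of_int (Legendre k q) * (wave q (k * x) * wave q (k * int j))))"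
    by (rule sum.swap)
  also have "\<dots> / t = (\<Sum>k\<in>residues_sym q. (gauss_phase q * of_int (Legendre k q) * sharp_coef q H k) * wave q (k * x))"
    unfolding sum_divide_distrib
  proof (intro sum.cong refl)
    fix k
    have "(\<Sum>j=1..nat \<lfloor>H\<rfloor>. gauss_phase q / s * (of_int (Legendre k q) * (wave q (k * x) * wave q (k * int j))) / t) =
      gauss_phase q / s * (of_int (Legendre k q) * wave q (k * x)) / t * (\<Sum>j=1..nat \<lfloor>H\<rfloor>. wave q (k * int j))"
      by (simp add: sum_distrib_left sum_divide_distrib mult_ac)
    also have "\<dots> = (gauss_phase q * of_int (Legendre k q) * sharp_coef q H k) * wave q (k * x)"
      unfolding sharp_coef_def st using nz by (simp add: field_simps)
    finally show "(\<Sum>j=1..nat \<lfloor>H\<rfloor>. gauss_phase q / s * (of_int (Legendre k q) * (wave q (k * x) * wave q (k * int j))) / t) =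
      (gauss_phase q * of_int (Legendre k q) * sharp_coef q H k) * wave q (k * x)" .
  qed
  finally show ?thesis .
qed

lemma norm_Legendre_residues_sym:
  assumes "odd q" "k \<in> residues_sym q" "k \<noteq> 0"
  shows "cmod (of_int (Legendre k q)) = 1"
proof -
  have "\<not> int q dvd k" using residues_sym_inj[OF assms(1,2), of 0] assms by (auto simp: residues_sym_def)
  hence "Legendre k q = 1 \<or> Legendre k q = -1"
    using Legendre_squared[of q k] Legendre_values[of k q] by auto
  thus ?thesis by auto
qed

text \<open>Parseval's identity is used twice. It turns the second moment into the sum of squared
  coefficients over \<open>k \<noteq> 0\<close>, where symbol and phase have modulus 1, and it
  evaluates the same sum over all \<open>k\<close>. The missing frequency 0 accounts for the
  subtracted term.\<close>

lemma normalized_sum_second_moment: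
  assumes q: "prime q" "q > 2" and H: "H \<ge> 1" "H \<le> real q"
  shows "avg q (\<lambda>x. (normalized_sum q H x)\<^sup>2) = of_int \<lfloor>H\<rfloor> / H - (of_int \<lfloor>H\<rfloor>)\<^sup>2 / (H * real q)"
proof -
  have odd: "odd q" using q prime_odd_nat by auto
  have q0: "q > 0" using q by simp
  define h where "h = nat \<lfloor>H\<rfloor>"
  have h: "real h = of_int \<lfloor>H\<rfloor>" "h \<le> q" using H by (auto simp: h_def nat_le_iff floor_le_iff)
  have fin: "finite (residues_sym q)" by (simp add: residues_sym_def)
  have "(\<Sum>x\<in>{0..<int q}. (normalized_sum q H x)\<^sup>2) =
    (\<Sum>x\<in>{0..<int q}. cmod (of_real (normalized_sum q H x)) ^ 2)" by simp
  also have "\<dots> = real q * (\<Sum>k\<in>residues_sym q. cmod (gauss_phase q * of_int (Legendre k q) * sharp_coef q H k) ^ 2)"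
    unfolding normalized_sum_fourier[OF q H(1)]
    by (rule parseval[OF q0 fin]) (use residues_sym_inj[OF odd] in blast)
  also have "(\<Sum>k\<in>residues_sym q. cmod (gauss_phase q * of_int (Legendre k q) * sharp_coef q H k) ^ 2) =
    (\<Sum>k\<in>residues_sym q - {0}. cmod (sharp_coef q H k) ^ 2)"
  proof -
    have "(\<Sum>k\<in>residues_sym q. cmod (gauss_phase q * of_int (Legendre k q) * sharp_coef q H k) ^ 2) =
      (\<Sum>k\<in>residues_sym q - {0}. cmod (gauss_phase q * of_int (Legendre k q) * sharp_coef q H k) ^ 2)"
      by (rule sum.mono_neutral_right) (use fin in \<open>auto simp: Legendre_def\<close>)
    also have "\<dots> = (\<Sum>k\<in>residues_sym q - {0}. cmod (sharp_coef q H k) ^ 2)"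
      by (intro sum.cong refl)
         (use norm_Legendre_residues_sym[OF odd] norm_gauss_phase[OF q] in \<open>auto simp: norm_mult\<close>)
    finally show ?thesis .
  qed
  also have "\<dots> = (\<Sum>k\<in>residues_sym q. cmod (sharp_coef q H k) ^ 2) - cmod (sharp_coef q H 0) ^ 2"
    using fin by (subst (2) sum.remove[of _ 0]) (auto simp: residues_sym_def)
  also have "(\<Sum>k\<in>residues_sym q. cmod (sharp_coef q H k) ^ 2) = real h / H"
  proof -
    have per: "periodic (\<lambda>k. cmod (sharp_coef q H k) ^ 2) q"
    proof -
      have "wave q ((k + int q) * int j) = wave q (k * int j)" for k j
        using wave_period[OF q0, of "int j"] by (simp add: distrib_right wave_add)
      thus ?thesis by (simp add: periodic_def sharp_coef_def)
    qed
    have "(\<Sum>k\<in>residues_sym q. cmod (sharp_coef q H k) ^ 2) = (\<Sum>k\<in>{0..<int q}. cmod (sharp_coef q H k) ^ 2)"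
      by (rule sum_residues_sym[OF odd per])
    also have "\<dots> = (\<Sum>k\<in>{0..<int q}. cmod (\<Sum>j\<in>int ` {1..h}. 1 * wave q (j * k)) ^ 2) / (H * real q)"
    proof -
      have "(\<Sum>j=1..h. wave q (k * int j)) = (\<Sum>j\<in>int ` {1..h}. 1 * wave q (j * k))" for k
        by (subst sum.reindex) (auto simp: mult.commute)
      moreover have "(sqrt (H * real q))\<^sup>2 = H * real q" using H by simp
      moreover have "\<bar>sqrt (H * real q)\<bar> = sqrt (H * real q)" using H by simp
      ultimately show ?thesis
        unfolding sum_divide_distrib[of _ "{0..<int q}"]
        by (intro sum.cong refl) (simp add: sharp_coef_def h_def norm_divide power_divide)
    qed
    also have "(\<Sum>k\<in>{0..<int q}. cmod (\<Sum>j\<in>int ` {1..h}. 1 * wave q (j * k)) ^ 2) = real q * (\<Sum>j\<in>int ` {1..h}. cmod 1 ^ 2)"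
    proof (rule parseval[OF q0])
      fix k l assume kl: "k \<in> int ` {1..h}" "l \<in> int ` {1..h}" "int q dvd k - l"
      have "\<bar>k - l\<bar> < int q" using kl(1,2) h(2) by auto
      thus "k = l" using kl(3) zdvd_imp_le[of "int q" "\<bar>k - l\<bar>"] by (cases "k = l") auto
    qed auto
    also have "(\<Sum>j\<in>int ` {1..h}. cmod 1 ^ 2) = real h" by (simp add: card_image)
    finally show ?thesis using q0 by simp
  qed
  also have "cmod (sharp_coef q H 0) ^ 2 = (real h)\<^sup>2 / (H * real q)"
    using H by (simp add: sharp_coef_def h_def norm_divide power_divide)
  finally show ?thesis using q0 by (simp add: avg_def h)
qed

section \<open>Riemann sums and truncation of the Fourier series\<close>

definition arc_integral :: "int \<Rightarrow> real \<Rightarrow> complex" where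
  "arc_integral k u = (cis (2 * pi * of_int k * u) - 1) / (2 * pi * \<i> * of_int k)"

lemma coef_arc_integral: "coef \<alpha> k = arc_integral k \<alpha> / of_real (sqrt \<alpha>)"
  by (simp add: coef_def arc_integral_def)

lemma norm_cis_diff_le: "cmod (cis a - cis b) \<le> \<bar>a - b\<bar>"
proof -
  have "cis a - cis b = cis b * (cis (a - b) - 1)" by (simp add: right_diff_distrib cis_mult)
  thus ?thesis using norm_cis_diff_1_le[of "a - b"] by (simp add: norm_mult)
qed

text \<open>As the integral of e(k t) over the arc from 0 to \<open>u\<close>, this function has
  Lipschitz constant 1 in \<open>u\<close>, uniformly in \<open>k\<close>.\<close>

lemma arc_integral_lipschitz:
  assumes "k \<noteq> 0"
  shows "cmod (arc_integral k u - arc_integral k v) \<le> \<bar>u - v\<bar>"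
proof -
  have "arc_integral k u - arc_integral k v =
    (cis (2 * pi * of_int k * u) - cis (2 * pi * of_int k * v)) / (2 * pi * \<i> * of_int k)"
    by (simp add: arc_integral_def diff_divide_distrib)
  hence "cmod (arc_integral k u - arc_integral k v) =
    cmod (cis (2 * pi * of_int k * u) - cis (2 * pi * of_int k * v)) / (2 * pi * \<bar>of_int k\<bar>)"
    by (simp add: norm_divide norm_mult)
  also have "\<dots> \<le> \<bar>2 * pi * of_int k * u - 2 * pi * of_int k * v\<bar> / (2 * pi * \<bar>of_int k\<bar>)"
    by (intro divide_right_mono norm_cis_diff_le) auto
  also have "2 * pi * of_int k * u - 2 * pi * of_int k * v = 2 * pi * of_int k * (u - v)"
    by (simp add: algebra_simps)
  also have "\<bar>2 * pi * of_int k * (u - v)\<bar> / (2 * pi * \<bar>of_int k\<bar>) = \<bar>u - v\<bar>"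
    using assms by (simp add: abs_mult)
  finally show ?thesis .
qed

lemma norm_arc_integral_le: "k \<noteq> 0 \<Longrightarrow> u \<ge> 0 \<Longrightarrow> cmod (arc_integral k u) \<le> u"
  using arc_integral_lipschitz[of k u 0] by (simp add: arc_integral_def)

lemma arc_integral_step:
  assumes k: "k \<noteq> 0"
  shows "cmod (arc_integral k v - arc_integral k (v - d) - of_real d * cis (2 * pi * of_int k * v))
    \<le> pi * \<bar>of_int k\<bar> * d\<^sup>2"
proof -
  define \<theta> where "\<theta> = - (2 * pi * of_int k * d)"
  define c where "c = 2 * pi * \<i> * of_int k"
  have c: "c \<noteq> 0" using k by (simp add: c_def)
  have AI: "arc_integral k u = (cis (2 * pi * of_int k * u) - 1) / c" for u
    by (simp add: arc_integral_def c_def)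
  have "cis (2 * pi * of_int k * (v - d)) = cis (2 * pi * of_int k * v) * cis \<theta>"
    by (simp add: cis_mult \<theta>_def algebra_simps)
  hence "arc_integral k v - arc_integral k (v - d) = cis (2 * pi * of_int k * v) * (1 - cis \<theta>) / c"
    by (simp add: AI diff_divide_distrib[symmetric] right_diff_distrib)
  moreover have "of_real d = - (\<i> * of_real \<theta>) / c"
    using c by (simp add: \<theta>_def c_def)
  moreover have "X * (1 - t) / c - - (\<i> * y) / c * X = - (X * (t - 1 - \<i> * y) / c)" for X t y
    by (simp add: diff_divide_distrib add_divide_distrib algebra_simps)
  ultimately have "arc_integral k v - arc_integral k (v - d) - of_real d * cis (2 * pi * of_int k * v) =
     - (cis (2 * pi * of_int k * v) * (cis \<theta> - 1 - \<i> * of_real \<theta>) / c)"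
    by metis
  hence "cmod (arc_integral k v - arc_integral k (v - d) - of_real d * cis (2 * pi * of_int k * v)) =
     cmod (cis \<theta> - 1 - \<i> * of_real \<theta>) / (2 * pi * \<bar>of_int k\<bar>)"
    by (simp add: norm_divide norm_mult c_def)
  also have "\<dots> \<le> (\<theta>\<^sup>2 / 2) / (2 * pi * \<bar>of_int k\<bar>)"
  proof (intro divide_right_mono)
    show "cmod (cis \<theta> - 1 - \<i> * of_real \<theta>) \<le> \<theta>\<^sup>2 / 2"
      using iexp_approx1[of \<theta> 1] by (simp add: cis_conv_exp numeral_2_eq_2 algebra_simps)
  qed auto
  also have "\<dots> = pi * \<bar>of_int k\<bar> * d\<^sup>2"
    using k by (simp add: \<theta>_def power2_eq_square field_simps abs_if)
  finally show ?thesis .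
qed

text \<open>A right-endpoint Riemann sum of mesh \<open>1 / q\<close>: by
  \<open>arc_integral_step\<close> each of the \<open>h\<close> steps costs at most
  \<open>pi * \<bar>k\<bar> / q\<^sup>2\<close>.\<close>

lemma riemann_sum_arc_integral:
  assumes k: "k \<noteq> 0" and q: "q > 0"
  shows "cmod ((\<Sum>j=1..h. wave q (k * int j)) / of_nat q - arc_integral k (real h / real q))
    \<le> pi * real h * \<bar>of_int k\<bar> / (real q)\<^sup>2"
proof (induction h)
  case 0
  show ?case by (simp add: arc_integral_def)
next
  case (Suc h)
  define v where "v = real (Suc h) / real q"
  have v: "v - 1 / real q = real h / real q" by (simp add: v_def diff_divide_distrib[symmetric])
  have w: "wave q (k * int (Suc h)) / of_nat q = of_real (1 / real q) * cis (2 * pi * of_int k * v)"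
  proof -
    have "2 * pi * real_of_int (k * int (Suc h)) / real q = 2 * pi * of_int k * v" by (simp add: v_def)
    thus ?thesis by (simp only: wave_def) simp
  qed
  have "(\<Sum>j=1..Suc h. wave q (k * int j)) / of_nat q - arc_integral k v =
    ((\<Sum>j=1..h. wave q (k * int j)) / of_nat q - arc_integral k (real h / real q)) -
    (arc_integral k v - arc_integral k (v - 1 / real q) - of_real (1 / real q) * cis (2 * pi * of_int k * v))"
  proof -
    have "(\<Sum>j=1..Suc h. wave q (k * int j)) = (\<Sum>j=1..h. wave q (k * int j)) + wave q (k * int (Suc h))" by simp
    thus ?thesis unfolding v by (simp only: add_divide_distrib w) simp
  qed
  also have "cmod \<dots> \<le> pi * real h * \<bar>of_int k\<bar> / (real q)\<^sup>2 + pi * \<bar>of_int k\<bar> * (1 / real q)\<^sup>2"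
    by (rule order_trans[OF norm_triangle_ineq4 add_mono[OF Suc arc_integral_step[OF k]]])
  also have "\<dots> = pi * real (Suc h) * \<bar>of_int k\<bar> / (real q)\<^sup>2"
    by (simp add: algebra_simps power_divide add_divide_distrib)
  finally show ?case by (simp add: v_def)
qed

text \<open>\<open>\<alpha>\<close> stands for the discretised density and \<open>H / q = \<rho> \<alpha>\<close> for the true one.\<close>

lemma sharp_coef_diff:
  assumes q: "q > 0" and H: "H \<ge> 1" and k: "k \<noteq> 0" "\<bar>k\<bar> \<le> int N" and \<alpha>: "\<alpha> > 0"
  defines "\<rho> \<equiv> H / (real q * \<alpha>)"
  shows "cmod (sharp_coef q H k - coef \<alpha> k) \<le>
    sqrt (H / real q) * (pi * real N / real q + \<bar>1 / \<rho> - of_int \<lfloor>H\<rfloor> / H\<bar> + \<bar>1 - sqrt \<rho>\<bar> / \<rho>)"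
proof -
  define h where "h = nat \<lfloor>H\<rfloor>"
  define \<alpha>' where "\<alpha>' = H / real q"
  have h: "real h = of_int \<lfloor>H\<rfloor>" "real h \<le> H" using H by (auto simp: h_def)
  have \<alpha>': "\<alpha>' > 0" using H q by (simp add: \<alpha>'_def)
  have \<rho>: "\<rho> = \<alpha>' / \<alpha>" "\<rho> > 0" using \<alpha> q H by (auto simp: \<rho>_def \<alpha>'_def)
  have s: "sqrt \<alpha>' > 0" "sqrt \<alpha> > 0" using \<alpha> \<alpha>' by auto
  define D where "D = (\<Sum>j=1..h. wave q (k * int j)) / of_nat q"
  have "sqrt (H * real q) = real q * sqrt \<alpha>'"
  proof -
    have "H * real q = (real q)\<^sup>2 * \<alpha>'" using q by (simp add: \<alpha>'_def power2_eq_square)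
    thus ?thesis by (simp add: real_sqrt_mult)
  qed
  hence sc: "sharp_coef q H k = D / of_real (sqrt \<alpha>')"
    using q by (simp add: sharp_coef_def D_def h_def)
  define F where "F = arc_integral k"
  \<comment> \<open>Three separate errors: Riemann sum against integral, arc length
    \<open>h / q\<close> against the rounded density \<open>\<alpha>\<close>, and the two
    normalisations.\<close>
  have "sharp_coef q H k - coef \<alpha> k = (D - F (real h / real q)) / of_real (sqrt \<alpha>') +
     (F (real h / real q) - F \<alpha>) / of_real (sqrt \<alpha>') + F \<alpha> * of_real (1 / sqrt \<alpha>' - 1 / sqrt \<alpha>)"
    using s by (simp add: sc coef_arc_integral F_def diff_divide_distrib algebra_simps)
  also have "cmod \<dots> \<le> (pi * real h * \<bar>of_int k\<bar> / (real q)\<^sup>2) / sqrt \<alpha>' + \<bar>real h / real q - \<alpha>\<bar> / sqrt \<alpha>' +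
     \<alpha> * \<bar>1 / sqrt \<alpha>' - 1 / sqrt \<alpha>\<bar>"
  proof (intro order_trans[OF norm_triangle_ineq] add_mono)
    show "cmod ((D - F (real h / real q)) / of_real (sqrt \<alpha>')) \<le> (pi * real h * \<bar>of_int k\<bar> / (real q)\<^sup>2) / sqrt \<alpha>'"
      using divide_right_mono[OF riemann_sum_arc_integral[OF k(1) q, of h], of "sqrt \<alpha>'"] s
      by (simp add: norm_divide D_def F_def)
    show "cmod ((F (real h / real q) - F \<alpha>) / of_real (sqrt \<alpha>')) \<le> \<bar>real h / real q - \<alpha>\<bar> / sqrt \<alpha>'"
      using arc_integral_lipschitz[OF k(1), of "real h / real q" \<alpha>] s
      by (simp add: norm_divide F_def divide_right_mono)
    show "cmod (F \<alpha> * of_real (1 / sqrt \<alpha>' - 1 / sqrt \<alpha>)) \<le> \<alpha> * \<bar>1 / sqrt \<alpha>' - 1 / sqrt \<alpha>\<bar>"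
      unfolding norm_mult norm_of_real F_def using \<alpha> by (intro mult_right_mono norm_arc_integral_le k) auto
  qed
  also have "\<dots> = sqrt \<alpha>' * ((pi * real h * \<bar>of_int k\<bar> / (real q)\<^sup>2) / \<alpha>' + \<bar>real h / real q - \<alpha>\<bar> / \<alpha>' +
     \<alpha> * \<bar>1 / sqrt \<alpha>' - 1 / sqrt \<alpha>\<bar> / sqrt \<alpha>')"
  proof -
    have "x / sqrt \<alpha>' = sqrt \<alpha>' * (x / \<alpha>')" for x
      using \<alpha>' real_div_sqrt[of \<alpha>'] s by (metis divide_divide_eq_right less_imp_le mult.commute times_divide_eq_left times_divide_eq_right)
    moreover have "x = sqrt \<alpha>' * (x / sqrt \<alpha>')" for x using s by simp
    ultimately show ?thesis by (metis (no_types, lifting) distrib_left)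
  qed
  also have "\<dots> \<le> sqrt \<alpha>' * (pi * real N / real q + \<bar>1 / \<rho> - of_int \<lfloor>H\<rfloor> / H\<bar> + \<bar>1 - sqrt \<rho>\<bar> / \<rho>)"
  proof (intro mult_left_mono add_mono)
    have "(pi * real h * \<bar>of_int k\<bar> / (real q)\<^sup>2) / \<alpha>' = pi * (real h * \<bar>of_int k\<bar>) / (H * real q)"
      using q H by (simp add: \<alpha>'_def power2_eq_square mult_ac)
    also have "\<dots> \<le> pi * (H * real N) / (H * real q)"
    proof (intro divide_right_mono mult_left_mono mult_mono)
      show "\<bar>real_of_int k\<bar> \<le> real N" using k(2) by linarith
    qed (use h H in auto)
    finally show "(pi * real h * \<bar>of_int k\<bar> / (real q)\<^sup>2) / \<alpha>' \<le> pi * real N / real q" using H by simp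
    have "\<bar>real h / real q - \<alpha>\<bar> / \<alpha>' = \<bar>(real h / real q - \<alpha>) / \<alpha>'\<bar>" using \<alpha>' by simp
    also have "(real h / real q - \<alpha>) / \<alpha>' = of_int \<lfloor>H\<rfloor> / H - 1 / \<rho>"
      using \<alpha> q H by (simp add: \<rho>_def \<alpha>'_def h(1)[symmetric] field_simps)
    finally show "\<bar>real h / real q - \<alpha>\<bar> / \<alpha>' \<le> \<bar>1 / \<rho> - of_int \<lfloor>H\<rfloor> / H\<bar>" by simp
    have "\<alpha> * \<bar>1 / sqrt \<alpha>' - 1 / sqrt \<alpha>\<bar> / sqrt \<alpha>' = \<bar>\<alpha> * (1 / sqrt \<alpha>' - 1 / sqrt \<alpha>) / sqrt \<alpha>'\<bar>"
      using \<alpha> s by (simp add: abs_mult)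
    also have "\<alpha> * (1 / sqrt \<alpha>' - 1 / sqrt \<alpha>) / sqrt \<alpha>' = \<alpha> / \<alpha>' * (1 - sqrt \<alpha>' / sqrt \<alpha>)"
      using s \<alpha>' by (simp add: field_simps)
    also have "\<dots> = (1 - sqrt \<rho>) / \<rho>"
      by (simp add: \<rho>(1) real_sqrt_divide)
    finally show "\<alpha> * \<bar>1 / sqrt \<alpha>' - 1 / sqrt \<alpha>\<bar> / sqrt \<alpha>' \<le> \<bar>1 - sqrt \<rho>\<bar> / \<rho>"
      using \<rho> \<alpha> \<alpha>' by (simp add: abs_mult)
  qed (use \<alpha>' in auto)
  finally show ?thesis by (simp add: \<alpha>'_def)
qed

text \<open>The constant 8 is crude. For \<open>\<bar>\<theta>\<bar> \<le> 1\<close> Taylor's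
  formula gives even \<open>\<bar>\<theta>\<bar> / 2\<close>. For larger angles the chord is at
  least the chord of angle 1, hence at least 1/2, while \<open>pi < 4\<close> gives
  \<open>\<bar>\<theta>\<bar> / 8 < 1 / 2\<close>.\<close>

lemma norm_cis_diff_1_ge:
  assumes "\<bar>\<theta>\<bar> \<le> pi"
  shows "cmod (cis \<theta> - 1) \<ge> \<bar>\<theta>\<bar> / 8"
proof -
  have small: "cmod (cis x - 1) \<ge> \<bar>x\<bar> / 2" if "\<bar>x\<bar> \<le> 1" for x
  proof -
    have "cmod (cis x - 1 - \<i> * of_real x) \<le> x\<^sup>2 / 2"
      using iexp_approx1[of x 1] by (simp add: cis_conv_exp numeral_2_eq_2 algebra_simps)
    moreover have "cmod (\<i> * of_real x) \<le> cmod (cis x - 1) + cmod (cis x - 1 - \<i> * of_real x)"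
      using norm_triangle_ineq4[of "cis x - 1" "cis x - 1 - \<i> * of_real x"] by simp
    moreover have "x\<^sup>2 \<le> \<bar>x\<bar>"
      using that mult_right_mono[of "\<bar>x\<bar>" 1 "\<bar>x\<bar>"] by (simp add: power2_eq_square abs_mult_self_eq)
    ultimately show ?thesis by (simp add: norm_mult)
  qed
  show ?thesis
  proof (cases "\<bar>\<theta>\<bar> \<le> 1")
    case True
    thus ?thesis using small[of \<theta>] by linarith
  next
    case False
    have e: "cmod (cis x - 1) = 2 * \<bar>sin (x / 2)\<bar>" for x
      using dist_exp_i_1[of x] by (simp add: cis_conv_exp)
    have mono: "sin (1 / 2) \<le> sin (\<bar>\<theta>\<bar> / 2)"
      using False assms pi_gt3 by (subst sin_mono_le_eq) auto
    have "1 / 2 \<le> 2 * \<bar>sin (1 / 2 :: real)\<bar>" using small[of 1] by (simp add: e)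
    moreover have "sin (1 / 2 :: real) > 0" using pi_gt3 by (intro sin_gt_zero) auto
    ultimately have "1 / 2 \<le> 2 * sin (\<bar>\<theta>\<bar> / 2)" using mono by linarith
    also have "\<dots> \<le> 2 * \<bar>sin (\<bar>\<theta>\<bar> / 2)\<bar>" by simp
    also have "\<dots> = cmod (cis \<theta> - 1)" by (simp add: e abs_if)
    finally show ?thesis using assms pi_less_4 by linarith
  qed
qed

text \<open>The coefficient is a geometric sum, so it decays like \<open>1 / \<bar>k\<bar>\<close>
  once the chord from 1 to the ratio is bounded below; this needs \<open>k\<close> in the symmetric
  residue system.\<close>

lemma norm_sharp_coef_le:
  assumes q: "odd q" and k: "k \<in> residues_sym q" "k \<noteq> 0" and H: "H \<ge> 1"
  shows "cmod (sharp_coef q H k) ^ 2 \<le> 16 * real q / H * (1 / (real_of_int k)\<^sup>2)"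
proof -
  define \<omega> where "\<omega> = wave q k"
  define h where "h = nat \<lfloor>H\<rfloor>"
  have q0: "q > 0" using q by (rule odd_pos)
  define \<theta> where "\<theta> = 2 * pi * real_of_int k / real q"
  have "2 * \<bar>k\<bar> \<le> int q" using k(1) by (auto simp: residues_sym_def)
  hence "2 * \<bar>real_of_int k\<bar> \<le> real q" by linarith
  hence "\<bar>\<theta>\<bar> \<le> pi" using q0 by (simp add: \<theta>_def abs_mult field_simps)
  hence "\<bar>\<theta>\<bar> / 8 \<le> cmod (\<omega> - 1)" using norm_cis_diff_1_ge[of \<theta>] by (simp add: \<omega>_def wave_def \<theta>_def)
  moreover have "\<bar>\<theta>\<bar> / 8 \<ge> \<bar>real_of_int k\<bar> / (2 * real q)"
  proof -
    have "4 * \<bar>real_of_int k\<bar> \<le> 2 * pi * \<bar>real_of_int k\<bar>" using pi_gt3 by (intro mult_right_mono) auto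
    thus ?thesis using q0 by (simp add: \<theta>_def abs_mult field_simps)
  qed
  ultimately have lo: "\<bar>real_of_int k\<bar> / (2 * real q) \<le> cmod (\<omega> - 1)" by linarith
  have "(\<Sum>j=1..h. wave q (k * int j)) * (\<omega> - 1) = \<omega> ^ Suc h - \<omega>"
    by (induction h) (simp_all add: wave_mult_nat \<omega>_def[symmetric] algebra_simps)
  hence "cmod (\<Sum>j=1..h. wave q (k * int j)) * cmod (\<omega> - 1) = cmod (\<omega> ^ Suc h - \<omega>)"
    by (simp only: norm_mult[symmetric])
  also have "\<dots> \<le> cmod (\<omega> ^ Suc h) + cmod \<omega>" by (rule norm_triangle_ineq4)
  also have "\<dots> = 2" by (simp add: \<omega>_def norm_power norm_mult)
  finally have "cmod (\<Sum>j=1..h. wave q (k * int j)) * (\<bar>real_of_int k\<bar> / (2 * real q)) \<le> 2"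
    using mult_left_mono[OF lo norm_ge_zero[of "\<Sum>j=1..h. wave q (k * int j)"]] by linarith
  hence "cmod (\<Sum>j=1..h. wave q (k * int j)) \<le> 4 * real q / \<bar>real_of_int k\<bar>"
    using k(2) q0 by (simp add: field_simps)
  hence "cmod (\<Sum>j=1..h. wave q (k * int j)) ^ 2 \<le> (4 * real q / \<bar>real_of_int k\<bar>) ^ 2"
    by (intro power_mono) auto
  hence "cmod (\<Sum>j=1..h. wave q (k * int j)) ^ 2 / (H * real q) \<le> (4 * real q / \<bar>real_of_int k\<bar>) ^ 2 / (H * real q)"
    using H by (intro divide_right_mono) auto
  also have "\<dots> = 16 * real q / H * (1 / (real_of_int k)\<^sup>2)"
    using q0 by (simp add: power_divide power_mult_distrib power2_eq_square)
  finally show ?thesis using H by (simp add: sharp_coef_def h_def norm_divide power_divide)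
qed

lemma sum_inverse_squares_tail:
  assumes "N \<ge> 1"
  shows "(\<Sum>k\<in>{N<..M}. 1 / (real k)\<^sup>2) \<le> 1 / real N"
proof -
  have "(\<Sum>k\<in>{N<..M}. 1 / (real k)\<^sup>2) \<le> 1 / real N - 1 / real (max M N)"
  proof (induction M)
    case (Suc M)
    show ?case
    proof (cases "Suc M \<le> N")
      case True
      thus ?thesis by simp
    next
      case False
      hence M: "N \<le> M" "M \<ge> 1" using assms by auto
      have "1 / (real (Suc M))\<^sup>2 \<le> 1 / (real M * real (Suc M))"
        using M by (intro divide_left_mono) (auto simp: power2_eq_square intro: mult_right_mono)
      also have "\<dots> = 1 / real M - 1 / real (Suc M)" using M by (simp add: field_simps)
      finally have st: "1 / (real (Suc M))\<^sup>2 \<le> 1 / real M - 1 / real (Suc M)" .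
      have "{N<..Suc M} = insert (Suc M) {N<..M}" using M by auto
      hence "(\<Sum>k\<in>{N<..Suc M}. 1 / (real k)\<^sup>2) = 1 / (real (Suc M))\<^sup>2 + (\<Sum>k\<in>{N<..M}. 1 / (real k)\<^sup>2)" by simp
      thus ?thesis using Suc st M by (simp add: max_def)
    qed
  qed (use assms in simp)
  also have "\<dots> \<le> 1 / real N" by simp
  finally show ?thesis .
qed

definition trig_poly :: "nat \<Rightarrow> nat \<Rightarrow> nat \<Rightarrow> int \<Rightarrow> complex" where
  "trig_poly l n q x = (\<Sum>k\<in>freqs l n. (gauss_phase q * coef (grid_scale n) k * of_int (Legendre k q)) * wave q (k * x))"

lemma finite_freqs [simp]: "finite (freqs l n)"
  by (simp add: freqs_def)

text \<open>Parseval's identity reduces the error to coefficients. The at most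
  \<open>2 * l / grid_scale n\<close> frequencies kept each contribute \<open>H / q\<close> times a
  squared relative error that is small for fixed \<open>l\<close>. The discarded ones form a tail of
  inverse squares, of order \<open>1 / l\<close>.\<close>

lemma trig_poly_l2_error:
  assumes q: "prime q" "q > 2" and H: "H \<ge> 1" and l: "l \<ge> 1" and N: "cutoff l n \<le> q div 2"
  defines "\<rho> \<equiv> H / (real q * grid_scale n)"
  shows "(\<Sum>x\<in>{0..<int q}. cmod (of_real (normalized_sum q H x) - trig_poly l n q x) ^ 2) / real q \<le>
    2 * real l * \<rho> * (pi * real (cutoff l n) / real q + \<bar>1 / \<rho> - of_int \<lfloor>H\<rfloor> / H\<bar> + \<bar>1 - sqrt \<rho>\<bar> / \<rho>)\<^sup>2
     + 64 / (\<rho> * real l)"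
proof -
  define N where "N = cutoff l n"
  define \<alpha> where "\<alpha> = grid_scale n"
  define w where "w = gauss_phase q"
  define A where "A = freqs l n"
  define e where "e = pi * real N / real q + \<bar>1 / \<rho> - of_int \<lfloor>H\<rfloor> / H\<bar> + \<bar>1 - sqrt \<rho>\<bar> / \<rho>"
  have odd: "odd q" using q prime_odd_nat by auto
  have q0: "q > 0" using q by simp
  have \<alpha>: "\<alpha> > 0" by (simp add: \<alpha>_def grid_scale_pos)
  have N1: "N \<ge> 1" "real N \<le> real l / \<alpha>" "real l / \<alpha> \<le> 2 * real N"
    using cutoff_bounds[OF l, of n] by (auto simp: N_def \<alpha>_def)
  have \<rho>: "\<rho> > 0" using H q0 \<alpha> by (simp add: \<rho>_def \<alpha>_def)
  define d where "d k = w * of_int (Legendre k q) * (sharp_coef q H k - (if k \<in> A then coef \<alpha> k else 0))" for k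
  have fin: "finite (residues_sym q)" by (simp add: residues_sym_def)
  have sub: "A \<subseteq> residues_sym q" using N by (auto simp: A_def freqs_def residues_sym_def)
  have A0: "0 \<notin> A" by (simp add: A_def freqs_def)
  have cA: "real (card A) \<le> 2 * real N"
    by (simp add: A_def freqs_def N_def card_Diff_singleton nat_add_distrib nat_mult_distrib)
  have diff: "of_real (normalized_sum q H x) - trig_poly l n q x = (\<Sum>k\<in>residues_sym q. d k * wave q (k * x))" for x
  proof -
    have tp: "trig_poly l n q x = (\<Sum>k\<in>residues_sym q. if k \<in> A then (w * coef \<alpha> k * of_int (Legendre k q)) * wave q (k * x) else 0)"
      unfolding trig_poly_def w_def[symmetric] \<alpha>_def[symmetric] A_def[symmetric]
      using fin sub by (simp add: sum.inter_restrict[symmetric] Int_absorb1)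
    show ?thesis unfolding normalized_sum_fourier[OF q H] tp w_def[symmetric] sum_subtractf[symmetric]
      by (auto intro!: sum.cong simp: d_def algebra_simps)
  qed
  have nd: "cmod (d k) ^ 2 = (if k = 0 then 0 else cmod (sharp_coef q H k - (if k \<in> A then coef \<alpha> k else 0)) ^ 2)"
    if "k \<in> residues_sym q" for k
    using norm_Legendre_residues_sym[OF odd that] norm_gauss_phase[OF q]
    by (simp add: d_def norm_mult w_def Legendre_def[of 0])
  have "(\<Sum>x\<in>{0..<int q}. cmod (of_real (normalized_sum q H x) - trig_poly l n q x) ^ 2) / real q =
     (\<Sum>k\<in>residues_sym q. cmod (d k) ^ 2)"
    unfolding diff using parseval[OF q0 fin, of d] residues_sym_inj[OF odd] q0 by simp
  also have "\<dots> = (\<Sum>k\<in>A. cmod (d k) ^ 2) + (\<Sum>k\<in>residues_sym q - A. cmod (d k) ^ 2)"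
    using sum.subset_diff[OF sub fin, of "\<lambda>k. cmod (d k) ^ 2"] by (simp add: add.commute)
  also have "(\<Sum>k\<in>A. cmod (d k) ^ 2) \<le> (\<Sum>k\<in>A. H / real q * e\<^sup>2)"
  proof (rule sum_mono)
    fix k assume k: "k \<in> A"
    have k0: "k \<noteq> 0" "\<bar>k\<bar> \<le> int N" using k by (auto simp: A_def freqs_def N_def)
    have "cmod (d k) ^ 2 = cmod (sharp_coef q H k - coef \<alpha> k) ^ 2" using nd[of k] k k0 sub by auto
    also have "\<dots> \<le> (sqrt (H / real q) * e) ^ 2"
      unfolding e_def \<rho>_def \<alpha>_def[symmetric]
      by (intro power_mono sharp_coef_diff[OF q0 H k0 \<alpha>]) auto
    also have "\<dots> = H / real q * e\<^sup>2" using H by (simp add: power_mult_distrib)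
    finally show "cmod (d k) ^ 2 \<le> H / real q * e\<^sup>2" .
  qed
  also have "(\<Sum>k\<in>A. H / real q * e\<^sup>2) = real (card A) * (H / real q * e\<^sup>2)" by simp
  also have "\<dots> \<le> (2 * (real l / \<alpha>)) * (H / real q * e\<^sup>2)"
    using cA N1 H by (intro mult_right_mono) auto
  also have "\<dots> = 2 * real l * \<rho> * e\<^sup>2" using \<alpha> by (simp add: \<rho>_def \<alpha>_def mult_ac)
  also have "(\<Sum>k\<in>residues_sym q - A. cmod (d k) ^ 2) \<le> 64 / (\<rho> * real l)"
  proof -
    define T where "T = {N<..q div 2}"
    have T: "residues_sym q - A = insert 0 (int ` T \<union> (\<lambda>k. - int k) ` T)"
    proof (intro equalityI subsetI)
      fix k assume "k \<in> residues_sym q - A"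
      hence k: "\<bar>k\<bar> \<le> int (q div 2)" "k = 0 \<or> \<bar>k\<bar> > int N"
        by (auto simp: residues_sym_def A_def freqs_def N_def)
      have "nat \<bar>k\<bar> \<in> T" if "k \<noteq> 0" using k that by (auto simp: T_def)
      moreover have "k = int (nat \<bar>k\<bar>) \<or> k = - int (nat \<bar>k\<bar>)" by auto
      ultimately show "k \<in> insert 0 (int ` T \<union> (\<lambda>k. - int k) ` T)" by blast
    next
      fix k assume "k \<in> insert 0 (int ` T \<union> (\<lambda>k. - int k) ` T)"
      thus "k \<in> residues_sym q - A"
        by (auto simp: T_def residues_sym_def A_def freqs_def N_def zdiv_int)
    qed
    have T0: "0 \<notin> T" "finite T" by (auto simp: T_def)
    define g where "g k = 16 * real q / H * (1 / (real_of_int k)\<^sup>2)" for k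
    have "(\<Sum>k\<in>residues_sym q - A. cmod (d k) ^ 2) = (\<Sum>k\<in>residues_sym q - A - {0}. cmod (d k) ^ 2)"
      by (rule sum.mono_neutral_right) (use fin nd in auto)
    also have "\<dots> \<le> (\<Sum>k\<in>residues_sym q - A - {0}. g k)"
    proof (rule sum_mono)
      fix k assume k: "k \<in> residues_sym q - A - {0}"
      hence "cmod (d k) ^ 2 = cmod (sharp_coef q H k) ^ 2" using nd[of k] by auto
      also have "\<dots> \<le> g k" unfolding g_def using k by (intro norm_sharp_coef_le[OF odd _ _ H]) auto
      finally show "cmod (d k) ^ 2 \<le> g k" .
    qed
    also have "residues_sym q - A - {0} = int ` T \<union> (\<lambda>k. - int k) ` T" using T T0 by auto
    also have "(\<Sum>k\<in>int ` T \<union> (\<lambda>k. - int k) ` T. g k) = (\<Sum>k\<in>int ` T. g k) + (\<Sum>k\<in>(\<lambda>k. - int k) ` T. g k)"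
      using T0 by (intro sum.union_disjoint) (auto simp: T_def)
    also have "\<dots> = 2 * (\<Sum>k\<in>T. 16 * real q / H * (1 / (real k)\<^sup>2))"
      by (simp add: sum.reindex inj_on_def g_def)
    also have "\<dots> = 32 * real q / H * (\<Sum>k\<in>T. 1 / (real k)\<^sup>2)" by (simp add: sum_distrib_left)
    also have "\<dots> \<le> 32 * real q / H * (1 / real N)"
      using sum_inverse_squares_tail[OF N1(1)] H by (intro mult_left_mono) (auto simp: T_def)
    also have "\<dots> \<le> 32 * real q / H * (2 * \<alpha> / real l)"
    proof (intro mult_left_mono)
      show "1 / real N \<le> 2 * \<alpha> / real l" using N1 l \<alpha> by (simp add: field_simps)
    qed (use H in auto)
    also have "\<dots> = 64 / (\<rho> * real l)" using H q0 \<alpha> by (simp add: \<rho>_def \<alpha>_def)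
    finally show ?thesis .
  qed
  finally show ?thesis by (simp add: e_def N_def)
qed

section \<open>Moments of the truncated series\<close>

lemma coef_minus: "coef \<alpha> (- k) = cnj (coef \<alpha> k)"
  by (simp add: coef_def cis_cnj)

text \<open>The sign (-1/q) from conjugating the phase matches the sign in (-k/q). Hence the
  polynomial is real-valued, and the product of opposite coefficients is a squared modulus.\<close>

lemma trig_poly_coef_cnj:
  assumes q: "prime q" "q > 2"
  shows "cnj (gauss_phase q * coef \<alpha> k * of_int (Legendre k q)) = gauss_phase q * coef \<alpha> (- k) * of_int (Legendre (- k) q)"
proof -
  have "Legendre (- k) q = Legendre (-1) q * Legendre k q" using Legendre_mult[OF q, of "-1" k] by simp
  thus ?thesis by (simp add: cnj_gauss_phase[OF q] coef_minus mult_ac)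
qed

lemma trig_poly_real:
  assumes q: "prime q" "q > 2"
  shows "trig_poly l n q x = of_real (Re (trig_poly l n q x))"
proof -
  have "cnj (trig_poly l n q x) = (\<Sum>k\<in>freqs l n. (gauss_phase q * coef (grid_scale n) (- k) * of_int (Legendre (- k) q)) * wave q ((- k) * x))"
    unfolding trig_poly_def cnj_sum complex_cnj_mult[of "_ * _ * _"] trig_poly_coef_cnj[OF q]
    by (simp add: wave_minus)
  also have "\<dots> = trig_poly l n q x"
    unfolding trig_poly_def
    by (rule sum.reindex_bij_witness[of _ uminus uminus]) (auto simp: freqs_def)
  finally show ?thesis by (metis Reals_cnj_iff of_real_Re)
qed

text \<open>As long as no wrap-around modulo \<open>q\<close> occurs, tuple sums are moments. They
  therefore depend only on the number of indices, which supplies the hypothesis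
  \<open>card_dep\<close> of \<open>tuple_sum_recursion\<close>; by Parseval's identity the pairing
  factor is the second moment.\<close>

theorem trig_poly_moment_recursion:
  assumes q: "prime q" "q > 2" and m: "m \<ge> 2" "m * cutoff l n < q"
  defines "M \<equiv> \<lambda>x. Re (trig_poly l n q x)"
  shows "\<bar>avg q (\<lambda>x. M x ^ m) - real (m - 1) * avg q (\<lambda>x. M x ^ 2) * avg q (\<lambda>x. M x ^ (m - 2))\<bar> \<le> defect l n m q"
proof -
  define a where "a k = gauss_phase q * coef (grid_scale n) k * of_int (Legendre k q)" for k
  define A where "A = freqs l n"
  have q0: "q > 0" using q by simp
  have A: "finite A" "\<And>k. k \<in> A \<Longrightarrow> \<bar>k\<bar> \<le> int (cutoff l n)" "\<And>k. k \<in> A \<Longrightarrow> - k \<in> A"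
    by (auto simp: A_def freqs_def)
  have mom: "tuple_sum a A I = of_real (avg q (\<lambda>x. M x ^ card I))" if I: "finite I" "card I \<le> m" for I
  proof -
    have "card I * cutoff l n \<le> m * cutoff l n" using I by (intro mult_right_mono) auto
    hence "card I * cutoff l n < q" using m by linarith
    from moment_eq_tuple_sum[OF I(1) A(1,2) this, of a]
    have "of_nat q * tuple_sum a A I = (\<Sum>x\<in>{0..<int q}. trig_poly l n q x ^ card I)"
      by (simp add: trig_poly_def a_def A_def)
    also have "\<dots> = (\<Sum>x\<in>{0..<int q}. complex_of_real (M x ^ card I))"
      using trig_poly_real[OF q] by (simp add: M_def)
    finally show ?thesis using q0 by (simp add: avg_def field_simps)
  qed
  have aa: "(\<Sum>k\<in>A. a k * a (- k)) = of_real (avg q (\<lambda>x. M x ^ 2))"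
  proof -
    have qd: "2 * cutoff l n < q" using m by (meson le_less_trans mult_le_mono1)
    have "a k * a (- k) = of_real (cmod (a k) ^ 2)" for k
      unfolding a_def using trig_poly_coef_cnj[OF q, of "grid_scale n" k] by (simp only: complex_norm_square)
    hence "(\<Sum>k\<in>A. a k * a (- k)) = of_real (\<Sum>k\<in>A. cmod (a k) ^ 2)" by simp
    also have "(\<Sum>k\<in>A. cmod (a k) ^ 2) = (\<Sum>x\<in>{0..<int q}. cmod (\<Sum>k\<in>A. a k * wave q (k * x)) ^ 2) / real q"
    proof -
      have "k = k'" if "k \<in> A" "k' \<in> A" "int q dvd k - k'" for k k'
      proof -
        have "\<bar>k - k'\<bar> < int q" using A(2)[OF that(1)] A(2)[OF that(2)] qd by linarith
        thus ?thesis using that(3) zdvd_imp_le[of "int q" "\<bar>k - k'\<bar>"] by (cases "k = k'") auto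
      qed
      thus ?thesis using parseval[OF q0 A(1), of a] q0 by simp
    qed
    also have "\<dots> = avg q (\<lambda>x. M x ^ 2)"
    proof -
      have "cmod (\<Sum>k\<in>A. a k * wave q (k * x)) ^ 2 = M x ^ 2" for x
      proof -
        have "(\<Sum>k\<in>A. a k * wave q (k * x)) = of_real (M x)"
          using trig_poly_real[OF q, of l n x] by (simp add: trig_poly_def a_def A_def M_def)
        thus ?thesis by simp
      qed
      thus ?thesis by (simp add: avg_def)
    qed
    finally show ?thesis .
  qed
  have "tuple_sum a A {..<m} = of_nat (m - 1) * (\<Sum>k\<in>A. a k * a (- k)) * of_real (avg q (\<lambda>x. M x ^ (m - 2))) + unpaired_sum a A m"
    by (rule tuple_sum_recursion[OF m(1) A(1,3)]) (simp_all add: mom)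
  hence "unpaired_sum a A m = of_real (avg q (\<lambda>x. M x ^ m) - real (m - 1) * avg q (\<lambda>x. M x ^ 2) * avg q (\<lambda>x. M x ^ (m - 2)))"
    unfolding aa using mom[of "{..<m}"] by simp
  hence "\<bar>avg q (\<lambda>x. M x ^ m) - real (m - 1) * avg q (\<lambda>x. M x ^ 2) * avg q (\<lambda>x. M x ^ (m - 2))\<bar> = cmod (unpaired_sum a A m)"
    by (simp only: norm_of_real)
  also have "\<dots> = defect l n m q"
    unfolding defect_def a_def A_def by (rule unpaired_sum_twist[OF q norm_gauss_phase[OF q]])
  finally show ?thesis by simp
qed

lemma trig_poly_mean_zero:
  assumes q: "prime q" "q > 2" and "cutoff l n < q"
  shows "avg q (\<lambda>x. Re (trig_poly l n q x)) = 0"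
proof -
  have q0: "q > 0" using q by simp
  have "(\<Sum>x\<in>{0..<int q}. trig_poly l n q x ^ card {0::nat}) =
    of_nat q * tuple_sum (\<lambda>k. gauss_phase q * coef (grid_scale n) k * of_int (Legendre k q)) (freqs l n) {0}"
    unfolding trig_poly_def
    by (rule moment_eq_tuple_sum[where N = "cutoff l n"]) (use assms in \<open>auto simp: freqs_def\<close>)
  moreover have "zero_sums {0} (freqs l n) = {}" by (auto simp: zero_sums_def PiE_def Pi_def freqs_def)
  ultimately have "(\<Sum>x\<in>{0..<int q}. trig_poly l n q x) = 0" by (simp add: tuple_sum_def)
  hence "(\<Sum>x\<in>{0..<int q}. Re (trig_poly l n q x)) = 0" by (metis Re_sum zero_complex.sel(1))
  thus ?thesis by (simp add: avg_def)
qed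

section \<open>Method of moments\<close>

lemma avg_diff: "avg q (\<lambda>x. f x - g x) = avg q f - avg q g"
  by (simp add: avg_def sum_subtractf diff_divide_distrib)

lemma avg_cmult: "avg q (\<lambda>x. c * f x) = c * avg q f"
  by (simp add: avg_def sum_distrib_left)

lemma avg_sum: "avg q (\<lambda>x. \<Sum>i\<in>I. f i x) = (\<Sum>i\<in>I. avg q (f i))"
  unfolding avg_def by (subst sum.swap) (simp add: sum_divide_distrib)

lemma avg_complex_of_real: "avg q (\<lambda>x. complex_of_real (f x)) = of_real (avg q f)"
  by (simp add: avg_def)

lemma avg_mono: "(\<And>x. f x \<le> (g x :: real)) \<Longrightarrow> avg q f \<le> avg q g"
  by (simp add: avg_def sum_mono divide_right_mono)

lemma norm_avg_le: "norm (avg q f) \<le> avg q (\<lambda>x. norm (f x))"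
  by (simp add: avg_def norm_divide divide_right_mono norm_sum)

lemma avg_abs_le_sqrt: "avg q (\<lambda>x. \<bar>f x\<bar>) \<le> sqrt (avg q (\<lambda>x. (f x)\<^sup>2))"
proof (rule real_le_rsqrt)
  have "(\<Sum>x\<in>{0..<int q}. \<bar>f x\<bar>)\<^sup>2 \<le> (\<Sum>x\<in>{0..<int q}. \<bar>f x\<bar>\<^sup>2) * real (card {0..<int q})"
    by (rule sum_squared_le_sum_of_squares)
  hence "(\<Sum>x\<in>{0..<int q}. \<bar>f x\<bar>)\<^sup>2 / (real q)\<^sup>2 \<le> ((\<Sum>x\<in>{0..<int q}. (f x)\<^sup>2) * real q) / (real q)\<^sup>2"
    by (intro divide_right_mono) auto
  thus "(avg q (\<lambda>x. \<bar>f x\<bar>))\<^sup>2 \<le> avg q (\<lambda>x. (f x)\<^sup>2)"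
    by (cases "q = 0") (simp_all add: avg_def power_divide power2_eq_square)
qed

fun gaussian_moment :: "nat \<Rightarrow> real" where
  "gaussian_moment 0 = 1"
| "gaussian_moment (Suc 0) = 0"
| "gaussian_moment (Suc (Suc m)) = real (Suc m) * gaussian_moment m"

lemma gaussian_moment_even: "gaussian_moment (2 * k) = fact (2 * k) / (2 ^ k * fact k)"
proof (induction k)
  case (Suc k)
  have "gaussian_moment (2 * Suc k) = real (2 * k + 1) * gaussian_moment (2 * k)" by simp
  also have "\<dots> = real (2 * k + 1) * (fact (2 * k) / (2 ^ k * fact k))" by (simp only: Suc)
  also have "\<dots> = (2 * (real k + 1)) * (real (2 * k + 1) * fact (2 * k)) / ((2 * (real k + 1)) * (2 ^ k * fact k))"
    by (subst mult_divide_mult_cancel_left) auto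
  also have "\<dots> = fact (2 * Suc k) / (2 ^ Suc k * fact (Suc k))" by (simp add: algebra_simps)
  finally show ?case .
qed simp

lemma gaussian_moment_odd: "gaussian_moment (Suc (2 * k)) = 0"
  by (induction k) auto

lemma gaussian_moment_sum:
  "(\<Sum>k<2*N. (\<i> * of_real t) ^ k / fact k * of_real (gaussian_moment k)) =
    complex_of_real (\<Sum>j<N. (- t\<^sup>2 / 2) ^ j / fact j)"
proof (induction N)
  case (Suc N)
  have "(\<i> * complex_of_real t) ^ (2 * N) / fact (2 * N) * of_real (gaussian_moment (2 * N)) =
    of_real ((- t\<^sup>2 / 2) ^ N / fact N)"
  proof -
    have "(\<i> * complex_of_real t) ^ (2 * N) = of_real ((- t\<^sup>2) ^ N)"
      by (simp add: power_mult power_mult_distrib)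
    moreover have "complex_of_real (fact (2 * N) / (2 ^ N * fact N)) = fact (2 * N) / (2 ^ N * fact N)" by simp
    ultimately show ?thesis by (simp add: gaussian_moment_even power_minus[of "(complex_of_real t)\<^sup>2"]
        power_minus[of "(complex_of_real t)\<^sup>2 / 2"] power_divide)
  qed
  thus ?case using Suc by (simp add: gaussian_moment_odd)
qed simp

text \<open>Stopping at the even order \<open>2 * N\<close> makes the absolute moment in the Taylor
  remainder an ordinary moment.\<close>

lemma avg_iexp_approx:
  assumes "N \<ge> 1"
  shows "cmod (avg q (\<lambda>x. iexp (t * X x)) - (\<Sum>k<2*N. (\<i> * of_real t) ^ k / fact k * of_real (avg q (\<lambda>x. X x ^ k))))
    \<le> t ^ (2*N) / fact (2*N) * avg q (\<lambda>x. X x ^ (2*N))"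
proof -
  have S: "Suc (2*N - 1) = 2*N" "{..2*N-1} = {..<2*N}" using assms by auto
  have "(\<Sum>k<2*N. (\<i> * of_real t) ^ k / fact k * of_real (avg q (\<lambda>x. X x ^ k))) =
    avg q (\<lambda>x. \<Sum>k<2*N. (\<i> * of_real (t * X x)) ^ k / fact k)"
    unfolding avg_sum
  proof (intro sum.cong refl)
    fix k
    have "avg q (\<lambda>x. (\<i> * of_real (t * X x)) ^ k / fact k) = avg q (\<lambda>x. (\<i> * of_real t) ^ k / fact k * of_real (X x ^ k))"
      by (simp add: power_mult_distrib mult_ac)
    thus "(\<i> * of_real t) ^ k / fact k * of_real (avg q (\<lambda>x. X x ^ k)) = avg q (\<lambda>x. (\<i> * of_real (t * X x)) ^ k / fact k)"
      by (simp only: avg_cmult avg_complex_of_real)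
  qed
  hence "cmod (avg q (\<lambda>x. iexp (t * X x)) - (\<Sum>k<2*N. (\<i> * of_real t) ^ k / fact k * of_real (avg q (\<lambda>x. X x ^ k)))) =
    cmod (avg q (\<lambda>x. iexp (t * X x) - (\<Sum>k<2*N. (\<i> * of_real (t * X x)) ^ k / fact k)))"
    by (simp only: avg_diff)
  also have "\<dots> \<le> avg q (\<lambda>x. cmod (iexp (t * X x) - (\<Sum>k<2*N. (\<i> * of_real (t * X x)) ^ k / fact k)))"
    by (rule norm_avg_le)
  also have "\<dots> \<le> avg q (\<lambda>x. t ^ (2*N) / fact (2*N) * X x ^ (2*N))"
  proof (rule avg_mono)
    fix x
    have "cmod (iexp (t * X x) - (\<Sum>k<2*N. (\<i> * of_real (t * X x)) ^ k / fact k)) \<le> \<bar>t * X x\<bar> ^ (2*N) / fact (2*N)"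
      using iexp_approx1[of "t * X x" "2*N - 1"] unfolding S .
    also have "\<bar>t * X x\<bar> ^ (2*N) = (t * X x) ^ (2*N)" by (simp add: power_mult)
    finally show "cmod (iexp (t * X x) - (\<Sum>k<2*N. (\<i> * of_real (t * X x)) ^ k / fact k)) \<le> t ^ (2*N) / fact (2*N) * X x ^ (2*N)"
      by (simp add: power_mult_distrib)
  qed
  also have "\<dots> = t ^ (2*N) / fact (2*N) * avg q (\<lambda>x. X x ^ (2*N))" by (rule avg_cmult)
  finally show ?thesis .
qed

text \<open>A fixed Taylor order suffices. In the limit the remainder becomes
  \<open>(t\<^sup>2 / 2) ^ N / fact N\<close>, which tends to 0, so one \<open>N\<close> makes both
  the remainder and the error of the exponential series small; only finitely many moments then have
  to converge.\<close>

theorem method_of_moments: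
  assumes mom: "\<And>m. ((\<lambda>q. avg q (\<lambda>x. X q x ^ m)) \<longlongrightarrow> gaussian_moment m) F"
  shows "((\<lambda>q. avg q (\<lambda>x. iexp (t * X q x))) \<longlongrightarrow> of_real (exp (- t\<^sup>2 / 2))) F"
proof (rule tendstoI)
  fix e :: real assume e: "e > 0"
  have exp_sums: "(\<lambda>n. x ^ n / fact n) sums exp x" for x :: real
    using exp_converges[of x] by (simp add: divide_inverse mult.commute)
  define S where "S N = (\<Sum>j<N. (- t\<^sup>2 / 2) ^ j / fact j)" for N
  have "S \<longlonglongrightarrow> exp (- t\<^sup>2 / 2)"
    using exp_sums[of "- t\<^sup>2 / 2"] unfolding sums_def S_def .
  hence "eventually (\<lambda>N. dist (S N) (exp (- t\<^sup>2 / 2)) < e / 4) sequentially" using e by (intro tendstoD) auto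
  moreover have "(\<lambda>N. (t\<^sup>2 / 2) ^ N / fact N) \<longlonglongrightarrow> 0"
    by (rule summable_LIMSEQ_zero[OF sums_summable[OF exp_sums]])
  hence "eventually (\<lambda>N. dist ((t\<^sup>2 / 2) ^ N / fact N) 0 < e / 4) sequentially" using e by (intro tendstoD) auto
  moreover have "eventually (\<lambda>N::nat. N \<ge> 1) sequentially" by (rule eventually_ge_at_top)
  ultimately have "eventually (\<lambda>N. dist (S N) (exp (- t\<^sup>2 / 2)) < e / 4 \<and> dist ((t\<^sup>2 / 2) ^ N / fact N) 0 < e / 4 \<and> N \<ge> 1) sequentially"
    by eventually_elim auto
  then obtain N where N: "dist (S N) (exp (- t\<^sup>2 / 2)) < e / 4" "dist ((t\<^sup>2 / 2) ^ N / fact N) 0 < e / 4" "N \<ge> 1"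
    using eventually_happens'[OF sequentially_bot] by blast
  define p where "p q = (\<Sum>k<2*N. (\<i> * of_real t) ^ k / fact k * of_real (avg q (\<lambda>x. X q x ^ k)))" for q
  define r where "r q = t ^ (2*N) / fact (2*N) * avg q (\<lambda>x. X q x ^ (2*N))" for q
  have "(p \<longlongrightarrow> (\<Sum>k<2*N. (\<i> * of_real t) ^ k / fact k * of_real (gaussian_moment k))) F"
    unfolding p_def by (intro tendsto_intros mom)
  hence "(p \<longlongrightarrow> of_real (S N)) F" by (simp only: gaussian_moment_sum S_def)
  hence ep: "eventually (\<lambda>q. dist (p q) (of_real (S N)) < e / 4) F" using e by (intro tendstoD) auto
  have "(r \<longlongrightarrow> t ^ (2*N) / fact (2*N) * gaussian_moment (2*N)) F"
    unfolding r_def by (intro tendsto_intros mom)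
  also have "t ^ (2*N) / fact (2*N) * gaussian_moment (2*N) = (t\<^sup>2 / 2) ^ N / fact N"
    by (simp add: gaussian_moment_even power_mult power_divide)
  finally have "eventually (\<lambda>q. r q < e / 4) F"
    by (rule order_tendstoD) (use N(2) in \<open>simp add: dist_real_def\<close>)
  with ep show "eventually (\<lambda>q. dist (avg q (\<lambda>x. iexp (t * X q x))) (of_real (exp (- t\<^sup>2 / 2))) < e) F"
  proof eventually_elim
    case (elim q)
    have "dist (avg q (\<lambda>x. iexp (t * X q x))) (p q) \<le> r q"
      unfolding p_def r_def dist_norm by (rule avg_iexp_approx[OF N(3)])
    moreover have "dist (complex_of_real (S N)) (of_real (exp (- t\<^sup>2 / 2))) < e / 4"
      using N(1) by (simp only: dist_of_real)
    ultimately show ?case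
      using elim dist_triangle[of "avg q (\<lambda>x. iexp (t * X q x))" "of_real (exp (- t\<^sup>2 / 2))" "p q"]
        dist_triangle[of "p q" "of_real (exp (- t\<^sup>2 / 2))" "of_real (S N)"] e by linarith
  qed
qed

section \<open>Characteristic functions and convergence along a filter\<close>

lemma avg_iexp_l2_close:
  "cmod (avg q (\<lambda>x. iexp (t * Y x)) - avg q (\<lambda>x. iexp (t * X x))) \<le> \<bar>t\<bar> * sqrt (avg q (\<lambda>x. (Y x - X x)\<^sup>2))"
proof -
  have d: "cmod (iexp a - iexp b) \<le> \<bar>a - b\<bar>" for a b
  proof -
    have "iexp a - iexp b = iexp b * (iexp (a - b) - 1)"
      by (simp add: right_diff_distrib exp_add[symmetric])
    hence "cmod (iexp a - iexp b) = cmod (iexp (a - b) - 1)" by (simp add: norm_mult)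
    thus ?thesis using iexp_approx1[of "a - b" 0] by simp
  qed
  have "cmod (avg q (\<lambda>x. iexp (t * Y x)) - avg q (\<lambda>x. iexp (t * X x))) = cmod (avg q (\<lambda>x. iexp (t * Y x) - iexp (t * X x)))"
    by (simp only: avg_diff)
  also have "\<dots> \<le> avg q (\<lambda>x. cmod (iexp (t * Y x) - iexp (t * X x)))" by (rule norm_avg_le)
  also have "\<dots> \<le> avg q (\<lambda>x. \<bar>t\<bar> * \<bar>Y x - X x\<bar>)"
    by (rule avg_mono, rule order_trans[OF d]) (simp add: abs_mult right_diff_distrib[symmetric])
  also have "\<dots> = \<bar>t\<bar> * avg q (\<lambda>x. \<bar>Y x - X x\<bar>)" by (rule avg_cmult)
  also have "\<dots> \<le> \<bar>t\<bar> * sqrt (avg q (\<lambda>x. (Y x - X x)\<^sup>2))"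
    by (intro mult_left_mono avg_abs_le_sqrt) auto
  finally show ?thesis .
qed

lemma real_distribution_legendre_sum_law: "real_distribution (legendre_sum_law q H)"
  unfolding legendre_sum_law_def
  by (rule prob_space.real_distribution_distr[OF measure_pmf.prob_space_axioms]) simp

lemma char_legendre_sum_law:
  assumes "q > 0"
  shows "char (legendre_sum_law q H) t = avg q (\<lambda>x. iexp (t * normalized_sum q H x))"
proof -
  have "char (legendre_sum_law q H) t = (CLINT x|measure_pmf (uniform_residue q). iexp (t * normalized_sum q H x))"
    unfolding char_def legendre_sum_law_def normalized_sum_def
    by (subst integral_distr) auto
  also have "\<dots> = avg q (\<lambda>x. iexp (t * normalized_sum q H x))"
    unfolding uniform_residue_def using assms
    by (subst integral_measure_pmf[of "{0..<int q}"])
       (auto simp: avg_def scaleR_conv_of_real sum_divide_distrib)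
  finally show ?thesis .
qed

text \<open>Levy's continuity theorem speaks of sequences. A failure of convergence along the filter
  yields a sequence in \<open>P\<close> tending to infinity that stays away from the limit, and the
  theorem applied to this sequence gives a contradiction.\<close>

lemma weak_conv_filter_charI:
  assumes \<mu>: "\<And>q. real_distribution (\<mu> q)" and M: "real_distribution M"
    and conv: "\<And>t. ((\<lambda>q. char (\<mu> q) t) \<longlongrightarrow> char M t) (at_top_within P)"
  shows "weak_conv_filter \<mu> M (at_top_within P)"
  unfolding weak_conv_filter_def
proof (intro allI impI)
  fix t assume t: "isCont (cdf M) t"
  show "((\<lambda>q. cdf (\<mu> q) t) \<longlongrightarrow> cdf M t) (at_top_within P)"
    unfolding tendsto_at_top_within_iff
  proof (rule ccontr)
    assume "\<not> (\<forall>e>0. \<exists>N. \<forall>q\<ge>N. q \<in> P \<longrightarrow> \<bar>cdf (\<mu> q) t - cdf M t\<bar> < e)"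
    then obtain e where e: "e > 0" and bad: "\<And>N. \<exists>q\<ge>N. q \<in> P \<and> \<bar>cdf (\<mu> q) t - cdf M t\<bar> \<ge> e"
      by (meson not_less)
    obtain s where s: "\<And>N. s N \<ge> N" "\<And>N. s N \<in> P" "\<And>N. \<bar>cdf (\<mu> (s N)) t - cdf M t\<bar> \<ge> e"
      using bad by metis
    have "filterlim s at_top sequentially"
      unfolding filterlim_at_top eventually_sequentially using s(1) order_trans by blast
    hence lim: "filterlim s (at_top_within P) sequentially"
      unfolding at_top_within_def by (simp add: filterlim_inf filterlim_principal s(2))
    have "weak_conv_m (\<lambda>N. \<mu> (s N)) M"
      by (rule levy_continuity[OF \<mu> M]) (rule filterlim_compose[OF conv lim])
    hence "(\<lambda>N. cdf (\<mu> (s N)) t) \<longlonglongrightarrow> cdf M t" using t by (simp add: weak_conv_m_def weak_conv_def)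
    hence "eventually (\<lambda>N. dist (cdf (\<mu> (s N)) t) (cdf M t) < e) sequentially" using e by (rule tendstoD)
    then obtain N where "dist (cdf (\<mu> (s N)) t) (cdf M t) < e"
      using eventually_happens'[OF sequentially_bot] by blast
    thus False using s(3)[of N] by (simp add: dist_real_def)
  qed
qed

text \<open>Take for \<open>q\<close> the largest \<open>l \<le> q\<close> with
  \<open>\<Phi> l q\<close>. Each fixed level is eventually available, so this maximum tends to
  infinity. The inserted 0 keeps the set nonempty, and \<open>\<Phi> 0\<close> is eventually true by
  assumption.\<close>

lemma diagonal_level:
  fixes \<Phi> :: "nat \<Rightarrow> nat \<Rightarrow> bool"
  assumes "\<And>l. eventually (\<Phi> l) (at_top_within P)"
  shows "\<exists>lev. filterlim lev at_top (at_top_within P) \<and> eventually (\<lambda>q. \<Phi> (lev q) q) (at_top_within P)"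
proof -
  define lev where "lev q = Max (insert 0 {l. l \<le> q \<and> \<Phi> l q})" for q
  have fin: "finite (insert 0 {l. l \<le> q \<and> \<Phi> l q})" for q by simp
  have "eventually (\<lambda>q. lev q \<ge> L) (at_top_within P)" for L
  proof -
    have "eventually (\<lambda>q. q \<ge> L) (at_top_within P)"
      unfolding at_top_within_def by (rule filter_leD[OF inf_le1 eventually_ge_at_top])
    with assms[of L] show ?thesis
      by eventually_elim (auto simp: lev_def intro!: Max_ge)
  qed
  hence "filterlim lev at_top (at_top_within P)" by (simp add: filterlim_at_top)
  moreover have "eventually (\<lambda>q. \<Phi> (lev q) q) (at_top_within P)"
    using assms[of 0]
  proof eventually_elim
    case (elim q)
    have "lev q \<in> insert 0 {l. l \<le> q \<and> \<Phi> l q}" unfolding lev_def by (rule Max_in[OF fin]) simp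
    thus ?case using elim by auto
  qed
  ultimately show ?thesis by blast
qed

lemma moments_tendsto_gaussian:
  fixes \<mu> :: "'i \<Rightarrow> nat \<Rightarrow> real"
  assumes m0: "eventually (\<lambda>q. \<mu> q 0 = 1) F" and m1: "eventually (\<lambda>q. \<mu> q 1 = 0) F"
    and m2: "((\<lambda>q. \<mu> q 2) \<longlongrightarrow> 1) F"
    and rec: "\<And>m. m \<ge> 2 \<Longrightarrow> ((\<lambda>q. \<mu> q m - real (m - 1) * \<mu> q 2 * \<mu> q (m - 2)) \<longlongrightarrow> 0) F"
  shows "((\<lambda>q. \<mu> q m) \<longlongrightarrow> gaussian_moment m) F"
proof (induction m rule: gaussian_moment.induct)
  case 1
  show ?case using m0 by (simp add: tendsto_eventually)
next
  case 2
  show ?case using m1 by (simp add: tendsto_eventually)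
next
  case (3 m)
  have "((\<lambda>q. (\<mu> q (Suc (Suc m)) - real (Suc m) * \<mu> q 2 * \<mu> q m) + real (Suc m) * \<mu> q 2 * \<mu> q m)
     \<longlongrightarrow> 0 + real (Suc m) * 1 * gaussian_moment m) F"
    using rec[of "Suc (Suc m)"] by (intro tendsto_intros m2 3) (simp add: numeral_2_eq_2)
  thus ?case by simp
qed

section \<open>Exceptional primes and the limit theorem\<close>

text \<open>The ratio \<open>q / H\<close> is rounded to \<open>exp (sqrt n)\<close>. This grid is coarse enough for
  \<open>exp (-c sqrt n)\<close> to be summable for every \<open>c > 0\<close>, and fine enough for the quotient of
  consecutive grid points to tend to \<open>1\<close>.\<close>

definition grid_index :: "(nat \<Rightarrow> real) \<Rightarrow> nat \<Rightarrow> nat" where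
  "grid_index H q = nat \<lfloor>(ln (real q / H q))\<^sup>2\<rfloor>"

text \<open>The conditions under which the bound with threshold \<open>A l\<close> is available for
  a block containing \<open>q\<close>, expressed through \<open>q\<close> alone: for
  \<open>q\<close> in \<open>[Q, 2Q]\<close> one has \<open>q div 2 \<le> Q\<close> and
  \<open>ln (q / 2) \<le> ln Q\<close>. The condition \<open>l \<le> grid_index H q\<close> leaves
  at most \<open>n\<close> levels for each grid point \<open>n\<close>.\<close>

definition admissible :: "(nat \<Rightarrow> nat) \<Rightarrow> (nat \<Rightarrow> real) \<Rightarrow> nat \<Rightarrow> nat \<Rightarrow> bool" where
  "admissible A H l q \<longleftrightarrow> 1 \<le> l \<and> l \<le> grid_index H q \<and> A l \<le> grid_index H q \<and> A l \<le> q div 2 \<and>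
     real (A l) * sqrt (real (grid_index H q)) \<le> ln (real q / 2)"

definition good_primes :: "(nat \<Rightarrow> nat) \<Rightarrow> (nat \<Rightarrow> real) \<Rightarrow> nat set" where
  "good_primes A H = {q. prime q \<and> q > 2 \<and> (\<forall>l. admissible A H l q \<longrightarrow> typical l (grid_index H q) q)}"

section \<open>The density of the good primes\<close>

lemma powr_Suc_le:
  assumes "n \<ge> 1" "0 \<le> a" "a \<le> 1"
  shows "(real n + 1) powr a \<le> real n powr a + 1"
proof -
  have n: "real n > 0" using assms by simp
  have "(real n + 1) powr a = real n powr a * (1 + 1 / real n) powr a"
  proof -
    have "real n + 1 = real n * (1 + 1 / real n)" using n by (simp add: field_simps)
    thus ?thesis using powr_mult[of "real n" "1 + 1 / real n" a] by simp
  qed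
  also have "(1 + 1 / real n) powr a \<le> (1 + 1 / real n) powr 1"
    using assms n by (intro powr_mono) auto
  also have "real n powr a * (1 + 1 / real n) powr 1 = real n powr a + real n powr (a - 1)"
    using n by (simp add: powr_diff field_simps)
  also have "real n powr (a - 1) \<le> real n powr 0"
    using assms by (intro powr_mono) auto
  finally show ?thesis using n by simp
qed

lemma sum_inverse_squares_le_2:
  assumes "finite S" "\<And>n. n \<in> S \<Longrightarrow> n \<ge> (1::nat)"
  shows "(\<Sum>n\<in>S. 1 / (real n)\<^sup>2) \<le> 2"
proof -
  define M where "M = Max (insert 1 S)"
  have "S \<subseteq> insert 1 {1<..M}"
  proof
    fix n assume n: "n \<in> S"
    have "n \<le> M" unfolding M_def using assms(1) n by (intro Max_ge) auto
    thus "n \<in> insert 1 {1<..M}" using assms(2)[OF n] by (cases "n = 1") auto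
  qed
  hence "(\<Sum>n\<in>S. 1 / (real n)\<^sup>2) \<le> (\<Sum>n\<in>insert 1 {1<..M}. 1 / (real n)\<^sup>2)"
    by (intro sum_mono2) auto
  also have "\<dots> \<le> 2" using sum_inverse_squares_tail[of 1 M] by simp
  finally show ?thesis .
qed

text \<open>Rounding changes the squared logarithm by less than 1, hence its power 3/8 by at most 1;
  this costs the factor \<open>exp 1\<close>. The exponent 3/8 of the square is the exponent 3/4 of
  the logarithm.\<close>

lemma exp_grid_index_le:
  assumes H: "1 \<le> H q" "H q \<le> real q" and n: "grid_index H q \<ge> 1"
    and \<mu>: "\<mu> \<le> ln (real q / H q) powr (3/4)"
  shows "exp (- (real (grid_index H q) powr (3/8))) \<le> exp 1 * exp (- \<mu>)"
proof -
  define x where "x = ln (real q / H q)"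
  have x: "x \<ge> 0" using H by (simp add: x_def)
  have "x\<^sup>2 < real (grid_index H q) + 1" unfolding grid_index_def x_def[symmetric] using x by linarith
  hence "(x\<^sup>2) powr (3/8) \<le> (real (grid_index H q) + 1) powr (3/8)" by (intro powr_mono2) auto
  also have "\<dots> \<le> real (grid_index H q) powr (3/8) + 1" using n by (intro powr_Suc_le) auto
  finally have "(x\<^sup>2) powr (3/8) \<le> real (grid_index H q) powr (3/8) + 1" .
  moreover have "(x\<^sup>2) powr (3/8) = x powr (3/4)"
    using x by (cases "x = 0") (simp_all add: powr_powr flip: powr_numeral)
  ultimately have "- (real (grid_index H q) powr (3/8)) \<le> 1 + - \<mu>" using \<mu> by (simp add: x_def)
  thus ?thesis unfolding exp_add[symmetric] by (simp only: exp_le_cancel_iff)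
qed

text \<open>A union bound over the grid points met in the block and the at most \<open>n\<close>
  levels at each. The factor \<open>1 / n ^ 3\<close> leaves \<open>1 / n\<^sup>2\<close>, whose sum
  is at most 2, and rounding costs \<open>exp 1\<close>, whence the constant
  \<open>2 * exp 1\<close>.\<close>

lemma good_primes_density:
  assumes H: "\<And>q. prime q \<Longrightarrow> 1 \<le> H q \<and> H q \<le> real q" and Q: "Q \<ge> 3"
    and A: "\<And>l n Q. 1 \<le> l \<Longrightarrow> A l \<le> n \<Longrightarrow> A l \<le> Q \<Longrightarrow> ln (real Q) \<ge> real (A l) * sqrt (real n) \<Longrightarrow>
      real (card {q \<in> primes_dyadic Q. \<not> typical l n q}) \<le>
      exp (- (real n powr (3/8))) / real n ^ 3 * real (card (primes_dyadic Q))"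
  shows "real (card (good_primes A H \<inter> {Q..2*Q})) \<ge> (1 - 2 * exp 1 *
    exp (- Min ((\<lambda>q. ln (real q / H q) powr (3/4)) ` primes_dyadic Q))) * real (card (primes_dyadic Q))"
proof -
  define D where "D = primes_dyadic Q"
  define \<pi>Q where "\<pi>Q = real (card D)"
  define \<mu> where "\<mu> = Min ((\<lambda>q. ln (real q / H q) powr (3/4)) ` D)"
  define bad where "bad = D - good_primes A H"
  define S where "S = {n \<in> grid_index H ` D. n \<ge> 1}"
  define L where "L n = {l \<in> {1..n}. A l \<le> n \<and> A l \<le> Q \<and> real (A l) * sqrt (real n) \<le> ln (real Q)}" for n
  define B where "B l n = {q \<in> D. \<not> typical l n q}" for l n
  have finD: "finite D" by (simp add: D_def)
  have finS: "finite S" using finD by (simp add: S_def)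
  have finL: "finite (L n)" for n by (simp add: L_def)
  have Dp: "prime q" "Q \<le> q" "q \<le> 2 * Q" if "q \<in> D" for q using that by (auto simp: D_def primes_dyadic_def)
  have sub: "bad \<subseteq> (\<Union>n\<in>S. \<Union>l\<in>L n. B l n)"
  proof
    fix q assume q: "q \<in> bad"
    hence qD: "q \<in> D" by (simp add: bad_def)
    then obtain l where l: "admissible A H l q" "\<not> typical l (grid_index H q) q"
      using q Dp[OF qD] Q by (auto simp: bad_def good_primes_def)
    define n where "n = grid_index H q"
    have "n \<ge> 1" using l by (auto simp: admissible_def n_def)
    hence nS: "n \<in> S" using qD by (auto simp: S_def n_def)
    have "q div 2 \<le> Q" using Dp[OF qD] by simp
    moreover have "ln (real q / 2) \<le> ln (real Q)" using Dp[OF qD] Q by (subst ln_le_cancel_iff) auto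
    ultimately have "l \<in> L n" using l(1) by (auto simp: admissible_def L_def n_def)
    moreover have "q \<in> B l n" using qD l(2) by (simp add: B_def n_def)
    ultimately show "q \<in> (\<Union>n\<in>S. \<Union>l\<in>L n. B l n)" using nS by blast
  qed
  have "card bad \<le> card (\<Union>n\<in>S. \<Union>l\<in>L n. B l n)"
    using finD finS finL by (intro card_mono sub) (auto simp: B_def)
  also have "\<dots> \<le> (\<Sum>n\<in>S. card (\<Union>l\<in>L n. B l n))" by (rule card_UN_le[OF finS])
  also have "\<dots> \<le> (\<Sum>n\<in>S. \<Sum>l\<in>L n. card (B l n))" by (intro sum_mono card_UN_le finL)
  finally have "real (card bad) \<le> real (\<Sum>n\<in>S. \<Sum>l\<in>L n. card (B l n))" by (simp only: of_nat_le_iff)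
  also have "\<dots> = (\<Sum>n\<in>S. \<Sum>l\<in>L n. real (card (B l n)))" by simp
  also have "\<dots> \<le> (\<Sum>n\<in>S. \<Sum>l\<in>L n. exp 1 * exp (- \<mu>) * (1 / real n ^ 3) * \<pi>Q)"
  proof (intro sum_mono)
    fix n l assume n: "n \<in> S" and l: "l \<in> L n"
    obtain q where q: "q \<in> D" "n = grid_index H q" and n1: "n \<ge> 1" using n by (auto simp: S_def)
    have "\<mu> \<le> ln (real q / H q) powr (3/4)" unfolding \<mu>_def using q finD by (intro Min_le) auto
    hence E: "exp (- (real n powr (3/8))) \<le> exp 1 * exp (- \<mu>)"
      using exp_grid_index_le[of H q \<mu>] H[OF Dp(1)[OF q(1)]] n1 q(2) by simp
    have "real (card (B l n)) \<le> exp (- (real n powr (3/8))) / real n ^ 3 * \<pi>Q"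
      unfolding B_def D_def \<pi>Q_def using l by (intro A) (auto simp: L_def)
    also have "\<dots> = exp (- (real n powr (3/8))) * (1 / real n ^ 3) * \<pi>Q" by simp
    also have "\<dots> \<le> exp 1 * exp (- \<mu>) * (1 / real n ^ 3) * \<pi>Q"
      by (intro mult_right_mono E) (auto simp: \<pi>Q_def)
    finally show "real (card (B l n)) \<le> exp 1 * exp (- \<mu>) * (1 / real n ^ 3) * \<pi>Q" .
  qed
  also have "\<dots> \<le> (\<Sum>n\<in>S. exp 1 * exp (- \<mu>) * \<pi>Q * (1 / (real n)\<^sup>2))"
  proof (intro sum_mono)
    fix n assume n: "n \<in> S"
    have "card (L n) \<le> card {1..n}" by (intro card_mono) (auto simp: L_def)
    hence "real (card (L n)) \<le> real n" by simp
    hence "real (card (L n)) * (exp 1 * exp (- \<mu>) * (1 / real n ^ 3) * \<pi>Q) \<le> real n * (exp 1 * exp (- \<mu>) * (1 / real n ^ 3) * \<pi>Q)"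
      by (intro mult_right_mono) (auto simp: \<pi>Q_def)
    also have "\<dots> = exp 1 * exp (- \<mu>) * \<pi>Q * (1 / (real n)\<^sup>2)"
      using n by (simp add: S_def power2_eq_square power3_eq_cube)
    finally show "(\<Sum>l\<in>L n. exp 1 * exp (- \<mu>) * (1 / real n ^ 3) * \<pi>Q) \<le> exp 1 * exp (- \<mu>) * \<pi>Q * (1 / (real n)\<^sup>2)"
      by simp
  qed
  also have "\<dots> = exp 1 * exp (- \<mu>) * \<pi>Q * (\<Sum>n\<in>S. 1 / (real n)\<^sup>2)" by (simp add: sum_distrib_left)
  also have "\<dots> \<le> exp 1 * exp (- \<mu>) * \<pi>Q * 2"
    using finS by (intro mult_left_mono sum_inverse_squares_le_2) (auto simp: S_def \<pi>Q_def)
  finally have bad: "real (card bad) \<le> 2 * exp 1 * exp (- \<mu>) * \<pi>Q" by simp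
  have "good_primes A H \<inter> {Q..2*Q} = D - bad"
    by (auto simp: good_primes_def D_def bad_def primes_dyadic_def)
  moreover have "real (card (D - bad)) = \<pi>Q - real (card bad)"
    using finD by (simp add: \<pi>Q_def card_Diff_subset bad_def card_mono of_nat_diff)
  ultimately show ?thesis using bad by (simp add: \<pi>Q_def \<mu>_def D_def algebra_simps)
qed

section \<open>The limit theorem along the good primes\<close>

lemma avg_l2_triangle:
  fixes f g :: "int \<Rightarrow> real"
  shows "sqrt (avg q (\<lambda>x. (f x + g x)\<^sup>2)) \<le> sqrt (avg q (\<lambda>x. (f x)\<^sup>2)) + sqrt (avg q (\<lambda>x. (g x)\<^sup>2))"
proof -
  have "sqrt (avg q (\<lambda>x. (h x)\<^sup>2)) = L2_set h {0..<int q} / sqrt (real q)" for h :: "int \<Rightarrow> real"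
    by (simp add: avg_def L2_set_def real_sqrt_divide)
  thus ?thesis
    using L2_set_triangle_ineq[of f g "{0..<int q}"]
    by (simp add: divide_right_mono flip: add_divide_distrib)
qed

locale short_interval_length =
  fixes H :: "nat \<Rightarrow> real"
  assumes H_range: "\<And>q. prime q \<Longrightarrow> 1 \<le> H q \<and> H q \<le> real q"
    and H_log: "((\<lambda>q. ln (real q / H q) / ln (real q)) \<longlongrightarrow> 0) (at_top_within {q. prime q})"
    and H_small: "H \<in> o[at_top_within {q. prime q}](\<lambda>q. real q)"
begin

abbreviation "\<P> \<equiv> at_top_within {q :: nat. prime q}"

abbreviation "n\<^sub>H \<equiv> grid_index H"

definition density_ratio :: "nat \<Rightarrow> real" where
  "density_ratio q = H q / (real q * grid_scale (n\<^sub>H q))"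

lemma eventually_prime: "eventually prime \<P>"
  by (simp add: at_top_within_def eventually_inf_principal)

lemma eventually_ge: "eventually (\<lambda>q. q \<ge> (N::nat)) (at_top_within P)"
  unfolding at_top_within_def by (rule filter_leD[OF inf_le1 eventually_ge_at_top])

lemma real_at_top: "filterlim real at_top \<P>"
  unfolding at_top_within_def
  by (rule filterlim_mono[OF filterlim_real_sequentially order_refl inf_le1])

lemma H_over_q: "((\<lambda>q. H q / real q) \<longlongrightarrow> 0) \<P>"
  by (rule smalloD_tendsto[OF H_small])

lemma eventually_range: "eventually (\<lambda>q. 1 \<le> H q \<and> H q \<le> real q \<and> prime q) \<P>"
  using eventually_prime by eventually_elim (use H_range in auto)

lemma ln_ratio_at_top: "filterlim (\<lambda>q. ln (real q / H q)) at_top \<P>"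
proof (rule filterlim_compose[OF ln_at_top])
  have "filterlim (\<lambda>q. inverse (H q / real q)) at_top \<P>"
    by (rule filterlim_inverse_at_top[OF H_over_q])
       (use eventually_range in \<open>eventually_elim, auto simp: prime_gt_0_nat\<close>)
  thus "filterlim (\<lambda>q. real q / H q) at_top \<P>" by simp
qed

lemma H_at_top: "filterlim H at_top \<P>"
proof (rule filterlim_at_top_mono)
  show "filterlim (\<lambda>q. sqrt (real q)) at_top \<P>"
    by (rule filterlim_compose[OF sqrt_at_top real_at_top])
  have "eventually (\<lambda>q. ln (real q / H q) / ln (real q) < 1 / 2) \<P>"
    by (rule order_tendstoD[OF H_log]) simp
  thus "eventually (\<lambda>q. sqrt (real q) \<le> H q) \<P>"
    using eventually_range eventually_ge[of 2]
  proof eventually_elim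
    case (elim q)
    hence q: "ln (real q) > 0" "real q > 0" "H q > 0" by auto
    hence "ln (real q / H q) < ln (real q) / 2" using elim by (simp add: field_simps)
    hence "ln (real q) / 2 \<le> ln (H q)" using q by (simp add: ln_div)
    hence "ln (sqrt (real q)) \<le> ln (H q)" using q by (simp add: ln_sqrt)
    thus ?case using q by simp
  qed
qed

lemma inverse_H: "((\<lambda>q. 1 / H q) \<longlongrightarrow> 0) \<P>"
  using tendsto_inverse_0_at_top[OF H_at_top] by (simp add: inverse_eq_divide)

lemma sqrt_grid_index_le:
  assumes "1 \<le> H q" "H q \<le> real q"
  shows "sqrt (real (n\<^sub>H q)) \<le> ln (real q / H q)"
proof -
  have "ln (real q / H q) \<ge> 0" using assms by simp
  thus ?thesis by (intro real_le_lsqrt) (auto simp: grid_index_def)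
qed

text \<open>With \<open>x\<close> the logarithm and \<open>s\<close> its rounded value,
  \<open>(x - s) * (x + s) \<le> 1\<close>. The absolute error of the logarithm thus tends to 0, so
  the true and the rounded density become asymptotically equal.\<close>

lemma sqrt_grid_index_diff:
  assumes "1 \<le> H q" "H q \<le> real q" "ln (real q / H q) > 0"
  shows "ln (real q / H q) - sqrt (real (n\<^sub>H q)) \<le> 1 / ln (real q / H q)"
proof -
  define x where "x = ln (real q / H q)"
  define s where "s = sqrt (real (n\<^sub>H q))"
  have x: "x > 0" "s \<le> x" "s \<ge> 0" using sqrt_grid_index_le[of q] assms by (auto simp: x_def s_def)
  have "s\<^sup>2 = real (n\<^sub>H q)" by (simp add: s_def)
  hence "x\<^sup>2 - s\<^sup>2 \<le> 1" using x unfolding grid_index_def x_def[symmetric] by linarith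
  hence "(x - s) * (x + s) \<le> 1" by (simp add: power2_eq_square algebra_simps)
  moreover have "(x - s) * x \<le> (x - s) * (x + s)" using x by (intro mult_left_mono) auto
  ultimately have "(x - s) * x \<le> 1" by linarith
  thus ?thesis using x by (simp add: x_def[symmetric] s_def[symmetric] pos_le_divide_eq)
qed

lemma sqrt_grid_index_diff_tendsto: "((\<lambda>q. sqrt (real (n\<^sub>H q)) - ln (real q / H q)) \<longlongrightarrow> 0) \<P>"
proof (rule tendsto_sandwich)
  show "((\<lambda>q. - (1 / ln (real q / H q))) \<longlongrightarrow> 0) \<P>"
    using tendsto_minus[OF tendsto_inverse_0_at_top[OF ln_ratio_at_top]] by (simp add: inverse_eq_divide)
  show "((\<lambda>q. 0) \<longlongrightarrow> (0::real)) \<P>" by simp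
  have pos: "eventually (\<lambda>q. ln (real q / H q) > 0) \<P>"
    using ln_ratio_at_top by (rule filterlim_at_top_dense[THEN iffD1, rule_format])
  show "eventually (\<lambda>q. - (1 / ln (real q / H q)) \<le> sqrt (real (n\<^sub>H q)) - ln (real q / H q)) \<P>"
    using pos eventually_range
  proof eventually_elim
    case (elim q)
    thus ?case using sqrt_grid_index_diff[of q] by linarith
  qed
  show "eventually (\<lambda>q. sqrt (real (n\<^sub>H q)) - ln (real q / H q) \<le> 0) \<P>"
    using eventually_range
  proof eventually_elim
    case (elim q)
    thus ?case using sqrt_grid_index_le[of q] by linarith
  qed
qed

lemma density_ratio_tendsto: "(density_ratio \<longlongrightarrow> 1) \<P>"
proof -
  have "((\<lambda>q. exp (sqrt (real (n\<^sub>H q)) - ln (real q / H q))) \<longlongrightarrow> exp 0) \<P>"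
    by (intro tendsto_intros sqrt_grid_index_diff_tendsto)
  moreover have "eventually (\<lambda>q. exp (sqrt (real (n\<^sub>H q)) - ln (real q / H q)) = density_ratio q) \<P>"
    using eventually_range
  proof eventually_elim
    case (elim q)
    hence "real q > 0" "H q > 0" by (auto simp: prime_gt_0_nat)
    thus ?case by (simp add: density_ratio_def grid_scale_def exp_diff exp_minus field_simps)
  qed
  ultimately show ?thesis by (simp add: tendsto_cong)
qed

lemma grid_index_at_top: "filterlim n\<^sub>H at_top \<P>"
proof -
  have "filterlim (\<lambda>q. (ln (real q / H q))\<^sup>2) at_top \<P>"
    by (rule filterlim_pow_at_top[OF _ ln_ratio_at_top]) simp
  hence "filterlim (\<lambda>q. nat \<lfloor>(ln (real q / H q))\<^sup>2\<rfloor>) at_top \<P>"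
    by (intro filterlim_compose[OF filterlim_nat_sequentially] filterlim_compose[OF filterlim_floor_sequentially])
  thus ?thesis by (simp add: grid_index_def[abs_def])
qed

text \<open>The cutoff is at most \<open>l * q / H\<close>, so the quotient is at most
  \<open>l / H\<close>. Frequencies in any fixed number of factors therefore cannot wrap around
  modulo \<open>q\<close>.\<close>

lemma cutoff_over_q: "l \<ge> 1 \<Longrightarrow> ((\<lambda>q. real (cutoff l (n\<^sub>H q)) / real q) \<longlongrightarrow> 0) \<P>"
proof (rule tendsto_sandwich)
  assume l: "l \<ge> 1"
  show "((\<lambda>q. 0) \<longlongrightarrow> (0::real)) \<P>" by simp
  show "((\<lambda>q. real l * (1 / H q)) \<longlongrightarrow> 0) \<P>"
    using tendsto_mult_left[OF inverse_H, of "real l"] by simp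
  show "eventually (\<lambda>q. 0 \<le> real (cutoff l (n\<^sub>H q)) / real q) \<P>" by simp
  show "eventually (\<lambda>q. real (cutoff l (n\<^sub>H q)) / real q \<le> real l * (1 / H q)) \<P>"
    using eventually_range
  proof eventually_elim
    case (elim q)
    hence q: "real q > 0" "H q > 0" by (auto simp: prime_gt_0_nat)
    have "real (cutoff l (n\<^sub>H q)) \<le> real l / grid_scale (n\<^sub>H q)" by (rule cutoff_bounds(2)[OF l])
    also have "\<dots> = real l * exp (sqrt (real (n\<^sub>H q)))" by (simp add: grid_scale_def exp_minus divide_inverse)
    also have "\<dots> \<le> real l * exp (ln (real q / H q))"
    proof (intro mult_left_mono)
      show "exp (sqrt (real (n\<^sub>H q))) \<le> exp (ln (real q / H q))"
        unfolding exp_le_cancel_iff by (rule sqrt_grid_index_le) (use elim in auto)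
    qed simp
    also have "\<dots> = real l * (real q / H q)" using q by simp
    finally show ?case using q by (simp add: field_simps)
  qed
qed

lemma floor_H_tendsto: "((\<lambda>q. of_int \<lfloor>H q\<rfloor> / H q) \<longlongrightarrow> (1::real)) \<P>"
proof (rule tendsto_sandwich)
  show "((\<lambda>q. 1 - 1 / H q) \<longlongrightarrow> 1) \<P>" using tendsto_diff[OF tendsto_const inverse_H, of 1] by simp
  show "((\<lambda>q. 1) \<longlongrightarrow> (1::real)) \<P>" by simp
  show "eventually (\<lambda>q. 1 - 1 / H q \<le> of_int \<lfloor>H q\<rfloor> / H q) \<P>"
    using eventually_range
  proof eventually_elim
    case (elim q)
    hence "(H q - 1) / H q \<le> of_int \<lfloor>H q\<rfloor> / H q" by (intro divide_right_mono) (linarith, simp)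
    thus ?case using elim by (simp add: diff_divide_distrib)
  qed
  show "eventually (\<lambda>q. of_int \<lfloor>H q\<rfloor> / H q \<le> (1::real)) \<P>"
    using eventually_range by eventually_elim (simp add: divide_le_eq)
qed

lemma second_moment_tendsto: "((\<lambda>q. avg q (\<lambda>x. (normalized_sum q (H q) x)\<^sup>2)) \<longlongrightarrow> 1) \<P>"
proof -
  have "((\<lambda>q. of_int \<lfloor>H q\<rfloor> / H q - (of_int \<lfloor>H q\<rfloor> / H q)\<^sup>2 * (H q / real q)) \<longlongrightarrow> 1 - 1\<^sup>2 * 0) \<P>"
    by (intro tendsto_intros floor_H_tendsto H_over_q)
  moreover have "eventually (\<lambda>q. of_int \<lfloor>H q\<rfloor> / H q - (of_int \<lfloor>H q\<rfloor> / H q)\<^sup>2 * (H q / real q) =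
      avg q (\<lambda>x. (normalized_sum q (H q) x)\<^sup>2)) \<P>"
    using eventually_range eventually_ge[of 3]
  proof eventually_elim
    case (elim q)
    thus ?case using normalized_sum_second_moment[of q "H q"]
      by (simp add: power2_eq_square)
  qed
  ultimately show ?thesis by (simp add: tendsto_cong)
qed

text \<open>For fixed \<open>l\<close> the coefficient error tends to 0, and the truncation tail
  tends to \<open>64 / l\<close>; 65 leaves room for the limit.\<close>

lemma l2_error_eventually:
  assumes l: "l \<ge> 1"
  shows "eventually (\<lambda>q. avg q (\<lambda>x. (normalized_sum q (H q) x - Re (trig_poly l (n\<^sub>H q) q x))\<^sup>2) \<le> 65 / real l) \<P>"
proof -
  define err where "err q = 2 * real l * density_ratio q * (pi * (real (cutoff l (n\<^sub>H q)) / real q) +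
      \<bar>1 / density_ratio q - of_int \<lfloor>H q\<rfloor> / H q\<bar> + \<bar>1 - sqrt (density_ratio q)\<bar> / density_ratio q)\<^sup>2
     + 64 / (density_ratio q * real l)" for q
  have "(err \<longlongrightarrow> 2 * real l * 1 * (pi * 0 + \<bar>1 / 1 - 1\<bar> + \<bar>1 - sqrt 1\<bar> / 1)\<^sup>2 + 64 / (1 * real l)) \<P>"
    unfolding err_def
    by (intro tendsto_intros density_ratio_tendsto cutoff_over_q floor_H_tendsto l) (use l in auto)
  hence "(err \<longlongrightarrow> 64 / real l) \<P>" by simp
  hence "eventually (\<lambda>q. err q < 65 / real l) \<P>" by (rule order_tendstoD) (use l in \<open>simp add: divide_strict_right_mono\<close>)
  moreover have "eventually (\<lambda>q. real (cutoff l (n\<^sub>H q)) / real q < 1 / 3) \<P>"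
    by (rule order_tendstoD[OF cutoff_over_q[OF l]]) simp
  ultimately show ?thesis using eventually_range eventually_ge[of 3]
  proof eventually_elim
    case (elim q)
    have q: "prime q" "q > 2" "H q \<ge> 1" using elim by auto
    have "3 * cutoff l (n\<^sub>H q) < q" using elim q by (simp add: field_simps)
    hence N: "cutoff l (n\<^sub>H q) \<le> q div 2" by linarith
    have "avg q (\<lambda>x. (normalized_sum q (H q) x - Re (trig_poly l (n\<^sub>H q) q x))\<^sup>2) =
      (\<Sum>x\<in>{0..<int q}. cmod (of_real (normalized_sum q (H q) x) - trig_poly l (n\<^sub>H q) q x) ^ 2) / real q"
    proof -
      have "cmod (of_real (normalized_sum q (H q) x) - trig_poly l (n\<^sub>H q) q x) ^ 2 =
        (normalized_sum q (H q) x - Re (trig_poly l (n\<^sub>H q) q x))\<^sup>2" for x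
      proof -
        have "of_real (normalized_sum q (H q) x) - trig_poly l (n\<^sub>H q) q x =
          complex_of_real (normalized_sum q (H q) x - Re (trig_poly l (n\<^sub>H q) q x))"
          using trig_poly_real[OF q(1,2), of l "n\<^sub>H q" x] by simp
        thus ?thesis by (simp only: norm_of_real power2_abs)
      qed
      thus ?thesis by (simp add: avg_def)
    qed
    also have "\<dots> \<le> err q"
      unfolding err_def density_ratio_def
      using trig_poly_l2_error[OF q l N] by simp
    finally show ?case using elim by linarith
  qed
qed

lemma admissible_eventually:
  assumes l: "l \<ge> 1"
  shows "eventually (admissible A H l) \<P>"
proof -
  \<comment> \<open>Chosen so that \<open>(A l + 1) * \<delta> = 1 / 2\<close>: then
    \<open>A l * sqrt n \<le> ln q / 2\<close>, which is at most \<open>ln (q / 2)\<close> for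
    \<open>q \<ge> 4\<close>.\<close>
  define \<delta> where "\<delta> = 1 / (2 * (real (A l) + 1))"
  have \<delta>: "\<delta> > 0" by (simp add: \<delta>_def)
  have "eventually (\<lambda>q. ln (real q / H q) / ln (real q) < \<delta>) \<P>" by (rule order_tendstoD(2)[OF H_log \<delta>])
  moreover have "eventually (\<lambda>q. n\<^sub>H q \<ge> max l (A l)) \<P>"
    using grid_index_at_top by (simp only: filterlim_at_top)
  ultimately show ?thesis using eventually_range eventually_ge[of "max 4 (2 * A l)"]
  proof eventually_elim
    case (elim q)
    have q: "real q \<ge> 4" using elim by simp
    have lnq: "ln (real q) > 0" using q by simp
    have "real (A l) * sqrt (real (n\<^sub>H q)) \<le> (real (A l) + 1) * ln (real q / H q)"
      using sqrt_grid_index_le[of q] elim by (intro mult_mono) auto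
    also have "\<dots> \<le> (real (A l) + 1) * (\<delta> * ln (real q))"
      using elim lnq by (intro mult_left_mono) (auto simp: field_simps)
    also have "\<dots> = ln (real q) / 2" by (simp add: \<delta>_def field_simps)
    also have "\<dots> \<le> ln (real q / 2)"
    proof -
      have "ln (4::real) = 2 * ln 2" using ln_realpow[of 2 2] by simp
      moreover have "ln (real q) \<ge> ln 4" using q by simp
      ultimately show ?thesis using q by (simp add: ln_div)
    qed
    finally show ?case using l elim by (auto simp: admissible_def)
  qed
qed

text \<open>The level is allowed to grow with \<open>q\<close> so slowly that each fixed-level
  property persists. The \<open>L2\<close> error and the error in the moment recursion are then both
  \<open>O(1 / lev q)\<close>, so the moments of the trigonometric polynomial become Gaussian, and
  the short sum has the same limiting characteristic function.\<close>

theorem good_primes_clt: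
  "weak_conv_filter (\<lambda>q. legendre_sum_law q (H q)) std_normal_distribution (at_top_within (good_primes A H))"
proof -
  define P where "P = good_primes A H"
  define F where "F = at_top_within P"
  have FP: "F \<le> \<P>"
    unfolding F_def at_top_within_def by (intro inf_mono) (auto simp: P_def good_primes_def)
  have evP: "eventually (\<lambda>q. q \<in> P) F"
    by (simp add: F_def at_top_within_def eventually_inf_principal)
  define Y where "Y q = normalized_sum q (H q)" for q
  \<comment> \<open>Level 0 is made true by fiat; it is the default value in
    \<open>diagonal_level\<close> and is left behind as the level grows.\<close>
  define \<Phi> where "\<Phi> l q \<longleftrightarrow> l = 0 \<or> typical l (n\<^sub>H q) q \<and> (l + 1) * cutoff l (n\<^sub>H q) < q \<and>
    avg q (\<lambda>x. (Y q x - Re (trig_poly l (n\<^sub>H q) q x))\<^sup>2) \<le> 65 / real l" for l q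
  have "eventually (\<Phi> l) F" for l
  proof (cases "l = 0")
    case False
    hence l: "l \<ge> 1" by simp
    have "eventually (\<lambda>q. real (cutoff l (n\<^sub>H q)) / real q < 1 / (real l + 1)) \<P>"
      by (rule order_tendstoD[OF cutoff_over_q[OF l]]) simp
    hence "eventually (\<lambda>q. real (cutoff l (n\<^sub>H q)) / real q < 1 / (real l + 1)) F"
      by (rule filter_leD[OF FP])
    moreover have "eventually (admissible A H l) F"
      by (rule filter_leD[OF FP admissible_eventually[OF l]])
    moreover have "eventually (\<lambda>q. avg q (\<lambda>x. (Y q x - Re (trig_poly l (n\<^sub>H q) q x))\<^sup>2) \<le> 65 / real l) F"
      unfolding Y_def by (rule filter_leD[OF FP l2_error_eventually[OF l]])
    ultimately show ?thesis using evP
    proof eventually_elim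
      case (elim q)
      have q: "real q > 0" using elim(4) by (simp add: P_def good_primes_def)
      have "(real l + 1) * real (cutoff l (n\<^sub>H q)) < real q" using elim(1) q by (simp add: field_simps)
      hence "real ((l + 1) * cutoff l (n\<^sub>H q)) < real q" by (simp add: algebra_simps)
      hence "(l + 1) * cutoff l (n\<^sub>H q) < q" by (simp only: of_nat_less_iff)
      thus ?case using elim by (auto simp: \<Phi>_def P_def good_primes_def)
    qed
  next
    case True
    thus ?thesis by (intro always_eventually allI) (simp add: \<Phi>_def)
  qed
  then obtain lev where lev: "filterlim lev at_top F" "eventually (\<lambda>q. \<Phi> (lev q) q) F"
    using diagonal_level[of \<Phi> P] unfolding F_def by blast
  define X where "X q x = Re (trig_poly (lev q) (n\<^sub>H q) q x)" for q x
  have rlev: "filterlim (\<lambda>q. real (lev q)) at_top F"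
    by (rule filterlim_compose[OF filterlim_real_sequentially lev(1)])
  have inv: "((\<lambda>q. 1 / real (lev q)) \<longlongrightarrow> 0) F"
    using tendsto_inverse_0_at_top[OF rlev] by (simp add: inverse_eq_divide)
  have big: "eventually (\<lambda>q. lev q \<ge> M) F" for M
    using lev(1) by (simp add: filterlim_at_top)
  have props: "eventually (\<lambda>q. prime q \<and> q > 2 \<and> lev q \<ge> 1 \<and> typical (lev q) (n\<^sub>H q) q \<and>
      (lev q + 1) * cutoff (lev q) (n\<^sub>H q) < q \<and> avg q (\<lambda>x. (Y q x - X q x)\<^sup>2) \<le> 65 / real (lev q)) F"
    using lev(2) big[of 1] evP
    by eventually_elim (auto simp: \<Phi>_def X_def P_def good_primes_def)
  have D0: "((\<lambda>q. avg q (\<lambda>x. (Y q x - X q x)\<^sup>2)) \<longlongrightarrow> 0) F"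
  proof (rule tendsto_sandwich[where f = "\<lambda>_. 0" and h = "\<lambda>q. 65 * (1 / real (lev q))"])
    show "((\<lambda>q. 65 * (1 / real (lev q))) \<longlongrightarrow> 0) F" using tendsto_mult_left[OF inv, of 65] by simp
    show "eventually (\<lambda>q. avg q (\<lambda>x. (Y q x - X q x)\<^sup>2) \<le> 65 * (1 / real (lev q))) F"
      using props by eventually_elim simp
    show "eventually (\<lambda>q. 0 \<le> avg q (\<lambda>x. (Y q x - X q x)\<^sup>2)) F" by (simp add: avg_def sum_nonneg)
  qed simp
  have sD0: "((\<lambda>q. sqrt (avg q (\<lambda>x. (Y q x - X q x)\<^sup>2))) \<longlongrightarrow> 0) F"
    using tendsto_real_sqrt[OF D0] by simp
  have Y2: "((\<lambda>q. avg q (\<lambda>x. (Y q x)\<^sup>2)) \<longlongrightarrow> 1) F"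
    unfolding Y_def by (rule tendsto_mono[OF FP second_moment_tendsto])
  \<comment> \<open>The variance is transferred from the short sum, where it is known exactly, by
    the triangle inequality in \<open>L2\<close>.\<close>
  have X2: "((\<lambda>q. avg q (\<lambda>x. (X q x)\<^sup>2)) \<longlongrightarrow> 1) F"
  proof -
    have sY: "((\<lambda>q. sqrt (avg q (\<lambda>x. (Y q x)\<^sup>2))) \<longlongrightarrow> 1) F" using tendsto_real_sqrt[OF Y2] by simp
    have "((\<lambda>q. sqrt (avg q (\<lambda>x. (X q x)\<^sup>2))) \<longlongrightarrow> 1) F"
    proof (rule tendsto_sandwich)
      show "((\<lambda>q. sqrt (avg q (\<lambda>x. (Y q x)\<^sup>2)) - sqrt (avg q (\<lambda>x. (Y q x - X q x)\<^sup>2))) \<longlongrightarrow> 1) F"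
        using tendsto_diff[OF sY sD0] by simp
      show "((\<lambda>q. sqrt (avg q (\<lambda>x. (Y q x)\<^sup>2)) + sqrt (avg q (\<lambda>x. (Y q x - X q x)\<^sup>2))) \<longlongrightarrow> 1) F"
        using tendsto_add[OF sY sD0] by simp
      have "sqrt (avg q (\<lambda>x. (Y q x)\<^sup>2)) \<le> sqrt (avg q (\<lambda>x. (X q x)\<^sup>2)) + sqrt (avg q (\<lambda>x. (Y q x - X q x)\<^sup>2))" for q
        using avg_l2_triangle[of q "X q" "\<lambda>x. Y q x - X q x"] by simp
      thus "eventually (\<lambda>q. sqrt (avg q (\<lambda>x. (Y q x)\<^sup>2)) - sqrt (avg q (\<lambda>x. (Y q x - X q x)\<^sup>2)) \<le> sqrt (avg q (\<lambda>x. (X q x)\<^sup>2))) F"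
        by (simp add: algebra_simps)
      have "sqrt (avg q (\<lambda>x. (X q x)\<^sup>2)) \<le> sqrt (avg q (\<lambda>x. (Y q x)\<^sup>2)) + sqrt (avg q (\<lambda>x. (Y q x - X q x)\<^sup>2))" for q
        using avg_l2_triangle[of q "Y q" "\<lambda>x. X q x - Y q x"] by (simp add: power2_commute)
      thus "eventually (\<lambda>q. sqrt (avg q (\<lambda>x. (X q x)\<^sup>2)) \<le> sqrt (avg q (\<lambda>x. (Y q x)\<^sup>2)) + sqrt (avg q (\<lambda>x. (Y q x - X q x)\<^sup>2))) F"
        by simp
    qed
    hence "((\<lambda>q. (sqrt (avg q (\<lambda>x. (X q x)\<^sup>2)))\<^sup>2) \<longlongrightarrow> 1\<^sup>2) F" by (rule tendsto_power)
    thus ?thesis by (simp add: avg_def sum_nonneg)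
  qed
  have mom: "((\<lambda>q. avg q (\<lambda>x. X q x ^ m)) \<longlongrightarrow> gaussian_moment m) F" for m
  proof (rule moments_tendsto_gaussian[where \<mu> = "\<lambda>q m. avg q (\<lambda>x. X q x ^ m)"])
    show "eventually (\<lambda>q. avg q (\<lambda>x. X q x ^ 0) = 1) F"
      using props by eventually_elim (simp add: avg_def)
    show "eventually (\<lambda>q. avg q (\<lambda>x. X q x ^ 1) = 0) F"
      using props
    proof eventually_elim
      case (elim q)
      have "cutoff (lev q) (n\<^sub>H q) < q" using elim by auto
      thus ?case using trig_poly_mean_zero[of q "lev q" "n\<^sub>H q"] elim by (simp add: X_def)
    qed
    show "((\<lambda>q. avg q (\<lambda>x. (X q x)\<^sup>2)) \<longlongrightarrow> 1) F" by (rule X2)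
    fix m :: nat assume m: "m \<ge> 2"
    show "((\<lambda>q. avg q (\<lambda>x. X q x ^ m) - real (m - 1) * avg q (\<lambda>x. (X q x)\<^sup>2) * avg q (\<lambda>x. X q x ^ (m - 2))) \<longlongrightarrow> 0) F"
    proof (rule Lim_null_comparison[OF _ inv])
      show "eventually (\<lambda>q. norm (avg q (\<lambda>x. X q x ^ m) - real (m - 1) * avg q (\<lambda>x. (X q x)\<^sup>2) * avg q (\<lambda>x. X q x ^ (m - 2)))
        \<le> 1 / real (lev q)) F"
        using props big[of m]
      proof eventually_elim
        case (elim q)
        have "m * cutoff (lev q) (n\<^sub>H q) \<le> (lev q + 1) * cutoff (lev q) (n\<^sub>H q)"
          using elim by (intro mult_right_mono) auto
        hence "m * cutoff (lev q) (n\<^sub>H q) < q" using elim by linarith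
        hence "\<bar>avg q (\<lambda>x. X q x ^ m) - real (m - 1) * avg q (\<lambda>x. (X q x)\<^sup>2) * avg q (\<lambda>x. X q x ^ (m - 2))\<bar>
          \<le> defect (lev q) (n\<^sub>H q) m q"
          unfolding X_def using elim m by (intro trig_poly_moment_recursion) auto
        also have "\<dots> \<le> 1 / real (lev q)" using elim m by (auto simp: typical_def)
        finally show ?case by simp
      qed
    qed
  qed
  show ?thesis
  proof (rule weak_conv_filter_charI[OF real_distribution_legendre_sum_law real_dist_normal_dist])
    fix t
    have "((\<lambda>q. avg q (\<lambda>x. iexp (t * Y q x)) - avg q (\<lambda>x. iexp (t * X q x))) \<longlongrightarrow> 0) F"
    proof (rule Lim_null_comparison)
      show "eventually (\<lambda>q. norm (avg q (\<lambda>x. iexp (t * Y q x)) - avg q (\<lambda>x. iexp (t * X q x)))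
        \<le> \<bar>t\<bar> * sqrt (avg q (\<lambda>x. (Y q x - X q x)\<^sup>2))) F"
        by (intro always_eventually allI avg_iexp_l2_close)
      show "((\<lambda>q. \<bar>t\<bar> * sqrt (avg q (\<lambda>x. (Y q x - X q x)\<^sup>2))) \<longlongrightarrow> 0) F"
        using tendsto_mult_left[OF sD0, of "\<bar>t\<bar>"] by simp
    qed
    from tendsto_add[OF this method_of_moments[OF mom, of t]]
    have "((\<lambda>q. avg q (\<lambda>x. iexp (t * Y q x))) \<longlongrightarrow> of_real (exp (- t\<^sup>2 / 2))) F" by simp
    moreover have "eventually (\<lambda>q. avg q (\<lambda>x. iexp (t * Y q x)) = char (legendre_sum_law q (H q)) t) F"
      using props by eventually_elim (simp add: char_legendre_sum_law Y_def)
    ultimately show "((\<lambda>q. char (legendre_sum_law q (H q)) t) \<longlongrightarrow> char std_normal_distribution t) (at_top_within (good_primes A H))"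
      by (simp add: char_std_normal_distribution tendsto_cong F_def P_def)
  qed
qed

end

theorem theorem3:
  fixes H :: "nat \<Rightarrow> real"
  assumes H_range: "\<And>q. prime q \<Longrightarrow> 1 \<le> H q \<and> H q \<le> real q"
    and H_log: "((\<lambda>q. ln (real q / H q) / ln (real q)) \<longlongrightarrow> 0) (at_top_within {q. prime q})"
    and H_small: "H \<in> o[at_top_within {q. prime q}](\<lambda>q. real q)"
  shows "\<exists>P \<subseteq> {q. prime q}.
    (\<exists>C::real. \<forall>j::nat. let Q = 2 ^ j in
       real (card (P \<inter> {Q..2 * Q})) / real (card (primes_dyadic Q))
         \<ge> 1 - C * exp (- Min ((\<lambda>q. ln (real q / H q) powr (3/4)) ` primes_dyadic Q))) \<and>
    weak_conv_filter (\<lambda>q. legendre_sum_law q (H q)) std_normal_distribution (at_top_within P)"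
proof -
  interpret short_interval_length H
    by (rule short_interval_length.intro[OF assms])
  define rare where "rare l a \<longleftrightarrow> (\<forall>n Q. n \<ge> a \<longrightarrow> Q \<ge> a \<longrightarrow> ln (real Q) \<ge> real a * sqrt (real n) \<longrightarrow>
    real (card {q \<in> primes_dyadic Q. \<not> typical l n q}) \<le>
      exp (- (real n powr (3/8))) / real n ^ 3 * real (card (primes_dyadic Q)))" for l a
  \<comment> \<open>The thresholds chosen here depend on the level only, not on
    \<open>H\<close>.\<close>
  have "\<forall>l. \<exists>a. l \<ge> 1 \<longrightarrow> rare l a"
    unfolding rare_def using card_atypical_primes by blast
  from choice[OF this] obtain A where A0: "\<And>l. l \<ge> 1 \<Longrightarrow> rare l (A l)" by blast
  have A: "real (card {q \<in> primes_dyadic Q. \<not> typical l n q}) \<le>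
      exp (- (real n powr (3/8))) / real n ^ 3 * real (card (primes_dyadic Q))"
    if "1 \<le> l" "A l \<le> n" "A l \<le> Q" "ln (real Q) \<ge> real (A l) * sqrt (real n)" for l n Q
    using A0[OF that(1)] that(2-4) unfolding rare_def by blast
  define P where "P = good_primes A H"
  define \<mu> where "\<mu> Q = Min ((\<lambda>q. ln (real q / H q) powr (3/4)) ` primes_dyadic Q)" for Q
  obtain Q0 where Q0: "\<And>Q. Q \<ge> Q0 \<Longrightarrow> real (card (primes_dyadic Q)) \<ge> real Q / (4 * ln (real Q))"
    using card_primes_dyadic_ge by blast
  define j0 where "j0 = max Q0 2"
  \<comment> \<open>The finite sum makes the claimed lower bound nonpositive for the finitely many
    blocks with \<open>j < j0\<close>. For the others \<open>Q = 2 ^ j > j\<close> is at least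
    \<open>Q0\<close>, so the block contains primes, and \<open>j \<ge> 2\<close> gives
    \<open>Q \<ge> 3\<close>.\<close>
  define C where "C = 2 * exp 1 + (\<Sum>j<j0. exp (\<mu> (2 ^ j)))"
  have "real (card (P \<inter> {Q..2 * Q})) / real (card (primes_dyadic Q)) \<ge> 1 - C * exp (- \<mu> Q)"
    if Qj: "Q = 2 ^ j" for Q j
  proof (cases "j < j0")
    case True
    have "exp (\<mu> (2 ^ j)) \<le> (\<Sum>j<j0. exp (\<mu> (2 ^ j)))" using True by (intro member_le_sum) auto
    hence "exp (\<mu> Q) \<le> C" unfolding C_def Qj by (simp add: add_increasing)
    hence "exp (\<mu> Q) * exp (- \<mu> Q) \<le> C * exp (- \<mu> Q)" by (intro mult_right_mono) auto
    hence "1 - C * exp (- \<mu> Q) \<le> 0" by (simp add: exp_minus)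
    also have "\<dots> \<le> real (card (P \<inter> {Q..2 * Q})) / real (card (primes_dyadic Q))" by simp
    finally show ?thesis .
  next
    case False
    have "j < 2 ^ j" by (rule less_exp)
    hence "Q \<ge> Q0" using False unfolding Qj j0_def by linarith
    have "(2::nat) ^ 2 \<le> 2 ^ j" using False by (intro power_increasing) (auto simp: j0_def)
    hence Q3: "Q \<ge> 3" using Qj by simp
    have "real Q / (4 * ln (real Q)) > 0" using Q3 by simp
    hence pos: "real (card (primes_dyadic Q)) > 0" using Q0[OF \<open>Q \<ge> Q0\<close>] by linarith
    have "(1 - 2 * exp 1 * exp (- \<mu> Q)) * real (card (primes_dyadic Q)) \<le> real (card (P \<inter> {Q..2 * Q}))"
      unfolding P_def \<mu>_def by (rule good_primes_density[OF H_range Q3 A])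
    hence "1 - 2 * exp 1 * exp (- \<mu> Q) \<le> real (card (P \<inter> {Q..2 * Q})) / real (card (primes_dyadic Q))"
      using pos by (simp add: pos_le_divide_eq)
    moreover have "2 * exp 1 * exp (- \<mu> Q) \<le> C * exp (- \<mu> Q)"
      unfolding C_def by (intro mult_right_mono) (auto intro: sum_nonneg)
    ultimately show ?thesis by linarith
  qed
  hence "\<exists>C::real. \<forall>j::nat. let Q = 2 ^ j in
       real (card (P \<inter> {Q..2 * Q})) / real (card (primes_dyadic Q))
         \<ge> 1 - C * exp (- Min ((\<lambda>q. ln (real q / H q) powr (3/4)) ` primes_dyadic Q))"
    unfolding Let_def \<mu>_def by blast
  moreover have "P \<subseteq> {q. prime q}" by (auto simp: P_def good_primes_def)
  moreover have "weak_conv_filter (\<lambda>q. legendre_sum_law q (H q)) std_normal_distribution (at_top_within P)"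
    unfolding P_def by (rule good_primes_clt)
  ultimately show ?thesis by blast
qed

end
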